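(* Let $v\in\mathbb{X}$, let $f\colon\mathbf{G}\to\mathbb{R}$ be measurable and let $0<t_0<t_1<\infty$. Assume that $|f|^v(t)<\infty$ for each $t\in[t_0,t_1]$. Assume moreover that for each $\varepsilon\in(0,t_1-t_0)$ $$\lim_{n\to\infty}\ \sup_{t\in[t_0+\varepsilon,t_1]}\Big|\sum_{k>n}\frac{d}{dt}f^v_k(t)\Big|=0 .$$ Then $f^v$ is continuously differentiable on $(t_0,t_1]$ (with one-sided derivative at $t_1$), with derivative given by $$\frac{d}{dt}f^v(t)=\lim_{n\to\infty}\frac{d}{dt}f^v_{\le n}(t)=\sum_{n=1}^\infty\frac{d}{dt}f^v_n(t),\qquad t\in(t_0,t_1].$$
   Context: Setting. $\mathbb{X}$ is a complete separable metric space with Borel $\sigma$-field; $\lambda$ is a locally finite (finite on bounded Borel sets) and diffuse measure on $\mathbb{X}$; $\varphi\colon\mathbb{X}^2\to[0,1]$ is measurable and symmetric with $D_\varphi(x):=\int\varphi(x,y)\,\lambda(dy)<\infty$ for $\lambda$-a.e. $x\in\mathbb{X}$. $\mathbf{G}$ is the space of undirected loop-free graphs $\mu$ whose vertex set $V(\mu)$ is a locally finite subset of $\mathbb{X}$; formally $\mu$ is a counting measure with one atom $(x,\psi_x)$ per vertex $x$, where $\psi_x$ is the (counting measure of the) set of neighbours of $x$, and $\mathbf{G}$ carries the standard $\sigma$-field generated by the evaluation maps. $|\mu|=|V(\mu)|$ is the number of vertices. For $t>0$, under $\mathbb{P}_t$ (expectation $\mathbb{E}_t$), $\eta$ is a Poisson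 process on $\mathbb{X}$ with intensity measure $t\lambda$. For $v\in\mathbb{X}$, $\xi^v$ is the random graph with vertex set $\eta\cup\{v\}$ in which, given $\eta$, each pair of distinct vertices $x,y$ is joined by an edge with probability $\varphi(x,y)$, independently for different pairs. $C^v$ is the connected component of $v$ in $\xi^v$, as a graph. For $n\in\mathbb{N}$ put $$f^v_n(t):=\mathbb{E}_t\big[f(C^v)\mathbf{1}\{|C^v|=n\}\big],\quad f^v_{\le n}(t):=\mathbb{E}_t\big[f(C^v)\mathbf{1}\{|C^v|\le n\}\big],\quad f^v(t):=\mathbb{E}_t\big[f(C^v)\mathbf{1}\{|C^v|<\infty\}\big],$$ and $|f|^v(t):=\mathbb{E}_t\big[|f(C^v)|\mathbf{1}\{|C^v|<\infty\}\big]$. (If $|f|^v(t_0)<\infty$, then each $f^v_n$ is differentiable on $(t_0,\infty)$, so the derivatives in the hypothesis make sense; convergence of the series there is part of the hypothesis.) *)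

theory Defs
  imports "HOL-Probability.Probability"
begin

section \<open>Point configurations\<close>

text \<open>The cardinality of \<open>A\<close>, with value \<open>\<infinity>\<close> for infinite \<open>A\<close>.\<close>

definition num :: "'b set \<Rightarrow> ennreal" where
  "num A = emeasure (count_space UNIV) A"

definition loc_finite :: "'a::metric_space set \<Rightarrow> bool" where
  "loc_finite S \<longleftrightarrow> (\<forall>B. bounded B \<longrightarrow> finite (S \<inter> B))"

text \<open>A simple counting measure is identified with its set of atoms; it then gives mass
  \<open>num (S \<inter> B)\<close> to \<open>B\<close>.\<close>

definition point_space :: "'a::metric_space set measure" where
  "point_space = (SUP B \<in> sets borel.
     vimage_algebra {S. loc_finite S} (\<lambda>S. num (S \<inter> B)) borel)"

text \<open>For a diffuse locally finite \<open>\<nu>\<close> a Poisson process with intensity measure \<open>\<nu>\<close> is simple,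
  hence can be realised as a random locally finite set.\<close>

definition poisson_process ::
  "'w measure \<Rightarrow> 'a::metric_space measure \<Rightarrow> ('w \<Rightarrow> 'a set) \<Rightarrow> bool" where
  "poisson_process M \<nu> \<eta> \<longleftrightarrow>
     prob_space M \<and> \<eta> \<in> M \<rightarrow>\<^sub>M point_space \<and>
     (\<forall>B\<in>sets borel. emeasure \<nu> B < \<infinity> \<longrightarrow>
        (\<forall>k::nat. measure M {\<omega>\<in>space M. num (\<eta> \<omega> \<inter> B) = of_nat k}
                  = measure \<nu> B ^ k / fact k * exp (- measure \<nu> B))) \<and>
     (\<forall>B\<in>sets borel. emeasure \<nu> B = \<infinity> \<longrightarrow> (AE \<omega> in M. num (\<eta> \<omega> \<inter> B) = \<infinity>)) \<and>
     (\<forall>(B :: nat \<Rightarrow> 'a set) m. (\<forall>i<m. B i \<in> sets borel) \<and> disjoint_family_on B {..<m} \<longrightarrow>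
        prob_space.indep_vars M (\<lambda>_. borel) (\<lambda>i \<omega>. num (\<eta> \<omega> \<inter> B i)) {..<m})"

section \<open>Graphs\<close>

text \<open>A graph is the set of its atoms \<open>(x, N)\<close>, one for each vertex \<open>x\<close>, where \<open>N\<close> is the set of
  neighbours of \<open>x\<close>.\<close>

type_synonym 'a graph = "('a \<times> 'a set) set"

definition verts :: "'a graph \<Rightarrow> 'a set" where
  "verts \<mu> = fst ` \<mu>"

definition adj :: "'a graph \<Rightarrow> ('a \<times> 'a) set" where
  "adj \<mu> = {(x, y). \<exists>N. (x, N) \<in> \<mu> \<and> y \<in> N}"

definition graphs :: "'a::metric_space graph set" where
  "graphs = {\<mu>. inj_on fst \<mu> \<and> loc_finite (verts \<mu>) \<and>
     adj \<mu> \<subseteq> verts \<mu> \<times> verts \<mu> \<and> irrefl (adj \<mu>) \<and> sym (adj \<mu>)}"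

definition graph_space :: "'a::metric_space graph measure" where
  "graph_space = (SUP A \<in> sets (borel \<Otimes>\<^sub>M point_space).
     vimage_algebra graphs (\<lambda>\<mu>. num (\<mu> \<inter> A)) borel)"

text \<open>Since the component of \<open>v\<close> contains all neighbours of its vertices, the induced subgraph
  is obtained by just keeping the atoms belonging to its vertices.\<close>

definition component :: "'a \<Rightarrow> 'a graph \<Rightarrow> 'a graph" where
  "component v \<mu> = {(x, N) \<in> \<mu>. (v, x) \<in> (adj \<mu>)\<^sup>*}"

section \<open>The random connection model\<close>

definition pairs :: "'a set \<Rightarrow> 'a set set" where
  "pairs W = {{x, y} | x y. x \<in> W \<and> y \<in> W \<and> x \<noteq> y}"

definition mk_graph :: "'a set \<Rightarrow> 'a set set \<Rightarrow> 'a graph" where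
  "mk_graph W E = (\<lambda>x. (x, {y \<in> W. {x, y} \<in> E \<and> x \<noteq> y})) ` W"

text \<open>\<open>edge_prob \<phi> {x, y} = \<phi> x y\<close> for symmetric \<open>\<phi>\<close>, see below.\<close>

definition edge_prob :: "('a \<Rightarrow> 'a \<Rightarrow> real) \<Rightarrow> 'a set \<Rightarrow> real" where
  "edge_prob \<phi> e = (THE p. \<exists>x y. e = {x, y} \<and> p = \<phi> x y)"

text \<open>The law of the random graph with the deterministic vertex set \<open>W\<close> in which the edges
  \<open>{x, y}\<close> are present independently of each other with probabilities \<open>\<phi> x y\<close>.\<close>

definition graph_law :: "('a \<Rightarrow> 'a \<Rightarrow> real) \<Rightarrow> 'a::metric_space set \<Rightarrow> 'a graph measure" where
  "graph_law \<phi> W =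
     distr (\<Pi>\<^sub>M e\<in>pairs W. measure_pmf (bernoulli_pmf (edge_prob \<phi> e))) graph_space
       (\<lambda>b. mk_graph W {e \<in> pairs W. b e})"

text \<open>\<open>\<xi>\<close> is a random graph whose conditional law given \<open>\<eta>\<close> is that of the random connection model
  on the vertex set \<open>\<eta> \<union> {v}\<close>.\<close>

definition rcm ::
  "'w measure \<Rightarrow> ('a \<Rightarrow> 'a \<Rightarrow> real) \<Rightarrow> ('w \<Rightarrow> 'a::metric_space set) \<Rightarrow> 'a \<Rightarrow> ('w \<Rightarrow> 'a graph) \<Rightarrow> bool"
  where
  "rcm M \<phi> \<eta> v \<xi> \<longleftrightarrow>
     \<xi> \<in> M \<rightarrow>\<^sub>M graph_space \<and>
     (\<forall>H\<in>sets point_space. \<forall>A\<in>sets graph_space.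
        emeasure M {\<omega>\<in>space M. \<eta> \<omega> \<in> H \<and> \<xi> \<omega> \<in> A}
        = (\<integral>\<^sup>+\<omega>. emeasure (graph_law \<phi> (insert v (\<eta> \<omega>))) A * indicator H (\<eta> \<omega>) \<partial>M))"

text \<open>The functions \<open>f\<^sub>n\<^sup>v\<close>, \<open>f\<^sub>\<le>\<^sub>n\<^sup>v\<close>, \<open>f\<^sup>v\<close> and \<open>|f|\<^sup>v\<close> of the intensity \<open>t\<close>; \<open>P t\<close> is the probability
  measure under which the Poisson process has intensity \<open>t\<close>, and \<open>\<xi>\<close> is the graph \<open>\<xi>\<^sup>v\<close>.\<close>

context
  fixes P :: "real \<Rightarrow> 'w measure" and \<xi> :: "'w \<Rightarrow> 'a::metric_space graph"
    and v :: 'a and f :: "'a graph \<Rightarrow> real"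
begin

definition mean_eq :: "nat \<Rightarrow> real \<Rightarrow> real" where
  "mean_eq n t = (\<integral>\<omega>. f (component v (\<xi> \<omega>)) *
     indicator {\<mu>. num (verts \<mu>) = of_nat n} (component v (\<xi> \<omega>)) \<partial>P t)"

definition mean_le :: "nat \<Rightarrow> real \<Rightarrow> real" where
  "mean_le n t = (\<integral>\<omega>. f (component v (\<xi> \<omega>)) *
     indicator {\<mu>. num (verts \<mu>) \<le> of_nat n} (component v (\<xi> \<omega>)) \<partial>P t)"

definition mean_fin :: "real \<Rightarrow> real" where
  "mean_fin t = (\<integral>\<omega>. f (component v (\<xi> \<omega>)) *
     indicator {\<mu>. num (verts \<mu>) < \<infinity>} (component v (\<xi> \<omega>)) \<partial>P t)"

definition abs_mean_fin :: "real \<Rightarrow> ennreal" where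
  "abs_mean_fin t = (\<integral>\<^sup>+\<omega>. ennreal \<bar>f (component v (\<xi> \<omega>))\<bar> *
     indicator {\<mu>. num (verts \<mu>) < \<infinity>} (component v (\<xi> \<omega>)) \<partial>P t)"

end

section \<open>Basic properties\<close>

lemma space_point_space: "space point_space = {S. loc_finite S}"
proof -
  have "(sets borel :: 'a set set) \<noteq> {}" by auto
  then show ?thesis by (auto simp: point_space_def space_Sup_eq_UN)
qed

lemma space_graph_space: "space graph_space = graphs"
proof -
  have "sets (borel \<Otimes>\<^sub>M point_space :: ('a \<times> 'a set) measure) \<noteq> {}" by auto
  then show ?thesis by (auto simp: graph_space_def space_Sup_eq_UN)
qed

lemma edge_prob_doubleton:
  assumes "\<And>x y. \<phi> x y = \<phi> y x"
  shows "edge_prob \<phi> {x, y} = \<phi> x y"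
  unfolding edge_prob_def by (rule the_equality) (use assms in \<open>auto simp: doubleton_eq_iff\<close>)

lemma loc_finite_subset: "loc_finite W \<Longrightarrow> S \<subseteq> W \<Longrightarrow> loc_finite S"
  unfolding loc_finite_def by (meson Int_mono finite_subset order_refl)

lemma loc_finite_insert: "loc_finite W \<Longrightarrow> loc_finite (insert v W)"
  unfolding loc_finite_def by (simp add: Int_insert_left)

lemma loc_finite_countable:
  assumes "loc_finite (W :: 'a::metric_space set)"
  shows "countable W"
proof (cases "W = {}")
  case False
  then obtain a where "a \<in> W" by auto
  have "W = (\<Union>n::nat. W \<inter> cball a (real n))"
    using real_arch_simple by (auto simp: mem_cball)
  moreover have "finite (W \<inter> cball a (real n))" for n
    using assms by (auto simp: loc_finite_def)
  then have "countable (\<Union>n::nat. W \<inter> cball a (real n))"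
    by (meson countableI_type countable_UN countable_finite)
  ultimately show ?thesis by metis
qed auto

lemma verts_mk_graph: "verts (mk_graph W E) = W"
  by (force simp: verts_def mk_graph_def)

lemma adj_mk_graph: "adj (mk_graph W E) = {(x, y). x \<in> W \<and> y \<in> W \<and> x \<noteq> y \<and> {x, y} \<in> E}"
  by (auto simp: adj_def mk_graph_def)

lemma mk_graph_in_graphs: "loc_finite W \<Longrightarrow> mk_graph W E \<in> graphs"
  unfolding graphs_def mem_Collect_eq verts_mk_graph adj_mk_graph
  by (auto simp: mk_graph_def irrefl_def sym_def insert_commute intro!: inj_onI)

lemma component_in_graphs:
  assumes "\<mu> \<in> graphs"
  shows "component v \<mu> \<in> graphs"
proof -
  have sub: "component v \<mu> \<subseteq> \<mu>" by (auto simp: component_def)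
  have adj: "adj (component v \<mu>) = {(x, y) \<in> adj \<mu>. (v, x) \<in> (adj \<mu>)\<^sup>*}"
    by (auto simp: adj_def component_def)
  have vert: "verts (component v \<mu>) = {x \<in> verts \<mu>. (v, x) \<in> (adj \<mu>)\<^sup>*}"
    by (force simp: verts_def component_def)
  show ?thesis
    unfolding graphs_def mem_Collect_eq
  proof (intro conjI)
    show "inj_on fst (component v \<mu>)"
      using assms sub inj_on_subset by (auto simp: graphs_def)
    show "loc_finite (verts (component v \<mu>))"
      using assms by (auto simp: graphs_def vert elim: loc_finite_subset)
    show "adj (component v \<mu>) \<subseteq> verts (component v \<mu>) \<times> verts (component v \<mu>)"
      using assms by (auto simp: graphs_def vert adj intro: rtrancl_into_rtrancl)
    show "irrefl (adj (component v \<mu>))"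
      using assms by (auto simp: graphs_def adj irrefl_def)
    show "sym (adj (component v \<mu>))"
      using assms by (auto simp: graphs_def adj sym_def intro: rtrancl_into_rtrancl)
  qed
qed

lemma measurable_num:
  assumes W: "countable W" "\<And>b. b \<in> space M \<Longrightarrow> S b \<subseteq> W"
    and S: "\<And>x. x \<in> W \<Longrightarrow> Measurable.pred M (\<lambda>b. x \<in> S b)"
  shows "(\<lambda>b. num (S b)) \<in> borel_measurable M"
proof -
  interpret sigma_finite_measure "count_space W"
    using W(1) by (rule sigma_finite_measure_count_space_countable)
  have "(\<lambda>p. indicator (S (snd p)) (fst p) :: ennreal) \<in> borel_measurable (count_space W \<Otimes>\<^sub>M M)"
  proof (rule measurable_pair_measure_countable1[OF W(1)])
    fix x assume "x \<in> W"
    then have [measurable]: "Measurable.pred M (\<lambda>b. x \<in> S b)" by (rule S)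
    have "(\<lambda>b. if x \<in> S b then 1 else 0 :: ennreal) \<in> borel_measurable M" by measurable
    then show "(\<lambda>b. indicator (S (snd (x, b))) (fst (x, b)) :: ennreal) \<in> borel_measurable M"
      by (simp add: indicator_def of_bool_def)
  qed
  then have "(\<lambda>p. indicator (S (fst p)) (snd p) :: ennreal) \<in> borel_measurable (M \<Otimes>\<^sub>M count_space W)"
    by (subst (asm) measurable_pair_swap_iff) (simp add: case_prod_beta)
  then have "(\<lambda>b. \<integral>\<^sup>+x. indicator (S b) x \<partial>count_space W) \<in> borel_measurable M"
    by (intro borel_measurable_nn_integral) (simp add: case_prod_beta')
  moreover have "num (S b) = (\<integral>\<^sup>+x. indicator (S b) x \<partial>count_space W)" if "b \<in> space M" for b
  proof -
    have "num (S b) = (\<integral>\<^sup>+x. indicator (S b) x \<partial>count_space UNIV)"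
      by (simp add: num_def)
    also have "\<dots> = (\<integral>\<^sup>+x. indicator (S b) x \<partial>count_space W)"
      by (rule nn_integral_count_space_eq) (use W(2)[OF that] in \<open>auto simp: indicator_def\<close>)
    finally show ?thesis .
  qed
  ultimately show ?thesis by (simp cong: measurable_cong)
qed

lemma num_image: "inj_on g S \<Longrightarrow> num (g ` S) = num S"
  by (cases "finite S") (auto simp: num_def emeasure_count_space card_image finite_image_iff)

text \<open>The map in the definition of \<open>graph_law\<close> is measurable, so the \<open>distr\<close> there is a genuine
  image measure.\<close>

lemma measurable_mk_graph:
  fixes W :: "'a::metric_space set"
  assumes "loc_finite W"
  shows "(\<lambda>b. mk_graph W {e \<in> pairs W. b e}) \<in>
    (\<Pi>\<^sub>M e\<in>pairs W. measure_pmf (Q e)) \<rightarrow>\<^sub>M graph_space" (is "?g \<in> ?M \<rightarrow>\<^sub>M _")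
proof -
  have W: "countable W" using assms by (rule loc_finite_countable)
  define nb where "nb x b = {y \<in> W. {x, y} \<in> {e \<in> pairs W. b e} \<and> x \<noteq> y}"
    for x and b :: "'a set \<Rightarrow> bool"
  have g: "?g b = (\<lambda>x. (x, nb x b)) ` W" for b
    by (simp add: mk_graph_def nb_def)
  have edge: "Measurable.pred ?M (\<lambda>b. e \<in> pairs W \<and> b e)" for e
  proof (cases "e \<in> pairs W")
    case True
    then have "(\<lambda>b. b e) \<in> ?M \<rightarrow>\<^sub>M measure_pmf (Q e)" by (rule measurable_component_singleton)
    with True show ?thesis by simp
  qed simp
  have nb: "nb x \<in> ?M \<rightarrow>\<^sub>M point_space" for x
    unfolding point_space_def
  proof (rule measurable_Sup2)
    fix m :: "'a set measure"
    assume "m \<in> (\<lambda>B. vimage_algebra {S. loc_finite S} (\<lambda>S. num (S \<inter> B)) borel) ` sets borel"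
    then obtain B :: "'a set" where m: "m = vimage_algebra {S. loc_finite S} (\<lambda>S. num (S \<inter> B)) borel"
      by auto
    have "(\<lambda>b. num (nb x b \<inter> B)) \<in> borel_measurable ?M"
    proof (rule measurable_num[OF W])
      fix y assume "y \<in> W"
      show "Measurable.pred ?M (\<lambda>b. y \<in> nb x b \<inter> B)"
        using edge[of "{x, y}"] \<open>y \<in> W\<close> by (cases "x \<noteq> y \<and> y \<in> B") (auto simp: nb_def)
    qed (auto simp: nb_def)
    then show "nb x \<in> ?M \<rightarrow>\<^sub>M m"
      unfolding m using assms
      by (intro measurable_vimage_algebra2) (auto simp: nb_def elim: loc_finite_subset)
  qed auto
  show ?thesis
    unfolding graph_space_def
  proof (rule measurable_Sup2)
    fix m :: "'a graph measure"
    assume "m \<in> (\<lambda>A. vimage_algebra graphs (\<lambda>\<mu>. num (\<mu> \<inter> A)) borel) `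
      sets (borel \<Otimes>\<^sub>M point_space :: ('a \<times> 'a set) measure)"
    then obtain A :: "('a \<times> 'a set) set" where A[measurable]: "A \<in> sets (borel \<Otimes>\<^sub>M point_space)"
      and m: "m = vimage_algebra graphs (\<lambda>\<mu>. num (\<mu> \<inter> A)) borel"
      by auto
    have "num (?g b \<inter> A) = num {x \<in> W. (x, nb x b) \<in> A}" for b
    proof -
      have "?g b \<inter> A = (\<lambda>x. (x, nb x b)) ` {x \<in> W. (x, nb x b) \<in> A}"
        unfolding g by auto
      then show ?thesis by (simp add: num_image inj_on_def)
    qed
    moreover have "(\<lambda>b. num {x \<in> W. (x, nb x b) \<in> A}) \<in> borel_measurable ?M"
    proof (rule measurable_num[OF W])
      fix x assume "x \<in> W"
      have "Measurable.pred ?M (\<lambda>b. (x, nb x b) \<in> A)"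
        using nb[of x] by measurable
      then show "Measurable.pred ?M (\<lambda>b. x \<in> {x \<in> W. (x, nb x b) \<in> A})"
        using \<open>x \<in> W\<close> by simp
    qed auto
    ultimately have "(\<lambda>b. num (?g b \<inter> A)) \<in> borel_measurable ?M" by simp
    then show "?g \<in> ?M \<rightarrow>\<^sub>M m"
      unfolding m using assms
      by (intro measurable_vimage_algebra2) (auto intro: mk_graph_in_graphs)
  qed auto
qed

end

theory Submission
  imports Defs
begin

text \<open>
  The reason for the differentiability of the means is an explicit change of intensity. Let \<open>C\<close> be
  the cluster of \<open>v\<close>, with vertex set \<open>V\<close>, and put
  \<open>hit V = \<integral> (1 - (\<Prod>x\<in>V. 1 - \<phi> x y)) \<lambda>(dy)\<close>. For the cluster to have \<open>n\<close> given vertices, \<open>n - 1\<close> of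
  them have to belong to the Poisson process, which contributes a factor proportional to
  \<open>t ^ (n - 1)\<close>; and no other point of the process may be joined to \<open>V\<close>, which has the probability
  \<open>exp (- t * hit V)\<close>. The remaining factors do not involve \<open>t\<close>. So on the event that \<open>C\<close> has \<open>n\<close>
  vertices, the law of \<open>C\<close> at intensity \<open>t > s\<close> has the density
  \<open>(t / s) ^ (n - 1) * exp (- (t - s) * hit V)\<close> with respect to the law at intensity \<open>s\<close>
  (\<open>nn_integral_change_intensity\<close>). With \<open>s = t\<^sub>0\<close> this writes \<open>mean_eq n\<close> on \<open>(t\<^sub>0, \<infinity>)\<close> as a power of \<open>t\<close>
  times the Laplace transform, at \<open>t - t\<^sub>0\<close>, of a finite signed measure (\<open>mean_eq_laplace\<close>).
  Such functions are continuously differentiable, also at and to the right of \<open>t\<^sub>1\<close>. The theorem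
  then follows from the rule for termwise differentiation: the series of the means converges by
  dominated convergence, and the hypothesis on the tails says that the series of the derivatives
  converges uniformly on every interval \<open>[t\<^sub>0 + \<epsilon>, t\<^sub>1]\<close>.

  The change of intensity is first proved in a bounded window, where everything is finite. There the
  Poisson process is a mixture of the laws of finitely many independent points; by Renyi's theorem
  (\<open>measure_eqI_void\<close>) it suffices to compare the probabilities that a set contains no point. For
  finitely many points the random graph is a finite sum over edge sets, and
  \<open>nn_integral_component_eq\<close> isolates the component of \<open>v\<close>. Summation over the number of points
  gives the cluster formula \<open>nn_integral_poisson_law_component\<close>. Finally the window grows to the whole
  space: a finite cluster is eventually contained in the window, and an infinite one eventually
  shows too many vertices.

  Measurability deserves care, since graphs are coded as sets of atoms. Two devices are
  used throughout. Points, or atoms, of a random locally finite set can be counted and quantified over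
  even if they are selected by a property that depends on the outcome (\<open>measurable_num_Collect\<close>);
  this yields the measurability of the component. And functions of finite sets can be treated along
  enumerations (\<open>measurable_on_finite_sets\<close>); this yields the measurability of the law of the
  random graph in its vertex set.
\<close>

section \<open>Cardinalities of random sets\<close>

lemma num_finite: "finite A \<Longrightarrow> num A = of_nat (card A)"
  by (simp add: num_def emeasure_count_space)

lemma num_infinite: "infinite A \<Longrightarrow> num A = \<infinity>"
  by (simp add: num_def emeasure_count_space)

lemma num_eq_0_iff: "num A = 0 \<longleftrightarrow> A = {}"
  by (cases "finite A") (auto simp: num_finite num_infinite)

lemma num_eq_of_nat_iff: "num A = of_nat n \<longleftrightarrow> finite A \<and> card A = n"
  by (cases "finite A") (auto simp: num_finite num_infinite ennreal_of_nat_eq_real_of_nat)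

lemma num_less_top_iff: "num A < \<infinity> \<longleftrightarrow> finite A"
  by (cases "finite A") (auto simp: num_finite num_infinite ennreal_of_nat_eq_real_of_nat)

lemma num_le_of_nat_iff: "num A \<le> of_nat n \<longleftrightarrow> finite A \<and> card A \<le> n"
  by (cases "finite A")
    (auto simp: num_finite num_infinite top_unique ennreal_of_nat_eq_real_of_nat ennreal_le_iff2)

lemma of_nat_le_num_iff: "of_nat n \<le> num A \<longleftrightarrow> (\<exists>F\<subseteq>A. finite F \<and> card F = n)"
proof (cases "finite A")
  case True
  then show ?thesis
    by (auto simp: num_finite ennreal_of_nat_eq_real_of_nat ennreal_le_iff2 card_mono
        intro: card_mono)
      (meson obtain_subset_with_card_n)
next
  case False
  then show ?thesis
    using infinite_arbitrarily_large[OF False] by (auto simp: num_infinite)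
qed

lemma borel_measurable_indicator_pred:
  "Measurable.pred M P \<Longrightarrow> (\<lambda>x. indicator {x. P x} x :: ennreal) \<in> borel_measurable M"
  by (subst borel_measurable_indicator_iff) (simp add: pred_def Int_def conj_commute)

text \<open>The sets \<open>A\<close> for which \<open>num (U \<omega> \<inter> A)\<close> is measurable form a Dynkin system as long as the counts
  are finite, since complements need a subtraction. Hence the counts are first restricted to the
  sets \<open>B k\<close>, on which they are finite, and \<open>k\<close> tends to infinity at the end.\<close>

lemma measurable_num_Int_generated:
  fixes U :: "'w \<Rightarrow> 'b set" and B :: "nat \<Rightarrow> 'b set"
  assumes G: "Int_stable G" "G \<subseteq> Pow X" and A: "A \<in> sigma_sets X G"
    and B: "\<And>k. B k \<in> G" "incseq B" "(\<Union>k. B k) = X"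
    and fin: "\<And>\<omega> k. \<omega> \<in> space \<Omega> \<Longrightarrow> finite (U \<omega> \<inter> B k)"
    and meas: "\<And>A. A \<in> G \<Longrightarrow> (\<lambda>\<omega>. num (U \<omega> \<inter> A)) \<in> borel_measurable \<Omega>"
  shows "(\<lambda>\<omega>. num (U \<omega> \<inter> A)) \<in> borel_measurable \<Omega>"
proof -
  have *: "(\<lambda>\<omega>. num (U \<omega> \<inter> (B k \<inter> A))) \<in> borel_measurable \<Omega>" for k
    using G A
  proof (induction rule: sigma_sets_induct_disjoint)
    case (basic A)
    then show ?case using G(1) B(1)[of k] meas by (auto simp: Int_stable_def)
  next
    case empty
    then show ?case by simp
  next
    case (compl A)
    have "num (U \<omega> \<inter> (B k \<inter> (X - A))) = num (U \<omega> \<inter> B k) - num (U \<omega> \<inter> (B k \<inter> A))"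
      if "\<omega> \<in> space \<Omega>" for \<omega>
    proof -
      have "U \<omega> \<inter> (B k \<inter> (X - A)) = U \<omega> \<inter> B k - U \<omega> \<inter> (B k \<inter> A)"
        using B(3) by auto
      moreover have "finite (U \<omega> \<inter> (B k \<inter> A))"
        using fin[OF that, of k] by (rule finite_subset[rotated]) auto
      ultimately show ?thesis
        using fin[OF that, of k] unfolding num_def
        by (simp only:) (rule emeasure_Diff, auto simp: emeasure_count_space)
    qed
    then show ?case
      using compl meas[OF B(1)[of k]] by (simp cong: measurable_cong)
  next
    case (union A)
    have "num (U \<omega> \<inter> (B k \<inter> (\<Union>i. A i))) = (\<Sum>i. num (U \<omega> \<inter> (B k \<inter> A i)))" for \<omega>
      unfolding num_def using union(1)
      by (subst suminf_emeasure) (auto simp: disjoint_family_on_def intro!: arg_cong[where f="emeasure _"])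
    then show ?case using union by simp
  qed
  have "num (U \<omega> \<inter> A) = (SUP k. num (U \<omega> \<inter> (B k \<inter> A)))" for \<omega>
  proof -
    have "A \<subseteq> X" using A G(2) by (rule sigma_sets_into_sp[rotated])
    then have "U \<omega> \<inter> A = (\<Union>k. U \<omega> \<inter> (B k \<inter> A))" using B(3) by auto
    then show ?thesis
      unfolding num_def using B(2)
      by (subst SUP_emeasure_incseq) (auto simp: incseq_def intro!: arg_cong[where f="emeasure _"])
  qed
  then show ?thesis using * by simp
qed

text \<open>Points of a random set may be selected by a property that depends on the outcome itself. This is
  what makes existential quantification over the points of a process, or over the atoms of a random
  graph, measurable, although the quantifier ranges over an uncountable space.\<close>

lemma measurable_num_Collect:
  fixes U :: "'w \<Rightarrow> 'b set" and B :: "nat \<Rightarrow> 'b set"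
  assumes Q: "Measurable.pred (\<Omega> \<Otimes>\<^sub>M M) (\<lambda>(\<omega>, p). Q \<omega> p)"
    and B: "\<And>k. B k \<in> sets M" "incseq B" "(\<Union>k. B k) = space M"
    and U: "\<And>\<omega>. \<omega> \<in> space \<Omega> \<Longrightarrow> U \<omega> \<subseteq> space M"
    and fin: "\<And>\<omega> k. \<omega> \<in> space \<Omega> \<Longrightarrow> finite (U \<omega> \<inter> B k)"
    and meas: "\<And>A. A \<in> sets M \<Longrightarrow> (\<lambda>\<omega>. num (U \<omega> \<inter> A)) \<in> borel_measurable \<Omega>"
  shows "(\<lambda>\<omega>. num {p \<in> U \<omega>. Q \<omega> p}) \<in> borel_measurable \<Omega>"
proof -
  define G where "G = {a \<times> b | a b. a \<in> sets \<Omega> \<and> b \<in> sets M}"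
  define A where "A = {z \<in> space (\<Omega> \<Otimes>\<^sub>M M). case z of (\<omega>, p) \<Rightarrow> Q \<omega> p}"
  \<comment> \<open>In the product space the selected points are the intersection with the fixed set \<open>A\<close>.\<close>
  define U' where "U' \<omega> = {\<omega>} \<times> U \<omega>" for \<omega>
  have A: "A \<in> sigma_sets (space \<Omega> \<times> space M) G"
    using Q by (simp add: pred_def A_def G_def sets_pair_measure[symmetric])
  have *: "num (U' \<omega> \<inter> a \<times> b) = num (U \<omega> \<inter> b) * indicator a \<omega>" for \<omega> a b
  proof -
    have "U' \<omega> \<inter> a \<times> b = (if \<omega> \<in> a then Pair \<omega> ` (U \<omega> \<inter> b) else {})"
      by (auto simp: U'_def)
    then show ?thesis
      by (auto simp: num_image inj_on_def num_eq_0_iff)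
  qed
  have "(\<lambda>\<omega>. num (U' \<omega> \<inter> A)) \<in> borel_measurable \<Omega>"
  proof (rule measurable_num_Int_generated[OF _ _ A, where B="\<lambda>k. space \<Omega> \<times> B k"])
    show "Int_stable G" unfolding G_def by (rule Int_stable_pair_measure_generator)
    show "G \<subseteq> Pow (space \<Omega> \<times> space M)" unfolding G_def by (rule pair_measure_closed)
    show "space \<Omega> \<times> B k \<in> G" for k using B(1) by (auto simp: G_def)
    show "incseq (\<lambda>k. space \<Omega> \<times> B k)" using B(2) by (auto simp: incseq_def)
    show "(\<Union>k. space \<Omega> \<times> B k) = space \<Omega> \<times> space M" using B(3) by auto
    show "finite (U' \<omega> \<inter> space \<Omega> \<times> B k)" if "\<omega> \<in> space \<Omega>" for \<omega> k
    proof -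
      have "U' \<omega> \<inter> space \<Omega> \<times> B k \<subseteq> Pair \<omega> ` (U \<omega> \<inter> B k)" by (auto simp: U'_def)
      then show ?thesis using fin[OF that, of k] by (meson finite_imageI finite_subset)
    qed
    show "(\<lambda>\<omega>. num (U' \<omega> \<inter> C)) \<in> borel_measurable \<Omega>" if "C \<in> G" for C
      using that meas by (auto simp: G_def *)
  qed
  moreover have "num (U' \<omega> \<inter> A) = num {p \<in> U \<omega>. Q \<omega> p}" if "\<omega> \<in> space \<Omega>" for \<omega>
  proof -
    have "U' \<omega> \<inter> A = Pair \<omega> ` {p \<in> U \<omega>. Q \<omega> p}"
      using that U[OF that] by (auto simp: U'_def A_def space_pair_measure)
    then show ?thesis by (simp add: num_image inj_on_def)
  qed
  ultimately show ?thesis by (simp cong: measurable_cong)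
qed

section \<open>Random locally finite sets\<close>

lemma measurable_num_point:
  assumes "B \<in> sets borel"
  shows "(\<lambda>S. num (S \<inter> B)) \<in> borel_measurable (point_space :: 'a::metric_space set measure)"
proof -
  have "(\<lambda>S. num (S \<inter> B)) \<in> borel_measurable
      (vimage_algebra {S. loc_finite S} (\<lambda>S :: 'a set. num (S \<inter> B)) borel)"
    by (rule measurable_vimage_algebra1) auto
  then show ?thesis
    unfolding point_space_def using assms by (intro measurable_Sup1) auto
qed

lemma measurable_void [measurable]:
  assumes [measurable]: "B \<in> sets borel"
  shows "Measurable.pred (point_space :: 'a::metric_space set measure) (\<lambda>S. S \<inter> B = {})"
  using measurable_num_point[OF assms] unfolding num_eq_0_iff[symmetric] by measurable

text \<open>Distinct points of a Hausdorff space can be told apart by disjoint members of a base; for a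
  countable base this reduces the counting of points to countably many void events.\<close>

lemma separated_by_base:
  fixes x :: "nat \<Rightarrow> 'a::{t2_space}"
  assumes "inj_on x {..<n}" and base: "topological_basis \<B>"
  shows "\<exists>L. set L \<subseteq> \<B> \<and> length L = n \<and> disjoint_family_on ((!) L) {..<n} \<and> (\<forall>i<n. x i \<in> L ! i)"
proof -
  have "\<exists>V. \<forall>i j. i < n \<and> j < n \<and> i \<noteq> j \<longrightarrow>
      open (V i j) \<and> x i \<in> V i j \<and> V i j \<inter> V j i = {}"
  proof -
    have "\<exists>V. \<forall>i j. i < j \<and> j < n \<longrightarrow> open (fst (V i j)) \<and> open (snd (V i j)) \<and> x i \<in> fst (V i j)
      \<and> x j \<in> snd (V i j) \<and> fst (V i j) \<inter> snd (V i j) = {}"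
    proof (intro choice allI)
      fix i j
      show "\<exists>y. i < j \<and> j < n \<longrightarrow> open (fst y) \<and> open (snd y) \<and> x i \<in> fst y
        \<and> x j \<in> snd y \<and> fst y \<inter> snd y = {}"
      proof (cases "i < j \<and> j < n")
        case True
        then have "x i \<noteq> x j" using assms(1) by (auto simp: inj_on_def)
        from hausdorff[OF this] show ?thesis by auto
      qed auto
    qed
    then obtain V where V: "\<And>i j. i < j \<Longrightarrow> j < n \<Longrightarrow>
      open (fst (V i j)) \<and> open (snd (V i j)) \<and> x i \<in> fst (V i j)
      \<and> x j \<in> snd (V i j) \<and> fst (V i j) \<inter> snd (V i j) = {}" by blast
    show ?thesis
      by (rule exI[of _ "\<lambda>i j. if i < j then fst (V i j) else snd (V j i)"])
        (use V in \<open>auto simp: neq_iff Int_commute\<close>)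
  qed
  then obtain V where V: "\<And>i j. i < n \<Longrightarrow> j < n \<Longrightarrow> i \<noteq> j \<Longrightarrow>
      open (V i j) \<and> x i \<in> V i j \<and> V i j \<inter> V j i = {}" by blast
  have "\<exists>b. i < n \<longrightarrow> b \<in> \<B> \<and> x i \<in> b \<and> b \<subseteq> (\<Inter>j\<in>{..<n} - {i}. V i j)" for i
  proof (cases "i < n")
    case True
    have "open (\<Inter>j\<in>{..<n} - {i}. V i j)" "x i \<in> (\<Inter>j\<in>{..<n} - {i}. V i j)"
      using V True by (auto intro!: open_INT)
    then show ?thesis using topological_basisE[OF base] by metis
  qed auto
  then obtain b where b: "\<And>i. i < n \<Longrightarrow> b i \<in> \<B> \<and> x i \<in> b i \<and> b i \<subseteq> (\<Inter>j\<in>{..<n} - {i}. V i j)"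
    by metis
  have "b i \<inter> b j = {}" if "i < n" "j < n" "i \<noteq> j" for i j
    using b[OF that(1)] b[OF that(2)] V[OF that] that by blast
  then show ?thesis
    using b by (intro exI[of _ "map b [0..<n]"]) (auto simp: disjoint_family_on_def)
qed

lemma of_nat_le_num_iff_base:
  fixes S :: "'a::t2_space set"
  assumes base: "topological_basis \<B>"
  shows "of_nat n \<le> num S \<longleftrightarrow>
    (\<exists>L\<in>lists \<B>. length L = n \<and> disjoint_family_on ((!) L) {..<n} \<and> (\<forall>i<n. S \<inter> L ! i \<noteq> {}))"
proof
  assume "of_nat n \<le> num S"
  then obtain F where F: "F \<subseteq> S" "finite F" "card F = n" by (auto simp: of_nat_le_num_iff)
  then obtain x where x: "bij_betw x {..<n} F"
    using ex_bij_betw_nat_finite[of F] by (auto simp: atLeast0LessThan)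
  then have "x i \<in> S" if "i < n" for i using F that by (auto simp: bij_betw_def)
  moreover obtain L where L: "set L \<subseteq> \<B>" "length L = n" "disjoint_family_on ((!) L) {..<n}"
      "\<And>i. i < n \<Longrightarrow> x i \<in> L ! i"
    using separated_by_base[of x n \<B>] base x by (auto simp: bij_betw_def)
  ultimately show
    "\<exists>L\<in>lists \<B>. length L = n \<and> disjoint_family_on ((!) L) {..<n} \<and> (\<forall>i<n. S \<inter> L ! i \<noteq> {})"
    by (intro bexI[of _ L]) auto
next
  assume "\<exists>L\<in>lists \<B>. length L = n \<and> disjoint_family_on ((!) L) {..<n} \<and> (\<forall>i<n. S \<inter> L ! i \<noteq> {})"
  then obtain L where L: "disjoint_family_on ((!) L) {..<n}" "\<And>i. i < n \<Longrightarrow> S \<inter> L ! i \<noteq> {}"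
    by auto
  define x where "x i = (SOME p. p \<in> S \<inter> L ! i)" for i
  have x: "x i \<in> S \<inter> L ! i" if "i < n" for i
    unfolding x_def using L(2)[OF that] by (rule some_in_eq[THEN iffD2])
  have "inj_on x {..<n}"
  proof (rule inj_onI, rule ccontr)
    fix i j assume "i \<in> {..<n}" "j \<in> {..<n}" "x i = x j" "i \<noteq> j"
    then have "x i \<in> L ! i" "x i \<in> L ! j"
      using x[of i] x[of j] by simp_all
    then show False
      using disjoint_family_onD[OF L(1), of i j] \<open>i \<in> _\<close> \<open>j \<in> _\<close> \<open>i \<noteq> j\<close> by blast
  qed
  then show "of_nat n \<le> num S"
    unfolding of_nat_le_num_iff using x by (intro exI[of _ "x ` {..<n}"]) (auto simp: card_image)
qed

text \<open>Renyi's observation: at least \<open>n\<close> points of \<open>S\<close> lie in \<open>B\<close> iff \<open>S\<close> hits \<open>n\<close> sets \<open>B \<inter> L ! i\<close> with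
  disjoint basic open \<open>L ! i\<close>, and there are only countably many such lists \<open>L\<close>. So the void events
  \<open>{S. S \<inter> B = {}}\<close> decide measurability of a random locally finite set.\<close>

lemma measurable_point_spaceI:
  fixes U :: "'w \<Rightarrow> 'a::{metric_space, second_countable_topology} set"
  assumes lf: "\<And>\<omega>. \<omega> \<in> space \<Omega> \<Longrightarrow> loc_finite (U \<omega>)"
    and void: "\<And>B. B \<in> sets borel \<Longrightarrow> Measurable.pred \<Omega> (\<lambda>\<omega>. U \<omega> \<inter> B = {})"
  shows "U \<in> \<Omega> \<rightarrow>\<^sub>M point_space"
  unfolding point_space_def
proof (rule measurable_Sup2)
  fix m :: "'a set measure"
  assume "m \<in> (\<lambda>B. vimage_algebra {S. loc_finite S} (\<lambda>S. num (S \<inter> B)) borel) ` sets borel"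
  then obtain B :: "'a set" where [measurable]: "B \<in> sets borel"
    and m: "m = vimage_algebra {S. loc_finite S} (\<lambda>S. num (S \<inter> B)) borel" by auto
  obtain \<B> :: "'a set set" where \<B>: "countable \<B>" "topological_basis \<B>"
    using ex_countable_basis by auto
  have "(\<lambda>\<omega>. num (U \<omega> \<inter> B)) \<in> borel_measurable \<Omega>"
  proof (rule borel_measurableI_greater)
    fix a :: ennreal
    have "a < num S \<longleftrightarrow> (\<exists>n. a < of_nat n \<and> of_nat n \<le> num S)" for S :: "'a set"
    proof
      assume "a < num S"
      then show "\<exists>n. a < of_nat n \<and> of_nat n \<le> num S"
      proof (cases "finite S")
        case False
        with \<open>a < num S\<close> have "a < top" by (auto simp: num_infinite)
        then obtain n where "a < of_nat n" using ennreal_Ex_less_of_nat[of a]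
          by (auto simp: less_top)
        with False show ?thesis by (auto simp: num_infinite)
      qed (auto simp: num_finite)
    qed auto
    then have "{\<omega> \<in> space \<Omega>. a < num (U \<omega> \<inter> B)} = {\<omega> \<in> space \<Omega>. \<exists>n\<in>{n. a < of_nat n}. \<exists>L\<in>{L\<in>lists \<B>.
        length L = n \<and> disjoint_family_on ((!) L) {..<n}}. \<forall>i\<in>{..<n}. \<not> (U \<omega> \<inter> (B \<inter> L ! i) = {})}"
      unfolding of_nat_le_num_iff_base[OF \<B>(2)] by (simp add: Int_assoc Bex_def Ball_def conj_assoc)
    also have "\<dots> \<in> sets \<Omega>"
    proof (intro sets.sets_Collect_countable_Ex' sets.sets_Collect_finite_All sets.sets_Collect_neg)
      show "countable {L\<in>lists \<B>. length L = n \<and> disjoint_family_on ((!) L) {..<n}}" for n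
        by (rule countable_subset[OF _ countable_lists[OF \<B>(1)]]) auto
    next
      fix n L i assume "L \<in> {L \<in> lists \<B>. length L = n \<and> disjoint_family_on ((!) L) {..<n}}" "i \<in> {..<n}"
      then have "L ! i \<in> \<B>" by auto
      then have "L ! i \<in> sets borel" using topological_basis_open[OF \<B>(2)] by (simp add: borel_open)
      then show "{\<omega> \<in> space \<Omega>. U \<omega> \<inter> (B \<inter> L ! i) = {}} \<in> sets \<Omega>"
        using void[of "B \<inter> L ! i"] by (simp add: pred_def)
    qed auto
    finally show "{\<omega> \<in> space \<Omega>. a < num (U \<omega> \<inter> B)} \<in> sets \<Omega>" .
  qed
  then show "U \<in> \<Omega> \<rightarrow>\<^sub>M m"
    unfolding m using lf by (intro measurable_vimage_algebra2) auto
qed auto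

lemma sets_point_space_void:
  "sets (point_space :: 'a::{metric_space, second_countable_topology} set measure) =
    sigma_sets {S. loc_finite S} {{S. loc_finite S \<and> S \<inter> B = {}} | B. B \<in> sets borel}"
    (is "_ = sigma_sets ?X ?G")
proof
  have G: "?G \<subseteq> Pow ?X" by auto
  have sigma: "space (sigma ?X ?G) = ?X" "sets (sigma ?X ?G) = sigma_sets ?X ?G"
    by (rule space_measure_of_conv, rule sets_measure_of[OF G])
  have *: "(\<lambda>S. S) \<in> sigma ?X ?G \<rightarrow>\<^sub>M (point_space :: 'a set measure)"
  proof (rule measurable_point_spaceI)
    fix B :: "'a set" assume "B \<in> sets borel"
    then have "{S. loc_finite S \<and> S \<inter> B = {}} \<in> sigma_sets ?X ?G"
      by (intro sigma_sets.Basic CollectI exI[of _ B] conjI refl)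
    then show "Measurable.pred (sigma ?X ?G) (\<lambda>S. S \<inter> B = {})"
      unfolding pred_def sigma by (simp only: mem_Collect_eq)
  qed (simp add: sigma)
  show "sets point_space \<subseteq> sigma_sets ?X ?G"
  proof
    fix A assume A: "A \<in> sets (point_space :: 'a set measure)"
    have "(\<lambda>S. S) -` A \<inter> space (sigma ?X ?G) = A"
      using sets.sets_into_space[OF A] by (auto simp: sigma space_point_space)
    then show "A \<in> sigma_sets ?X ?G"
      using measurable_sets[OF * A] by (simp only: sigma)
  qed
  have "?G \<subseteq> sets point_space"
    using measurable_void by (auto simp: pred_def space_point_space)
  then show "sigma_sets ?X ?G \<subseteq> sets point_space"
    unfolding space_point_space[symmetric] by (rule sets.sigma_sets_subset)
qed

text \<open>The void events are stable under intersection, because \<open>S\<close> avoids \<open>A\<close> and \<open>B\<close> iff it avoids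
  \<open>A \<union> B\<close>. Hence void probabilities determine the law of a random locally finite set.\<close>

lemma measure_eqI_void:
  fixes M N :: "'a::{metric_space, second_countable_topology} set measure"
  assumes sets: "sets M = sets point_space" "sets N = sets point_space"
    and fin: "emeasure M (space M) \<noteq> \<infinity>"
    and eq: "\<And>B. B \<in> sets borel \<Longrightarrow>
      emeasure M {S. loc_finite S \<and> S \<inter> B = {}} = emeasure N {S. loc_finite S \<and> S \<inter> B = {}}"
  shows "M = N"
proof (rule measure_eqI_generator_eq[where A="\<lambda>_. {S. loc_finite S}"])
  let ?G = "{{S. loc_finite S \<and> S \<inter> B = {}} | B :: 'a set. B \<in> sets borel}"
  show "Int_stable ?G"
  proof (rule Int_stableI)
    fix a b assume "a \<in> ?G" "b \<in> ?G"
    then obtain A B where "A \<in> sets borel" "B \<in> sets borel"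
      "a = {S. loc_finite S \<and> S \<inter> A = {}}" "b = {S. loc_finite S \<and> S \<inter> B = {}}" by auto
    then show "a \<inter> b \<in> ?G" by (intro CollectI exI[of _ "A \<union> B"]) auto
  qed
  show "range (\<lambda>_::nat. {S :: 'a set. loc_finite S}) \<subseteq> ?G"
    by (auto intro!: exI[of _ "{}"])
  show "emeasure M {S. loc_finite S} \<noteq> \<infinity>"
    using fin sets_eq_imp_space_eq[OF sets(1)] by (simp add: space_point_space)
qed (use sets eq in \<open>auto simp: sets_point_space_void\<close>)

lemma UN_cball_nat: "(\<Union>k. cball a (real k)) = (UNIV :: 'a::metric_space set)"
  using real_arch_simple by (auto simp: mem_cball)

lemma incseq_cball_nat: "incseq (\<lambda>k. cball (a :: 'a::metric_space) (real k))"
  by (auto simp: incseq_def)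

lemma measurable_num_points:
  fixes U :: "'w \<Rightarrow> 'a::polish_space set"
  assumes U: "U \<in> \<Omega> \<rightarrow>\<^sub>M point_space"
    and Q: "Measurable.pred (\<Omega> \<Otimes>\<^sub>M borel) (\<lambda>(\<omega>, p). Q \<omega> p)"
  shows "(\<lambda>\<omega>. num {p \<in> U \<omega>. Q \<omega> p}) \<in> borel_measurable \<Omega>"
proof (rule measurable_num_Collect[OF Q, where B="\<lambda>k. cball undefined (real k)"])
  show "(\<lambda>\<omega>. num (U \<omega> \<inter> A)) \<in> borel_measurable \<Omega>" if "A \<in> sets borel" for A
    using U measurable_num_point[OF that] by (rule measurable_compose)
  show "finite (U \<omega> \<inter> cball undefined (real k))" if "\<omega> \<in> space \<Omega>" for \<omega> k
    using measurable_space[OF U that] by (auto simp: space_point_space loc_finite_def)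
qed (auto simp: incseq_cball_nat UN_cball_nat)

lemma measurable_ex_point:
  fixes U :: "'w \<Rightarrow> 'a::polish_space set"
  assumes "U \<in> \<Omega> \<rightarrow>\<^sub>M point_space"
    and "Measurable.pred (\<Omega> \<Otimes>\<^sub>M borel) (\<lambda>(\<omega>, p). Q \<omega> p)"
  shows "Measurable.pred \<Omega> (\<lambda>\<omega>. \<exists>p\<in>U \<omega>. Q \<omega> p)"
proof -
  note measurable_num_points[OF assms, measurable]
  have "Measurable.pred \<Omega> (\<lambda>\<omega>. num {p \<in> U \<omega>. Q \<omega> p} \<noteq> 0)" by measurable
  then show ?thesis by (simp add: num_eq_0_iff Bex_def)
qed

lemma measurable_member:
  "Measurable.pred (borel \<Otimes>\<^sub>M (point_space :: 'a::polish_space set measure)) (\<lambda>(x, S). x \<in> S)"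
proof -
  have "Measurable.pred (borel \<Otimes>\<^sub>M (point_space :: 'a set measure)) (\<lambda>z. \<exists>p\<in>snd z. p = fst z)"
    by (rule measurable_ex_point) (auto simp: split_beta')
  then show ?thesis by (simp add: split_beta' Bex_def)
qed

lemma measurable_finite: "Measurable.pred (point_space :: 'a::metric_space set measure) finite"
proof -
  have [measurable]: "(\<lambda>S. num (S \<inter> UNIV)) \<in> borel_measurable (point_space :: 'a set measure)"
    by (rule measurable_num_point) simp
  have "Measurable.pred (point_space :: 'a set measure) (\<lambda>S. num (S \<inter> UNIV) < \<infinity>)" by measurable
  then show ?thesis by (simp only: num_less_top_iff Int_UNIV_right)
qed

lemma measurable_Int_set:
  assumes [measurable]: "W \<in> sets borel"
  shows "(\<lambda>S. S \<inter> W) \<in> point_space \<rightarrow>\<^sub>M (point_space :: 'a::polish_space set measure)"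
proof (rule measurable_point_spaceI)
  fix B :: "'a set" assume [measurable]: "B \<in> sets borel"
  show "Measurable.pred point_space (\<lambda>S. S \<inter> W \<inter> B = {})"
    unfolding Int_assoc by measurable
qed (auto simp: space_point_space elim: loc_finite_subset)

lemma measurable_insert:
  "insert v \<in> point_space \<rightarrow>\<^sub>M (point_space :: 'a::polish_space set measure)"
proof (rule measurable_point_spaceI)
  fix B :: "'a set" assume [measurable]: "B \<in> sets borel"
  show "Measurable.pred point_space (\<lambda>S. insert v S \<inter> B = {})"
    by (cases "v \<in> B") auto
qed (auto simp: space_point_space loc_finite_insert)

section \<open>Random graphs and clusters\<close>

lemma measurable_num_atom:
  assumes "A \<in> sets (borel \<Otimes>\<^sub>M point_space)"
  shows "(\<lambda>\<mu>. num (\<mu> \<inter> A)) \<in> borel_measurable (graph_space :: 'a::polish_space graph measure)"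
proof -
  have "(\<lambda>\<mu>. num (\<mu> \<inter> A)) \<in> borel_measurable
      (vimage_algebra graphs (\<lambda>\<mu> :: 'a graph. num (\<mu> \<inter> A)) borel)"
    by (rule measurable_vimage_algebra1) auto
  then show ?thesis
    unfolding graph_space_def using assms by (intro measurable_Sup1) auto
qed

lemma measurable_graph_spaceI:
  fixes U :: "'w \<Rightarrow> 'a::polish_space graph"
  assumes U: "\<And>\<omega>. \<omega> \<in> space \<Omega> \<Longrightarrow> U \<omega> \<in> graphs"
    and num: "\<And>A. A \<in> sets (borel \<Otimes>\<^sub>M point_space) \<Longrightarrow>
      (\<lambda>\<omega>. num (U \<omega> \<inter> A)) \<in> borel_measurable \<Omega>"
  shows "U \<in> \<Omega> \<rightarrow>\<^sub>M graph_space"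
  unfolding graph_space_def
proof (rule measurable_Sup2)
  fix m :: "'a graph measure"
  assume "m \<in> (\<lambda>A. vimage_algebra graphs (\<lambda>\<mu>. num (\<mu> \<inter> A)) borel) `
    sets (borel \<Otimes>\<^sub>M point_space :: ('a \<times> 'a set) measure)"
  then show "U \<in> \<Omega> \<rightarrow>\<^sub>M m"
    using U num by (auto intro!: measurable_vimage_algebra2)
qed auto

lemma graph_atomsD:
  assumes "\<mu> \<in> graphs"
  shows "inj_on fst \<mu>" "loc_finite (verts \<mu>)" "(x, N) \<in> \<mu> \<Longrightarrow> N \<subseteq> verts \<mu>" "(x, N) \<in> \<mu> \<Longrightarrow> loc_finite N"
    "(x, N) \<in> \<mu> \<Longrightarrow> x \<notin> N"
proof -
  show "inj_on fst \<mu>" and lf: "loc_finite (verts \<mu>)" using assms by (auto simp: graphs_def)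
  show N: "N \<subseteq> verts \<mu>" if "(x, N) \<in> \<mu>" using assms that by (auto simp: graphs_def adj_def)
  show "loc_finite N" if "(x, N) \<in> \<mu>" using lf N[OF that] by (rule loc_finite_subset)
  show "x \<notin> N" if "(x, N) \<in> \<mu>" using assms that by (auto simp: graphs_def adj_def irrefl_def)
qed

lemma graph_subset_space:
  fixes \<mu> :: "'a::polish_space graph"
  assumes "\<mu> \<in> graphs"
  shows "\<mu> \<subseteq> space (borel \<Otimes>\<^sub>M point_space)"
  using graph_atomsD(4)[OF assms] by (auto simp: space_pair_measure space_point_space)

lemma finite_atoms:
  assumes "\<mu> \<in> graphs" "bounded B"
  shows "finite (\<mu> \<inter> B \<times> UNIV)"
proof (rule finite_imageD[where f=fst])
  have "fst ` (\<mu> \<inter> B \<times> UNIV) \<subseteq> verts \<mu> \<inter> B" by (auto simp: verts_def)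
  then show "finite (fst ` (\<mu> \<inter> B \<times> UNIV))"
    using graph_atomsD(2)[OF assms(1)] assms(2) unfolding loc_finite_def by (blast intro: finite_subset)
  show "inj_on fst (\<mu> \<inter> B \<times> UNIV)"
    using graph_atomsD(1)[OF assms(1)] by (rule inj_on_subset) auto
qed

lemma measurable_num_atoms:
  fixes U :: "'w \<Rightarrow> 'a::polish_space graph"
  assumes U: "U \<in> \<Omega> \<rightarrow>\<^sub>M graph_space"
    and Q: "Measurable.pred (\<Omega> \<Otimes>\<^sub>M (borel \<Otimes>\<^sub>M point_space)) (\<lambda>(\<omega>, p). Q \<omega> p)"
  shows "(\<lambda>\<omega>. num {p \<in> U \<omega>. Q \<omega> p}) \<in> borel_measurable \<Omega>"
proof -
  define a :: 'a where "a = undefined"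
  show ?thesis
  proof (rule measurable_num_Collect[OF Q, where B="\<lambda>k. cball a (real k) \<times> space point_space"])
    show "(\<lambda>\<omega>. num (U \<omega> \<inter> A)) \<in> borel_measurable \<Omega>" if "A \<in> sets (borel \<Otimes>\<^sub>M point_space)" for A
      using U measurable_num_atom[OF that] by (rule measurable_compose)
    have g: "U \<omega> \<in> graphs" if "\<omega> \<in> space \<Omega>" for \<omega>
      using measurable_space[OF U that] by (simp add: space_graph_space)
    show "U \<omega> \<subseteq> space (borel \<Otimes>\<^sub>M point_space)" if "\<omega> \<in> space \<Omega>" for \<omega>
      using g[OF that] by (rule graph_subset_space)
    show "finite (U \<omega> \<inter> cball a (real k) \<times> space point_space)" if "\<omega> \<in> space \<Omega>" for \<omega> k
      using finite_atoms[OF g[OF that], of "cball a (real k)"] by (rule finite_subset[rotated]) auto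
    show "incseq (\<lambda>k. cball a (real k) \<times> space point_space)"
      using incseq_cball_nat by (auto simp: incseq_def)
    show "(\<Union>k. cball a (real k) \<times> space point_space) = space (borel \<Otimes>\<^sub>M (point_space :: 'a set measure))"
    proof -
      have "\<exists>k. x \<in> cball a (real k)" for x :: 'a
        using UN_cball_nat[of a] by blast
      then show ?thesis by (auto simp: space_pair_measure space_point_space simp del: mem_cball)
    qed
  qed auto
qed

lemma measurable_ex_atom:
  fixes U :: "'w \<Rightarrow> 'a::polish_space graph"
  assumes "U \<in> \<Omega> \<rightarrow>\<^sub>M graph_space"
    and "Measurable.pred (\<Omega> \<Otimes>\<^sub>M (borel \<Otimes>\<^sub>M point_space)) (\<lambda>(\<omega>, p). Q \<omega> p)"
  shows "Measurable.pred \<Omega> (\<lambda>\<omega>. \<exists>p\<in>U \<omega>. Q \<omega> p)"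
proof -
  note measurable_num_atoms[OF assms, measurable]
  have "Measurable.pred \<Omega> (\<lambda>\<omega>. num {p \<in> U \<omega>. Q \<omega> p} \<noteq> 0)" by measurable
  then show ?thesis by (simp add: num_eq_0_iff Bex_def)
qed

lemma measurable_verts: "verts \<in> graph_space \<rightarrow>\<^sub>M (point_space :: 'a::polish_space set measure)"
proof (rule measurable_point_spaceI)
  fix B :: "'a set" assume [measurable]: "B \<in> sets borel"
  have "Measurable.pred (graph_space :: 'a graph measure) (\<lambda>\<mu>. \<not> (\<exists>p\<in>\<mu>. fst p \<in> B))"
    by (intro pred_intros_logic measurable_ex_atom) auto
  moreover have "\<not> (\<exists>p\<in>\<mu>. fst p \<in> B) \<longleftrightarrow> verts \<mu> \<inter> B = {}" for \<mu> :: "'a graph"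
    by (auto simp: verts_def)
  ultimately show "Measurable.pred graph_space (\<lambda>\<mu> :: 'a graph. verts \<mu> \<inter> B = {})" by simp
qed (auto simp: space_graph_space graph_atomsD)

lemma measurable_verts_eq:
  assumes "finite (V :: 'a::polish_space set)"
  shows "Measurable.pred graph_space (\<lambda>\<mu>. verts \<mu> = V)"
proof -
  have eq: "verts \<mu> = V \<longleftrightarrow> (\<forall>x\<in>V. verts \<mu> \<inter> {x} \<noteq> {}) \<and> verts \<mu> \<inter> - V = {}" for \<mu> :: "'a graph"
    by auto
  have V: "- V \<in> sets borel" using assms by (intro borel_comp borel_closed finite_imp_closed)
  have void: "Measurable.pred graph_space (\<lambda>\<mu>. verts \<mu> \<inter> B = {})" if "B \<in> sets borel" for B :: "'a set"
    using measurable_compose[OF measurable_verts measurable_void[OF that]] .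
  show ?thesis
    unfolding eq using assms V by (intro pred_intros_logic pred_intros_finite void) auto
qed

definition has_card :: "nat \<Rightarrow> 'a graph \<Rightarrow> ennreal" where
  "has_card n \<mu> = indicator {\<mu>. num (verts \<mu>) = of_nat n} \<mu>"

lemma has_card_eq_0_iff: "has_card n \<mu> = 0 \<longleftrightarrow> \<not> (finite (verts \<mu>) \<and> card (verts \<mu>) = n)"
  by (simp add: has_card_def num_eq_of_nat_iff indicator_def)

lemma has_card_le_1: "has_card n \<mu> \<le> 1"
  by (simp add: has_card_def indicator_def)

lemma measurable_num_verts:
  "(\<lambda>\<mu>. num (verts \<mu>)) \<in> borel_measurable (graph_space :: 'a::polish_space graph measure)"
  using measurable_compose[OF measurable_verts measurable_num_point[of "UNIV :: 'a set"]] by simp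

lemma measurable_has_card: "has_card n \<in> borel_measurable (graph_space :: 'a::polish_space graph measure)"
proof -
  note measurable_num_verts[measurable]
  have "Measurable.pred graph_space (\<lambda>\<mu> :: 'a graph. num (verts \<mu>) = of_nat n)" by measurable
  then show ?thesis unfolding has_card_def[abs_def] by (rule borel_measurable_indicator_pred)
qed

text \<open>A vertex is reached from \<open>v\<close> in \<open>k + 1\<close> steps iff it belongs to the neighbourhood stored in an atom
  whose vertex is reached in \<open>k\<close> steps; each step is one existential quantifier over atoms.\<close>

lemma measurable_adj_relpow:
  fixes v :: "'a::polish_space"
  shows "Measurable.pred (graph_space \<Otimes>\<^sub>M borel) (\<lambda>(\<mu>, x). (v, x) \<in> adj \<mu> ^^ k)"
proof (induction k)
  case 0
  have "Measurable.pred (graph_space \<Otimes>\<^sub>M borel) (\<lambda>(\<mu>, x :: 'a). v = x)" by measurable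
  then show ?case by (simp add: split_beta')
next
  case (Suc k)
  let ?\<Omega> = "graph_space \<Otimes>\<^sub>M borel :: ('a graph \<times> 'a) measure"
  have 1: "Measurable.pred (?\<Omega> \<Otimes>\<^sub>M (borel \<Otimes>\<^sub>M (point_space :: 'a set measure))) (\<lambda>(\<omega>, p). (v, fst p) \<in> adj (fst \<omega>) ^^ k)"
  proof -
    have "(\<lambda>z. (fst (fst z), fst (snd z))) \<in> ?\<Omega> \<Otimes>\<^sub>M (borel \<Otimes>\<^sub>M (point_space :: 'a set measure)) \<rightarrow>\<^sub>M ?\<Omega>"
      by measurable
    from measurable_compose[OF this Suc] show ?thesis by (simp add: split_beta')
  qed
  have 2: "Measurable.pred (?\<Omega> \<Otimes>\<^sub>M (borel \<Otimes>\<^sub>M point_space)) (\<lambda>(\<omega>, p). snd \<omega> \<in> snd p)"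
  proof -
    have "(\<lambda>z. (snd (fst z), snd (snd z))) \<in>
        ?\<Omega> \<Otimes>\<^sub>M (borel \<Otimes>\<^sub>M point_space) \<rightarrow>\<^sub>M borel \<Otimes>\<^sub>M (point_space :: 'a set measure)"
      by measurable
    from measurable_compose[OF this measurable_member] show ?thesis by (simp add: split_beta')
  qed
  have "Measurable.pred ?\<Omega> (\<lambda>\<omega>. \<exists>p\<in>fst \<omega>. (v, fst p) \<in> adj (fst \<omega>) ^^ k \<and> snd \<omega> \<in> snd p)"
    using pred_intros_logic(3)[OF 1 2] by (intro measurable_ex_atom) (simp_all add: split_beta')
  moreover have "(v, x) \<in> adj \<mu> ^^ Suc k \<longleftrightarrow> (\<exists>p\<in>\<mu>. (v, fst p) \<in> adj \<mu> ^^ k \<and> x \<in> snd p)" for \<mu> x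
    by (force simp: adj_def relcomp_unfold)
  ultimately show ?case by (simp add: split_beta')
qed

lemma measurable_connected:
  fixes v :: "'a::polish_space"
  shows "Measurable.pred (graph_space \<Otimes>\<^sub>M borel) (\<lambda>(\<mu>, x). (v, x) \<in> (adj \<mu>)\<^sup>*)"
proof -
  have "Measurable.pred (graph_space \<Otimes>\<^sub>M borel) (\<lambda>z. \<exists>k. (v, snd z) \<in> adj (fst z) ^^ k)"
    using measurable_adj_relpow[of v] by (intro pred_intros_countable) (simp add: split_beta')
  then show ?thesis by (simp add: rtrancl_power split_beta')
qed

lemma measurable_connected_atom:
  fixes v :: "'a::polish_space"
  shows "Measurable.pred (graph_space \<Otimes>\<^sub>M (borel \<Otimes>\<^sub>M (point_space :: 'a set measure)))
    (\<lambda>z. (v, fst (snd z)) \<in> (adj (fst z))\<^sup>*)"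
proof -
  have "(\<lambda>z. (fst z, fst (snd z))) \<in> graph_space \<Otimes>\<^sub>M (borel \<Otimes>\<^sub>M (point_space :: 'a set measure)) \<rightarrow>\<^sub>M
      graph_space \<Otimes>\<^sub>M borel" by measurable
  from measurable_compose[OF this measurable_connected[of v]] show ?thesis by (simp add: split_beta')
qed

lemma measurable_component:
  "component v \<in> graph_space \<rightarrow>\<^sub>M (graph_space :: 'a::polish_space graph measure)"
proof (rule measurable_graph_spaceI)
  fix A :: "('a \<times> 'a set) set" assume [measurable]: "A \<in> sets (borel \<Otimes>\<^sub>M point_space)"
  note measurable_connected_atom[of v, measurable]
  have "(\<lambda>\<mu>. num {p \<in> \<mu>. (v, fst p) \<in> (adj \<mu>)\<^sup>* \<and> p \<in> A}) \<in> borel_measurable graph_space"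
    by (rule measurable_num_atoms) (auto simp: split_beta')
  moreover have "component v \<mu> \<inter> A = {p \<in> \<mu>. (v, fst p) \<in> (adj \<mu>)\<^sup>* \<and> p \<in> A}" for \<mu>
    by (auto simp: component_def)
  ultimately show "(\<lambda>\<mu>. num (component v \<mu> \<inter> A)) \<in> borel_measurable graph_space" by simp
qed (simp add: space_graph_space component_in_graphs)

lemma verts_component: "verts (component v \<mu>) = {x \<in> verts \<mu>. (v, x) \<in> (adj \<mu>)\<^sup>*}"
  unfolding verts_def component_def by auto

definition connected_from :: "'a \<Rightarrow> 'a graph set" where
  "connected_from v = {\<mu>. \<forall>x\<in>verts \<mu>. (v, x) \<in> (adj \<mu>)\<^sup>*}"

lemma component_eq_self: "\<mu> \<in> connected_from v \<Longrightarrow> component v \<mu> = \<mu>"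
  by (force simp: connected_from_def component_def verts_def)

lemma verts_component_eq_iff: "verts (component v \<mu>) = verts \<mu> \<longleftrightarrow> \<mu> \<in> connected_from v"
  by (auto simp: connected_from_def verts_component)

lemma measurable_connected_from:
  "Measurable.pred (graph_space :: 'a::polish_space graph measure) (\<lambda>\<mu>. \<mu> \<in> connected_from v)"
proof -
  note measurable_connected_atom[of v, measurable]
  have "Measurable.pred (graph_space :: 'a graph measure) (\<lambda>\<mu>. \<not> (\<exists>p\<in>\<mu>. (v, fst p) \<notin> (adj \<mu>)\<^sup>*))"
    by (intro pred_intros_logic measurable_ex_atom) (auto simp: split_beta')
  moreover have "\<not> (\<exists>p\<in>\<mu>. (v, fst p) \<notin> (adj \<mu>)\<^sup>*) \<longleftrightarrow> \<mu> \<in> connected_from v" for \<mu>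
    by (auto simp: connected_from_def verts_def)
  ultimately show ?thesis by simp
qed

text \<open>The induced subgraph; the stored neighbourhoods have to be cut down as well.\<close>

definition restr :: "'a set \<Rightarrow> 'a graph \<Rightarrow> 'a graph" where
  "restr W \<mu> = (\<lambda>(x, N). (x, N \<inter> W)) ` {p \<in> \<mu>. fst p \<in> W}"

lemma mem_restr: "(x, M) \<in> restr W \<mu> \<longleftrightarrow> x \<in> W \<and> (\<exists>N. (x, N) \<in> \<mu> \<and> M = N \<inter> W)"
  by (force simp: restr_def)

lemma verts_restr: "verts (restr W \<mu>) = verts \<mu> \<inter> W"
  by (force simp: restr_def verts_def)

lemma adj_restr: "adj (restr W \<mu>) = adj \<mu> \<inter> W \<times> W"
  by (auto simp: adj_def mem_restr)

lemma graph_atoms_unique: "\<mu> \<in> graphs \<Longrightarrow> (x, N) \<in> \<mu> \<Longrightarrow> (x, N') \<in> \<mu> \<Longrightarrow> N = N'"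
  using inj_onD[OF graph_atomsD(1), of \<mu> "(x, N)" "(x, N')"] by simp

lemma restr_in_graphs:
  assumes "\<mu> \<in> graphs"
  shows "restr W \<mu> \<in> graphs"
proof -
  have "inj_on fst (restr W \<mu>)"
    by (intro inj_onI) (auto simp: mem_restr dest: graph_atoms_unique[OF assms])
  with assms show ?thesis
    unfolding graphs_def mem_Collect_eq verts_restr adj_restr
    by (auto simp: irrefl_def sym_def elim: loc_finite_subset)
qed

lemma restr_mk_graph: "restr W (mk_graph V E) = mk_graph (V \<inter> W) (E \<inter> pairs W)"
proof -
  have "restr W (mk_graph V E) = (\<lambda>x. (x, {y \<in> V. {x, y} \<in> E \<and> x \<noteq> y} \<inter> W)) ` (V \<inter> W)"
    by (auto simp: restr_def mk_graph_def)
  also have "\<dots> = mk_graph (V \<inter> W) (E \<inter> pairs W)"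
    unfolding mk_graph_def by (rule image_cong) (auto simp: pairs_def)
  finally show ?thesis .
qed

lemma measurable_restr:
  assumes [measurable]: "W \<in> sets borel"
  shows "restr W \<in> graph_space \<rightarrow>\<^sub>M (graph_space :: 'a::polish_space graph measure)"
proof (rule measurable_graph_spaceI)
  fix A :: "('a \<times> 'a set) set" assume [measurable]: "A \<in> sets (borel \<Otimes>\<^sub>M point_space)"
  note measurable_Int_set[measurable]
  define k where "k \<mu> = num {p \<in> \<mu>. fst p \<in> W \<and> (fst p, snd p \<inter> W) \<in> A}" for \<mu>
  have k: "k \<in> borel_measurable graph_space"
    unfolding k_def by (rule measurable_num_atoms) (auto simp: split_beta')
  have "num (restr W \<mu> \<inter> A) = k \<mu>" if "\<mu> \<in> space graph_space" for \<mu>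
  proof -
    have \<mu>: "\<mu> \<in> graphs" using that by (simp add: space_graph_space)
    have "restr W \<mu> \<inter> A = (\<lambda>(x, N). (x, N \<inter> W)) ` {p \<in> \<mu>. fst p \<in> W \<and> (fst p, snd p \<inter> W) \<in> A}"
      by (auto simp: restr_def)
    moreover have "inj_on (\<lambda>(x, N). (x, N \<inter> W)) {p \<in> \<mu>. fst p \<in> W \<and> (fst p, snd p \<inter> W) \<in> A}"
      by (intro inj_onI) (auto dest: graph_atoms_unique[OF \<mu>])
    ultimately show ?thesis by (simp add: num_image k_def)
  qed
  then show "(\<lambda>\<mu>. num (restr W \<mu> \<inter> A)) \<in> borel_measurable graph_space"
    by (rule measurable_cong[THEN iffD2]) (assumption, rule k)
qed (simp add: space_graph_space restr_in_graphs)

text \<open>Deleting vertices outside \<open>W\<close> neither removes an atom of a component contained in \<open>W\<close> nor changes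
  the neighbourhoods stored in its atoms.\<close>

lemma component_restr_eq:
  assumes \<mu>: "\<mu> \<in> graphs" and v: "v \<in> verts \<mu>" and sub: "verts (component v \<mu>) \<subseteq> W"
  shows "component v (restr W \<mu>) = component v \<mu>"
proof -
  have av: "x \<in> verts \<mu> \<and> y \<in> verts \<mu>" if "(x, y) \<in> adj \<mu>" for x y
    using \<mu> that by (auto simp: graphs_def)
  have W: "x \<in> W" if "(v, x) \<in> (adj \<mu>)\<^sup>*" for x
  proof -
    have "x \<in> verts \<mu>" using that v by (induction) (auto dest: av)
    then show ?thesis using sub that by (auto simp: verts_component)
  qed
  have "(v, x) \<in> (adj \<mu> \<inter> W \<times> W)\<^sup>*" if "(v, x) \<in> (adj \<mu>)\<^sup>*" for x
    using that
  proof induction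
    case (step y z)
    moreover have "y \<in> W" "z \<in> W" using step(1,2) by (auto intro: W rtrancl_into_rtrancl)
    ultimately show ?case by (meson IntI SigmaI rtrancl.rtrancl_into_rtrancl)
  qed auto
  moreover have "(adj \<mu> \<inter> W \<times> W)\<^sup>* \<subseteq> (adj \<mu>)\<^sup>*" by (rule rtrancl_mono) auto
  ultimately have eq: "(v, x) \<in> (adj \<mu> \<inter> W \<times> W)\<^sup>* \<longleftrightarrow> (v, x) \<in> (adj \<mu>)\<^sup>*" for x by auto
  have NW: "N \<inter> W = N" if "(x, N) \<in> \<mu>" "(v, x) \<in> (adj \<mu>)\<^sup>*" for x N
    using that W by (auto simp: adj_def intro: rtrancl_into_rtrancl)
  show ?thesis
    unfolding component_def adj_restr eq using W NW by (auto simp: mem_restr) (metis NW)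
qed

text \<open>A vertex is joined to \<open>v\<close> by a finite path, which stays inside \<open>W k\<close> for large \<open>k\<close>.\<close>

lemma eventually_verts_component_restr:
  assumes W: "incseq W" "(\<Union>k. W k) = UNIV" and x: "x \<in> verts (component v \<mu>)"
  shows "eventually (\<lambda>k::nat. x \<in> verts (component v (restr (W k) \<mu>))) sequentially"
proof -
  have inW: "eventually (\<lambda>k. y \<in> W k) sequentially" for y
  proof -
    obtain j where "y \<in> W j" using W(2) by blast
    then show ?thesis
      using W(1) by (auto simp: eventually_sequentially incseq_def intro!: exI[of _ j])
  qed
  have "eventually (\<lambda>k. (v, x) \<in> (adj \<mu> \<inter> W k \<times> W k)\<^sup>*) sequentially" if "(v, x) \<in> (adj \<mu>)\<^sup>*" for x
    using that
  proof induction
    case (step y z)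
    show ?case
      using step.IH inW[of y] inW[of z]
      by eventually_elim (use step.hyps(2) in \<open>auto intro: rtrancl_into_rtrancl\<close>)
  qed auto
  then have "eventually (\<lambda>k. (v, x) \<in> (adj \<mu> \<inter> W k \<times> W k)\<^sup>*) sequentially"
    using x by (simp add: verts_component)
  then show ?thesis
    using inW[of x] by eventually_elim (use x in \<open>simp add: verts_component verts_restr adj_restr\<close>)
qed

section \<open>Functions of finitely many points\<close>

lemma measurable_inj_on:
  "finite I \<Longrightarrow> Measurable.pred (PiM I (\<lambda>_. borel :: 'a::polish_space measure)) (\<lambda>x. inj_on x I)"
proof -
  assume [simp]: "finite I"
  have "Measurable.pred (PiM I (\<lambda>_. borel :: 'a measure)) (\<lambda>x. \<forall>i\<in>I. \<forall>j\<in>I. i \<noteq> j \<longrightarrow> x i \<noteq> x j)"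
  proof (intro pred_intros_finite pred_intros_logic)
    fix i j assume [measurable]: "i \<in> I" "j \<in> I"
    have "Measurable.pred (PiM I (\<lambda>_. borel :: 'a measure)) (\<lambda>x. dist (x i) (x j) = 0)" by measurable
    then show "Measurable.pred (PiM I (\<lambda>_. borel :: 'a measure)) (\<lambda>x. x i = x j)" by simp
  qed auto
  moreover have "inj_on x I \<longleftrightarrow> (\<forall>i\<in>I. \<forall>j\<in>I. i \<noteq> j \<longrightarrow> x i \<noteq> x j)" for x :: "'b \<Rightarrow> 'a"
    by (auto simp: inj_on_def)
  ultimately show ?thesis by simp
qed

lemma sets_PiM_boxes:
  assumes "finite I"
  shows "sets (PiM I M) = sigma_sets (\<Pi>\<^sub>E i\<in>I. space (M i)) {Pi\<^sub>E I E | E. \<forall>i\<in>I. E i \<in> sets (M i)}"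
  unfolding sets_PiM prod_algebra_eq_finite[OF assms] by (simp add: Pi_iff)

text \<open>The tuples with entries in a finite random set are themselves a finite random set, whose number of
  elements in a box is a product of counts.\<close>

lemma measurable_ex_tuple:
  fixes Q :: "(nat \<Rightarrow> 'a::polish_space) \<Rightarrow> bool"
  assumes Q: "Measurable.pred (PiM {..<m} (\<lambda>_. borel)) Q"
  shows "Measurable.pred (point_space :: 'a set measure)
    (\<lambda>S. finite S \<and> card S = m \<and> (\<exists>x\<in>{..<m} \<rightarrow>\<^sub>E S. Q x))"
proof -
  define I where "I = {..<m}"
  have I: "finite I" by (simp add: I_def)
  let ?X = "PiE I (\<lambda>_. UNIV :: 'a set)"
  let ?G = "{Pi\<^sub>E I E | E. \<forall>i\<in>I. E i \<in> sets (borel :: 'a measure)}"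
  define F where "F = {S \<in> space (point_space :: 'a set measure). num S = of_nat m}"
  have F: "F \<in> sets point_space"
    using measurable_num_point[of "UNIV :: 'a set"] unfolding F_def by simp measurable
  define \<Omega> where "\<Omega> = restrict_space (point_space :: 'a set measure) F"
  define A where "A = {x \<in> space (PiM I (\<lambda>_. borel :: 'a measure)). Q x}"
  have fin: "finite S \<and> card S = m" if "S \<in> space \<Omega>" for S
    using that by (simp add: \<Omega>_def F_def space_restrict_space num_eq_of_nat_iff)
  have "(\<lambda>S. num ((I \<rightarrow>\<^sub>E S) \<inter> A)) \<in> borel_measurable \<Omega>"
  proof (rule measurable_num_Int_generated[where X="?X" and G="?G" and B="\<lambda>_. ?X"])
    show "Int_stable ?G" by (rule Int_stable_PiE)
    show "A \<in> sigma_sets ?X ?G"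
      using Q sets_PiM_boxes[OF I, of "\<lambda>_. borel :: 'a measure"] by (simp add: A_def pred_def I_def)
    show "finite ((I \<rightarrow>\<^sub>E S) \<inter> ?X)" if "S \<in> space \<Omega>" for S
      using fin[OF that] I by (intro finite_Int disjI1 finite_PiE) auto
    show "(\<lambda>S. num ((I \<rightarrow>\<^sub>E S) \<inter> C)) \<in> borel_measurable \<Omega>" if "C \<in> ?G" for C
    proof -
      from that obtain E where C: "C = Pi\<^sub>E I E" and E: "\<And>i. i \<in> I \<Longrightarrow> E i \<in> sets borel" by auto
      have *: "num ((I \<rightarrow>\<^sub>E S) \<inter> C) = (\<Prod>i\<in>I. num (S \<inter> E i))" if "S \<in> space \<Omega>" for S
        using fin[OF that] I by (simp add: C PiE_Int num_finite finite_PiE card_PiE)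
      have "(\<lambda>S. \<Prod>i\<in>I. num (S \<inter> E i)) \<in> borel_measurable \<Omega>"
        unfolding \<Omega>_def using E
        by (intro borel_measurable_prod_ennreal measurable_restrict_space1 measurable_num_point) auto
      then show ?thesis by (rule measurable_cong[OF *, THEN iffD2, rotated])
    qed
  qed (auto simp: incseq_def intro!: exI[of _ "\<lambda>_. UNIV"])
  then have "Measurable.pred \<Omega> (\<lambda>S. num ((I \<rightarrow>\<^sub>E S) \<inter> A) \<noteq> 0)" by measurable
  then have "{S \<in> space \<Omega>. (I \<rightarrow>\<^sub>E S) \<inter> A \<noteq> {}} \<in> sets \<Omega>"
    by (simp add: pred_def num_eq_0_iff)
  then have "{S \<in> space \<Omega>. (I \<rightarrow>\<^sub>E S) \<inter> A \<noteq> {}} \<in> sets point_space"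
    using F by (simp add: \<Omega>_def sets_restrict_space_iff)
  also have "{S \<in> space \<Omega>. (I \<rightarrow>\<^sub>E S) \<inter> A \<noteq> {}} =
      {S \<in> space point_space. finite S \<and> card S = m \<and> (\<exists>x\<in>{..<m} \<rightarrow>\<^sub>E S. Q x)}"
    by (fastforce simp: \<Omega>_def F_def space_restrict_space num_eq_of_nat_iff A_def I_def space_PiM)
  finally show ?thesis by (simp add: pred_def)
qed

text \<open>A function of a finite set is measurable as soon as it is measurable in an enumeration of the set:
  it exceeds \<open>a\<close> iff some injective enumeration by points of the set has a value above \<open>a\<close>. The
  existential quantifier takes the place of a measurable choice of an enumeration.\<close>

lemma measurable_on_finite_sets:
  fixes H :: "'a::polish_space set \<Rightarrow> ennreal"
    and h :: "nat \<Rightarrow> (nat \<Rightarrow> 'a) \<Rightarrow> ennreal"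
  assumes h: "\<And>m. h m \<in> borel_measurable (PiM {..<m} (\<lambda>_. borel))"
    and H: "\<And>m x. x \<in> extensional {..<m} \<Longrightarrow> inj_on x {..<m} \<Longrightarrow> H (x ` {..<m}) = h m x"
  shows "(\<lambda>S. if finite S then H S else 0) \<in> borel_measurable point_space"
proof (rule borel_measurableI_greater)
  fix a :: ennreal
  have "Measurable.pred (point_space :: 'a set measure)
    (\<lambda>S. \<exists>m. finite S \<and> card S = m \<and> (\<exists>x\<in>{..<m} \<rightarrow>\<^sub>E S. inj_on x {..<m} \<and> a < h m x))"
    using h measurable_inj_on
    by (intro pred_intros_countable measurable_ex_tuple pred_intros_logic) auto
  moreover have "a < (if finite S then H S else 0) \<longleftrightarrow>
    (\<exists>m. finite S \<and> card S = m \<and> (\<exists>x\<in>{..<m} \<rightarrow>\<^sub>E S. inj_on x {..<m} \<and> a < h m x))" for S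
  proof (cases "finite S")
    case True
    have S: "x ` {..<card S} = S" if "x \<in> {..<card S} \<rightarrow>\<^sub>E S" "inj_on x {..<card S}" for x
      using that True by (intro card_subset_eq) (auto simp: card_image PiE_iff)
    obtain x where x: "bij_betw x {..<card S} S"
      using ex_bij_betw_nat_finite[OF True] by (auto simp: atLeast0LessThan)
    define y where "y = restrict x {..<card S}"
    have y: "y \<in> {..<card S} \<rightarrow>\<^sub>E S" "inj_on y {..<card S}"
      using x by (auto simp: y_def bij_betw_def inj_on_def)
    have "h (card S) x = H S" if "x \<in> {..<card S} \<rightarrow>\<^sub>E S" "inj_on x {..<card S}" for x
      using H[of x "card S"] S[OF that] that by (auto simp: PiE_iff)
    with y have "(\<exists>x\<in>{..<card S} \<rightarrow>\<^sub>E S. inj_on x {..<card S} \<and> a < h (card S) x) \<longleftrightarrow> a < H S"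
      by (auto simp del: PiE_iff)
    with True show ?thesis by simp
  qed auto
  ultimately show "{S \<in> space point_space. a < (if finite S then H S else 0)} \<in> sets point_space"
    by (simp add: pred_def)
qed

lemma measurable_image_tuple:
  fixes I :: "'i set"
  assumes "finite J" "J \<subseteq> I"
  shows "(\<lambda>x. x ` J) \<in> PiM I (\<lambda>_. borel) \<rightarrow>\<^sub>M (point_space :: 'a::polish_space set measure)"
proof (rule measurable_point_spaceI)
  show "loc_finite (x ` J)" for x :: "'i \<Rightarrow> 'a" using assms(1) by (simp add: loc_finite_def)
  fix B :: "'a set" assume [measurable]: "B \<in> sets borel"
  have "Measurable.pred (PiM I (\<lambda>_. borel)) (\<lambda>x. x i \<notin> B)" if "i \<in> J" for i
  proof -
    have [measurable]: "i \<in> I" using that assms by auto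
    show ?thesis by measurable
  qed
  then have "Measurable.pred (PiM I (\<lambda>_. borel)) (\<lambda>x. \<forall>i\<in>J. x i \<notin> B)"
    using assms(1) by (intro pred_intros_finite) auto
  moreover have "x ` J \<inter> B = {} \<longleftrightarrow> (\<forall>i\<in>J. x i \<notin> B)" for x by auto
  ultimately show "Measurable.pred (PiM I (\<lambda>_. borel)) (\<lambda>x. x ` J \<inter> B = {})" by simp
qed

lemma pairs_subset_Pow: "pairs V \<subseteq> Pow V"
  by (auto simp: pairs_def)

lemma finite_pairs: "finite V \<Longrightarrow> finite (pairs V)"
  by (rule finite_subset[OF pairs_subset_Pow]) simp

lemma pairsI: "x \<in> V \<Longrightarrow> y \<in> V \<Longrightarrow> x \<noteq> y \<Longrightarrow> {x, y} \<in> pairs V"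
  by (auto simp: pairs_def)

lemma pairsE:
  assumes "e \<in> pairs V"
  obtains x y where "e = {x, y}" "x \<in> V" "y \<in> V" "x \<noteq> y"
  using assms by (auto simp: pairs_def)

lemma pairs_image:
  assumes inj: "inj_on x J"
  shows "pairs (x ` J) = (`) x ` pairs J"
proof (intro set_eqI iffI)
  fix e assume "e \<in> pairs (x ` J)"
  then obtain a b where ab: "e = {a, b}" "a \<in> x ` J" "b \<in> x ` J" "a \<noteq> b" by (rule pairsE)
  then obtain i j where "i \<in> J" "j \<in> J" "a = x i" "b = x j" by auto
  with ab have "e = x ` {i, j}" "{i, j} \<in> pairs J" by (auto intro: pairsI)
  then show "e \<in> (`) x ` pairs J" by (rule image_eqI)
next
  fix e assume "e \<in> (`) x ` pairs J"
  then obtain d where d: "e = x ` d" "d \<in> pairs J" by auto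
  obtain i j where ij: "d = {i, j}" "i \<in> J" "j \<in> J" "i \<noteq> j" using d(2) by (rule pairsE)
  then have "x i \<noteq> x j" using inj by (auto dest: inj_onD)
  with ij have "{x i, x j} \<in> pairs (x ` J)" by (intro pairsI) auto
  then show "e \<in> pairs (x ` J)" using d ij by simp
qed

text \<open>For a fixed edge set on the indices, the graph on the points \<open>x i\<close> has one atom per index, so
  its counts are finite sums of indicators. Injectivity keeps the atoms apart.\<close>

lemma measurable_mk_graph_tuple:
  fixes E :: "nat set set"
  assumes E: "E \<subseteq> pairs {..<m}"
  shows "(\<lambda>x. mk_graph (x ` {..<m}) ((`) x ` E)) \<in>
    restrict_space (PiM {..<m} (\<lambda>_. borel)) {x. inj_on x {..<m}} \<rightarrow>\<^sub>M
    (graph_space :: 'a::polish_space graph measure)" (is "?g \<in> ?\<Omega> \<rightarrow>\<^sub>M _")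
proof (rule measurable_graph_spaceI)
  show "?g x \<in> graphs" for x :: "nat \<Rightarrow> 'a"
    by (rule mk_graph_in_graphs) (simp add: loc_finite_def)
  fix A :: "('a \<times> 'a set) set" assume A: "A \<in> sets (borel \<Otimes>\<^sub>M point_space)"
  define nb where "nb i = {j \<in> {..<m}. {i, j} \<in> E \<and> i \<noteq> j}" for i
  have *: "num (?g x \<inter> A) = (\<Sum>i<m. indicator A (x i, x ` nb i))" if "x \<in> space ?\<Omega>" for x
  proof -
    have inj: "inj_on x {..<m}" using that by (simp add: space_restrict_space)
    have edge: "{x i, x j} \<in> (`) x ` E \<longleftrightarrow> {i, j} \<in> E" if "i < m" "j < m" for i j
    proof -
      have "{x i, x j} = x ` {i, j}" by auto
      moreover have "inj_on ((`) x) (Pow {..<m})" using inj by (rule inj_on_image_Pow)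
      moreover have "E \<subseteq> Pow {..<m}" using E pairs_subset_Pow by blast
      ultimately show ?thesis
        using that inj_on_image_mem_iff[of "(`) x" "Pow {..<m}" "{i, j}" E] by auto
    qed
    have "?g x = (\<lambda>i. (x i, x ` nb i)) ` {..<m}"
      unfolding mk_graph_def image_image
    proof (rule image_cong)
      fix i assume i: "i \<in> {..<m}"
      have "{y \<in> x ` {..<m}. {x i, y} \<in> (`) x ` E \<and> x i \<noteq> y} = x ` nb i"
        using edge i inj unfolding nb_def by (auto simp: inj_on_def)
      then show "(x i, {y \<in> x ` {..<m}. {x i, y} \<in> (`) x ` E \<and> x i \<noteq> y}) = (x i, x ` nb i)"
        by simp
    qed simp
    then have "?g x \<inter> A = (\<lambda>i. (x i, x ` nb i)) ` {i \<in> {..<m}. (x i, x ` nb i) \<in> A}" by auto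
    moreover have "inj_on (\<lambda>i. (x i, x ` nb i)) {i \<in> {..<m}. (x i, x ` nb i) \<in> A}"
      using inj by (auto simp: inj_on_def)
    ultimately have "num (?g x \<inter> A) = num {i \<in> {..<m}. (x i, x ` nb i) \<in> A}"
      by (simp only: num_image)
    also have "\<dots> = (\<Sum>i\<in>{i \<in> {..<m}. (x i, x ` nb i) \<in> A}. 1)" by (simp add: num_finite)
    also have "\<dots> = (\<Sum>i\<in>{i \<in> {..<m}. (x i, x ` nb i) \<in> A}. indicator A (x i, x ` nb i))"
      by (rule sum.cong) auto
    also have "\<dots> = (\<Sum>i<m. indicator A (x i, x ` nb i))"
      by (rule sum.mono_neutral_left) auto
    finally show ?thesis .
  qed
  have "(\<lambda>x. indicator A (x i, x ` nb i) :: ennreal) \<in> borel_measurable ?\<Omega>" if "i < m" for i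
  proof -
    have [measurable]: "(\<lambda>x. x ` nb i) \<in> ?\<Omega> \<rightarrow>\<^sub>M point_space"
      by (intro measurable_restrict_space1 measurable_image_tuple) (auto simp: nb_def)
    have [measurable]: "(\<lambda>x. x i) \<in> ?\<Omega> \<rightarrow>\<^sub>M borel"
      using that by (intro measurable_restrict_space1 measurable_component_singleton) auto
    note A[measurable]
    show ?thesis by measurable
  qed
  then have "(\<lambda>x. \<Sum>i<m. indicator A (x i, x ` nb i) :: ennreal) \<in> borel_measurable ?\<Omega>"
    by (intro borel_measurable_sum) auto
  then show "(\<lambda>x. num (?g x \<inter> A)) \<in> borel_measurable ?\<Omega>"
    by (rule measurable_cong[OF *, THEN iffD2, rotated])
qed

section \<open>The random connection model on finitely many vertices\<close>

text \<open>On finitely many edges the product of Bernoulli laws is a sum over the set of edges that are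
  present. In this form later manipulations of the edge variables are identities between finite sums.\<close>

lemma nn_integral_PiM_bernoulli:
  fixes p :: "'e \<Rightarrow> real" and F :: "'e set \<Rightarrow> ennreal"
  assumes "finite I" and p: "\<And>e. e \<in> I \<Longrightarrow> 0 \<le> p e \<and> p e \<le> 1"
  shows "(\<integral>\<^sup>+b. F {e \<in> I. b e} \<partial>(\<Pi>\<^sub>M e\<in>I. measure_pmf (bernoulli_pmf (p e)))) =
    (\<Sum>E\<in>Pow I. ennreal ((\<Prod>e\<in>E. p e) * (\<Prod>e\<in>I - E. 1 - p e)) * F E)"
  using assms
proof (induction I arbitrary: F)
  case empty
  have "(\<Pi>\<^sub>M e\<in>({} :: 'e set). measure_pmf (bernoulli_pmf (p e))) = count_space {\<lambda>_. undefined}"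
    by (rule PiM_empty)
  then show ?case by (simp add: nn_integral_count_space_finite)
next
  case (insert a I)
  interpret product_sigma_finite "\<lambda>e. measure_pmf (bernoulli_pmf (p e))" ..
  let ?M = "\<lambda>I. \<Pi>\<^sub>M e\<in>I. measure_pmf (bernoulli_pmf (p e))"
  have meas: "(\<lambda>b. F {e \<in> J. b e}) \<in> borel_measurable (?M J)" if "finite J" for J and F :: "'e set \<Rightarrow> ennreal"
  proof -
    have "(\<lambda>b. {e \<in> J. b e}) \<in> ?M J \<rightarrow>\<^sub>M count_space (Pow J)"
    proof (subst measurable_count_space_eq2)
      show "finite (Pow J)" using that by simp
      have "(\<lambda>b. {e \<in> J. b e}) -` {E} \<inter> space (?M J) \<in> sets (?M J)" if E: "E \<in> Pow J" for E
      proof -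
        have "Measurable.pred (?M J) (\<lambda>b. b e = (e \<in> E))" if "e \<in> J" for e
        proof -
          have "(\<lambda>b. b e) \<in> ?M J \<rightarrow>\<^sub>M measure_pmf (bernoulli_pmf (p e))"
            using that by (rule measurable_component_singleton)
          then have [measurable]: "Measurable.pred (?M J) (\<lambda>b. b e)" by simp
          show ?thesis by measurable
        qed
        then have "Measurable.pred (?M J) (\<lambda>b. \<forall>e\<in>J. b e = (e \<in> E))"
          using \<open>finite J\<close> by (intro pred_intros_finite) auto
        moreover have "(\<lambda>b. {e \<in> J. b e}) -` {E} \<inter> space (?M J) =
            {b \<in> space (?M J). \<forall>e\<in>J. b e = (e \<in> E)}"
          using E by auto
        ultimately show ?thesis by (simp add: pred_def)
      qed
      then show "(\<lambda>b. {e \<in> J. b e}) \<in> space (?M J) \<rightarrow> Pow J \<and>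
          (\<forall>E\<in>Pow J. (\<lambda>b. {e \<in> J. b e}) -` {E} \<inter> space (?M J) \<in> sets (?M J))" by auto
    qed
    then show ?thesis by (rule measurable_compose) simp
  qed
  have a: "0 \<le> p a" "p a \<le> 1" using insert.prems by auto
  have *: "ennreal c * (X * ennreal q) = ennreal (q * c) * X" if "0 \<le> c" "0 \<le> q" for c q X
    using that by (simp add: ennreal_mult ac_simps)
  have I: "\<And>e. e \<in> I \<Longrightarrow> 0 \<le> p e \<and> p e \<le> 1" using insert.prems by auto
  have "(\<integral>\<^sup>+b. F {e \<in> insert a I. b e} \<partial>?M (insert a I)) =
      (\<integral>\<^sup>+b. \<integral>\<^sup>+y. F {e \<in> insert a I. (b(a := y)) e} \<partial>measure_pmf (bernoulli_pmf (p a)) \<partial>?M I)"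
    using insert.hyps meas[of "insert a I"] by (intro product_nn_integral_insert) auto
  also have "\<dots> = (\<integral>\<^sup>+b. F (insert a {e \<in> I. b e}) * ennreal (p a) + F {e \<in> I. b e} * ennreal (1 - p a) \<partial>?M I)"
  proof (rule nn_integral_cong)
    fix b :: "'e \<Rightarrow> bool"
    have "{e \<in> insert a I. (b(a := True)) e} = insert a {e \<in> I. b e}"
      "{e \<in> insert a I. (b(a := False)) e} = {e \<in> I. b e}"
      using insert.hyps by auto
    then show "(\<integral>\<^sup>+y. F {e \<in> insert a I. (b(a := y)) e} \<partial>measure_pmf (bernoulli_pmf (p a))) =
      F (insert a {e \<in> I. b e}) * ennreal (p a) + F {e \<in> I. b e} * ennreal (1 - p a)"
      using a by (subst nn_integral_bernoulli_pmf) auto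
  qed
  also have "\<dots> = (\<integral>\<^sup>+b. F (insert a {e \<in> I. b e}) * ennreal (p a) \<partial>?M I) +
      (\<integral>\<^sup>+b. F {e \<in> I. b e} * ennreal (1 - p a) \<partial>?M I)"
    using meas[OF insert.hyps(1), of "\<lambda>E. F (insert a E)"] meas[OF insert.hyps(1), of F]
    by (intro nn_integral_add) auto
  also have "\<dots> = (\<Sum>E\<in>Pow I. ennreal ((\<Prod>e\<in>E. p e) * (\<Prod>e\<in>I - E. 1 - p e)) * (F (insert a E) * ennreal (p a)))
      + (\<Sum>E\<in>Pow I. ennreal ((\<Prod>e\<in>E. p e) * (\<Prod>e\<in>I - E. 1 - p e)) * (F E * ennreal (1 - p a)))"
    using insert.IH[OF I, of "\<lambda>E. F (insert a E) * ennreal (p a)"]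
      insert.IH[OF I, of "\<lambda>E. F E * ennreal (1 - p a)"] by simp
  also have "(\<Sum>E\<in>Pow I. ennreal ((\<Prod>e\<in>E. p e) * (\<Prod>e\<in>I - E. 1 - p e)) * (F (insert a E) * ennreal (p a)))
      = (\<Sum>E\<in>insert a ` Pow I. ennreal ((\<Prod>e\<in>E. p e) * (\<Prod>e\<in>insert a I - E. 1 - p e)) * F E)"
  proof (subst sum.reindex)
    show "inj_on (insert a) (Pow I)"
      using insert.hyps by (auto simp: inj_on_def)
    show "(\<Sum>E\<in>Pow I. ennreal ((\<Prod>e\<in>E. p e) * (\<Prod>e\<in>I - E. 1 - p e)) * (F (insert a E) * ennreal (p a))) =
      sum ((\<lambda>E. ennreal ((\<Prod>e\<in>E. p e) * (\<Prod>e\<in>insert a I - E. 1 - p e)) * F E) \<circ> insert a) (Pow I)"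
    proof (rule sum.cong)
      fix E assume "E \<in> Pow I"
      then have E: "E \<subseteq> I" "finite E" "a \<notin> E" using insert.hyps finite_subset by auto
      then have "insert a I - insert a E = I - E" using insert.hyps by auto
      moreover have "(\<Prod>e\<in>insert a E. p e) = p a * (\<Prod>e\<in>E. p e)" using E by simp
      moreover have "0 \<le> (\<Prod>e\<in>E. p e) * (\<Prod>e\<in>I - E. 1 - p e)"
        using I E by (intro mult_nonneg_nonneg prod_nonneg) auto
      ultimately show "ennreal ((\<Prod>e\<in>E. p e) * (\<Prod>e\<in>I - E. 1 - p e)) * (F (insert a E) * ennreal (p a)) =
        ((\<lambda>E. ennreal ((\<Prod>e\<in>E. p e) * (\<Prod>e\<in>insert a I - E. 1 - p e)) * F E) \<circ> insert a) E"
        using a by (simp add: * mult.assoc)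
    qed simp
  qed
  also have "(\<Sum>E\<in>Pow I. ennreal ((\<Prod>e\<in>E. p e) * (\<Prod>e\<in>I - E. 1 - p e)) * (F E * ennreal (1 - p a)))
      = (\<Sum>E\<in>Pow I. ennreal ((\<Prod>e\<in>E. p e) * (\<Prod>e\<in>insert a I - E. 1 - p e)) * F E)"
  proof (rule sum.cong)
    fix E assume "E \<in> Pow I"
    then have E: "E \<subseteq> I" "finite E" "a \<notin> E" using insert.hyps finite_subset by auto
    then have "insert a I - E = insert a (I - E)" using insert.hyps by auto
    then have "(\<Prod>e\<in>insert a I - E. 1 - p e) = (1 - p a) * (\<Prod>e\<in>I - E. 1 - p e)"
      using insert.hyps by simp
    moreover have "0 \<le> (\<Prod>e\<in>E. p e) * (\<Prod>e\<in>I - E. 1 - p e)"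
      using I E by (intro mult_nonneg_nonneg prod_nonneg) auto
    ultimately show "ennreal ((\<Prod>e\<in>E. p e) * (\<Prod>e\<in>I - E. 1 - p e)) * (F E * ennreal (1 - p a)) =
        ennreal ((\<Prod>e\<in>E. p e) * (\<Prod>e\<in>insert a I - E. 1 - p e)) * F E"
      using a by (simp add: *) (simp add: ac_simps)
  qed simp
  also have "(\<Sum>E\<in>insert a ` Pow I. ennreal ((\<Prod>e\<in>E. p e) * (\<Prod>e\<in>insert a I - E. 1 - p e)) * F E)
      + (\<Sum>E\<in>Pow I. ennreal ((\<Prod>e\<in>E. p e) * (\<Prod>e\<in>insert a I - E. 1 - p e)) * F E)
      = (\<Sum>E\<in>Pow (insert a I). ennreal ((\<Prod>e\<in>E. p e) * (\<Prod>e\<in>insert a I - E. 1 - p e)) * F E)"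
    unfolding Pow_insert using insert.hyps
    by (subst sum.union_disjoint) (auto simp: add.commute)
  finally show ?case .
qed

definition edge_weight :: "('a \<Rightarrow> 'a \<Rightarrow> real) \<Rightarrow> 'a set set \<Rightarrow> 'a set set \<Rightarrow> real" where
  "edge_weight \<phi> I E = (\<Prod>e\<in>E. edge_prob \<phi> e) * (\<Prod>e\<in>I - E. 1 - edge_prob \<phi> e)"

locale connection_function =
  fixes \<phi> :: "'a::polish_space \<Rightarrow> 'a \<Rightarrow> real"
  assumes phi_measurable: "(\<lambda>(x, y). \<phi> x y) \<in> borel_measurable (borel \<Otimes>\<^sub>M borel)"
    and phi_range: "\<And>x y. 0 \<le> \<phi> x y \<and> \<phi> x y \<le> 1"
    and phi_sym: "\<And>x y. \<phi> x y = \<phi> y x"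
begin

lemma edge_prob_range: "e \<in> pairs V \<Longrightarrow> 0 \<le> edge_prob \<phi> e \<and> edge_prob \<phi> e \<le> 1"
  using phi_range by (auto elim!: pairsE simp: edge_prob_doubleton[OF phi_sym])

lemma edge_weight_nonneg: "E \<subseteq> I \<Longrightarrow> I \<subseteq> pairs V \<Longrightarrow> 0 \<le> edge_weight \<phi> I E"
  unfolding edge_weight_def using edge_prob_range
  by (intro mult_nonneg_nonneg prod_nonneg) (auto simp: subset_iff)

lemma nn_integral_graph_law:
  assumes "finite V" and g: "g \<in> borel_measurable graph_space"
  shows "(\<integral>\<^sup>+\<mu>. g \<mu> \<partial>graph_law \<phi> V) =
    (\<Sum>E\<in>Pow (pairs V). ennreal (edge_weight \<phi> (pairs V) E) * g (mk_graph V E))"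
proof -
  have lf: "loc_finite V" using assms(1) by (simp add: loc_finite_def)
  have "(\<integral>\<^sup>+\<mu>. g \<mu> \<partial>graph_law \<phi> V) = (\<integral>\<^sup>+b. g (mk_graph V {e \<in> pairs V. b e})
      \<partial>(\<Pi>\<^sub>M e\<in>pairs V. measure_pmf (bernoulli_pmf (edge_prob \<phi> e))))"
    unfolding graph_law_def
    by (rule nn_integral_distr[OF measurable_mk_graph[OF lf]]) (simp add: g)
  also have "\<dots> = (\<Sum>E\<in>Pow (pairs V). ennreal (edge_weight \<phi> (pairs V) E) * g (mk_graph V E))"
    unfolding edge_weight_def
    using finite_pairs[OF assms(1)] edge_prob_range by (rule nn_integral_PiM_bernoulli)
  finally show ?thesis .
qed

lemma prob_space_graph_law: "loc_finite V \<Longrightarrow> prob_space (graph_law \<phi> V)"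
  unfolding graph_law_def
  by (intro prob_space.prob_space_distr measurable_mk_graph prob_space_PiM prob_space_measure_pmf)

lemma sets_graph_law: "sets (graph_law \<phi> V) = sets graph_space"
  by (simp add: graph_law_def)

lemma measurable_edge_prob_tuple:
  assumes "e \<in> pairs I"
  shows "(\<lambda>x. edge_prob \<phi> (x ` e)) \<in> borel_measurable (PiM I (\<lambda>_. borel))"
proof -
  obtain i j where e: "e = {i, j}" and [measurable]: "i \<in> I" "j \<in> I" using assms by (rule pairsE)
  have "(\<lambda>x. (x i, x j)) \<in> PiM I (\<lambda>_. borel) \<rightarrow>\<^sub>M borel \<Otimes>\<^sub>M borel" by measurable
  from measurable_compose[OF this phi_measurable] show ?thesis
    by (simp add: e edge_prob_doubleton[OF phi_sym])
qed

lemma edge_weight_image: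
  assumes inj: "inj_on x J" and E: "E \<subseteq> pairs J"
  shows "edge_weight \<phi> (pairs (x ` J)) ((`) x ` E) =
    (\<Prod>e\<in>E. edge_prob \<phi> (x ` e)) * (\<Prod>e\<in>pairs J - E. 1 - edge_prob \<phi> (x ` e))"
proof -
  have inj': "inj_on ((`) x) (pairs J)"
    using inj_on_image_Pow[OF inj] pairs_subset_Pow by (rule inj_on_subset)
  have "pairs (x ` J) - (`) x ` E = (`) x ` (pairs J - E)"
    unfolding pairs_image[OF inj] using inj' E by (auto simp: inj_on_def)
  moreover have "inj_on ((`) x) E" "inj_on ((`) x) (pairs J - E)"
    using inj' E by (auto intro: inj_on_subset)
  ultimately show ?thesis by (simp add: edge_weight_def prod.reindex)
qed

text \<open>Along an enumeration of \<open>V\<close> the probability is a finite sum over edge sets on the indices with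
  measurable summands, so \<open>measurable_on_finite_sets\<close> applies.\<close>

lemma measurable_graph_law:
  assumes A: "A \<in> sets graph_space"
  shows "(\<lambda>V. if finite V then emeasure (graph_law \<phi> V) A else 0) \<in> borel_measurable point_space"
proof (rule measurable_on_finite_sets)
  define w where "w m E x = ennreal
    ((\<Prod>e\<in>E. edge_prob \<phi> (x ` e)) * (\<Prod>e\<in>pairs {..<m} - E. 1 - edge_prob \<phi> (x ` e)))"
    for m and E :: "nat set set" and x
  define G where "G m E x = mk_graph (x ` {..<m}) ((`) x ` E)" for m and E :: "nat set set" and x :: "nat \<Rightarrow> 'a"
  define h where "h m x = (\<Sum>E\<in>Pow (pairs {..<m}).
      w m E x * indicator {x. inj_on x {..<m} \<and> G m E x \<in> A} x)" for m x
  let ?M = "\<lambda>m. PiM {..<m::nat} (\<lambda>_. borel :: 'a measure)"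
  show "h m \<in> borel_measurable (?M m)" for m
    unfolding h_def
  proof (intro borel_measurable_sum borel_measurable_times_ennreal)
    fix E assume E: "E \<in> Pow (pairs {..<m})"
    show "w m E \<in> borel_measurable (?M m)"
      unfolding w_def
      using E measurable_edge_prob_tuple[of _ "{..<m}"]
      by (intro measurable_compose[OF _ measurable_ennreal] borel_measurable_times borel_measurable_prod
          borel_measurable_diff borel_measurable_const) auto
    have inj: "{x \<in> space (?M m). inj_on x {..<m}} \<in> sets (?M m)"
      using measurable_inj_on[of "{..<m}"] by (simp add: pred_def)
    have "G m E -` A \<inter> space (restrict_space (?M m) {x. inj_on x {..<m}}) \<in>
        sets (restrict_space (?M m) {x. inj_on x {..<m}})"
      using measurable_mk_graph_tuple[of E m] A E unfolding G_def by (intro measurable_sets) auto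
    then have "G m E -` A \<inter> space (restrict_space (?M m) {x. inj_on x {..<m}}) \<in> sets (?M m)"
      using inj by (subst (asm) sets_restrict_space_iff) (auto simp: Int_def conj_commute)
    also have "G m E -` A \<inter> space (restrict_space (?M m) {x. inj_on x {..<m}}) =
        {x. inj_on x {..<m} \<and> G m E x \<in> A} \<inter> space (?M m)"
      by (auto simp: space_restrict_space)
    finally show "(\<lambda>x. indicator {x. inj_on x {..<m} \<and> G m E x \<in> A} x :: ennreal) \<in> borel_measurable (?M m)"
      by (subst borel_measurable_indicator_iff)
  qed
  fix m and x :: "nat \<Rightarrow> 'a" assume inj: "inj_on x {..<m}"
  have "emeasure (graph_law \<phi> (x ` {..<m})) A = (\<integral>\<^sup>+\<mu>. indicator A \<mu> \<partial>graph_law \<phi> (x ` {..<m}))"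
    using A by (simp add: sets_graph_law)
  also have "\<dots> = (\<Sum>E\<in>Pow (pairs (x ` {..<m})).
      ennreal (edge_weight \<phi> (pairs (x ` {..<m})) E) * indicator A (mk_graph (x ` {..<m}) E))"
    using A by (intro nn_integral_graph_law) auto
  also have "Pow (pairs (x ` {..<m})) = (`) ((`) x) ` Pow (pairs {..<m})"
    unfolding pairs_image[OF inj] by (rule image_Pow_surj[symmetric]) simp
  also have "(\<Sum>E\<in>(`) ((`) x) ` Pow (pairs {..<m}).
      ennreal (edge_weight \<phi> (pairs (x ` {..<m})) E) * indicator A (mk_graph (x ` {..<m}) E)) = h m x"
  proof (subst sum.reindex)
    have "inj_on ((`) x) (pairs {..<m})"
      using inj_on_image_Pow[OF inj] pairs_subset_Pow by (rule inj_on_subset)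
    then show "inj_on ((`) ((`) x)) (Pow (pairs {..<m}))" by (rule inj_on_image_Pow)
  qed (auto simp: h_def w_def G_def edge_weight_image[OF inj] inj indicator_def intro!: sum.cong)
  finally show "emeasure (graph_law \<phi> (x ` {..<m})) A = h m x" .
qed

text \<open>The null measure for infinite \<open>V\<close> turns the law into a kernel on all of \<open>point_space\<close>; only the
  values at finite sets matter, because windows contain finitely many points.\<close>

definition finite_law :: "'a set \<Rightarrow> 'a graph measure" where
  "finite_law V = (if finite V then graph_law \<phi> V else null_measure graph_space)"

lemma measurable_finite_law: "finite_law \<in> point_space \<rightarrow>\<^sub>M subprob_algebra graph_space"
proof (rule measurable_subprob_algebra)
  fix V :: "'a set"
  have "{} \<in> (graphs :: 'a graph set)" by (simp add: graphs_def verts_def adj_def loc_finite_def irrefl_def sym_def)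
  then have "subprob_space (null_measure (graph_space :: 'a graph measure))"
    by (intro subprob_spaceI) (auto simp: space_graph_space)
  then show "subprob_space (finite_law V)"
    using prob_space_graph_law[of V]
    by (auto simp: finite_law_def loc_finite_def prob_space_imp_subprob_space)
  show "sets (finite_law V) = sets graph_space" by (simp add: finite_law_def sets_graph_law)
  fix A :: "'a graph set" assume "A \<in> sets graph_space"
  from measurable_graph_law[OF this]
  show "(\<lambda>V. emeasure (finite_law V) A) \<in> borel_measurable point_space"
    by (simp add: finite_law_def if_distrib[of "\<lambda>M. emeasure M A"] cong: if_cong)
qed

end

context connection_function
begin

text \<open>Edges between vertices in \<open>W\<close> are unaffected by the other edges; only finitely many of them are
  left, so the statement is the consistency of product measures.\<close>

lemma graph_law_restr:
  assumes V: "loc_finite V" and W: "W \<in> sets borel" "bounded W"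
    and A: "A \<in> sets graph_space"
  shows "emeasure (graph_law \<phi> V) (restr W -` A \<inter> space graph_space) = emeasure (graph_law \<phi> (V \<inter> W)) A"
proof -
  let ?Q = "\<lambda>e. measure_pmf (bernoulli_pmf (edge_prob \<phi> e))"
  let ?M = "\<lambda>V. \<Pi>\<^sub>M e\<in>pairs V. ?Q e"
  interpret product_prob_space ?Q "pairs V" ..
  have fin: "finite (V \<inter> W)" using V W by (simp add: loc_finite_def)
  then have VW: "loc_finite (V \<inter> W)" by (simp add: loc_finite_def)
  have sub: "pairs (V \<inter> W) \<subseteq> pairs V" by (auto simp: pairs_def)
  have [measurable]: "(\<lambda>b. mk_graph V {e \<in> pairs V. b e}) \<in> ?M V \<rightarrow>\<^sub>M graph_space"
    using V by (rule measurable_mk_graph)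
  have m: "(\<lambda>b. mk_graph (V \<inter> W) {e \<in> pairs (V \<inter> W). b e}) \<in> ?M (V \<inter> W) \<rightarrow>\<^sub>M graph_space"
    using VW by (rule measurable_mk_graph)
  have r: "(\<lambda>b. restrict b (pairs (V \<inter> W))) \<in> ?M V \<rightarrow>\<^sub>M ?M (V \<inter> W)"
    using sub by (rule measurable_restrict_subset)
  have eq: "restr W (mk_graph V {e \<in> pairs V. b e}) =
      mk_graph (V \<inter> W) {e \<in> pairs (V \<inter> W). restrict b (pairs (V \<inter> W)) e}" for b
  proof -
    have "{e \<in> pairs V. b e} \<inter> pairs W = {e \<in> pairs (V \<inter> W). restrict b (pairs (V \<inter> W)) e}"
      by (auto simp: pairs_def doubleton_eq_iff)
    then show ?thesis by (simp only: restr_mk_graph)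
  qed
  have "emeasure (graph_law \<phi> V) (restr W -` A \<inter> space graph_space) =
      emeasure (distr (graph_law \<phi> V) graph_space (restr W)) A"
    using measurable_restr[OF W(1)] A
    by (subst emeasure_distr) (simp_all add: graph_law_def cong: measurable_cong_sets)
  also have "distr (graph_law \<phi> V) graph_space (restr W) =
      distr (?M V) graph_space (\<lambda>b. restr W (mk_graph V {e \<in> pairs V. b e}))"
    unfolding graph_law_def using measurable_restr[OF W(1)] by (subst distr_distr) (auto simp: comp_def)
  also have "\<dots> = distr (distr (?M V) (?M (V \<inter> W)) (\<lambda>b. restrict b (pairs (V \<inter> W)))) graph_space
      (\<lambda>b. mk_graph (V \<inter> W) {e \<in> pairs (V \<inter> W). b e})"
    unfolding eq by (subst distr_distr[OF m r]) (simp add: comp_def)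
  also have "\<dots> = graph_law \<phi> (V \<inter> W)"
    using distr_PiM_restrict_finite[OF finite_pairs[OF fin] sub] by (simp add: graph_law_def)
  finally show ?thesis .
qed

lemma AE_graph_law_verts:
  assumes "finite V"
  shows "AE \<mu> in graph_law \<phi> V. verts \<mu> = V"
  unfolding graph_law_def
  using assms measurable_verts_eq[OF assms]
  by (subst AE_distr_iff[OF measurable_mk_graph])
    (auto simp: loc_finite_def pred_def verts_mk_graph)

end

section \<open>The Poisson process with a finite intensity measure\<close>

text \<open>To be applied to the restriction of the intensity measure to a bounded window. The measure is not
  normalised, since a window may have measure zero.\<close>

locale window = product_sigma_finite "\<lambda>_ :: nat. \<nu>" for \<nu> :: "'a::polish_space measure" +
  assumes sets_nu: "sets \<nu> = sets borel" and finite_nu: "emeasure \<nu> UNIV < \<infinity>"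
    and diffuse: "\<And>x. emeasure \<nu> {x} = 0"
begin

lemma sigma_finite_nu: "sigma_finite_measure \<nu>"
  using sigma_finite_measures .

lemma space_nu: "space \<nu> = UNIV"
  using sets_eq_imp_space_eq[OF sets_nu] by simp

lemma sets_PiM_nu: "sets (PiM I (\<lambda>_. \<nu>)) = sets (PiM I (\<lambda>_. borel))"
  by (rule sets_PiM_cong) (simp_all add: sets_nu)

lemma measurable_PiM_nu: "f \<in> PiM I (\<lambda>_. \<nu>) \<rightarrow>\<^sub>M N \<longleftrightarrow> f \<in> PiM I (\<lambda>_. borel) \<rightarrow>\<^sub>M N"
  by (simp only: measurable_cong_sets[OF sets_PiM_nu refl])

abbreviation mass :: real where "mass \<equiv> measure \<nu> UNIV"

lemma emeasure_nu_eq: "emeasure \<nu> B = ennreal (measure \<nu> B)"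
proof -
  have "emeasure \<nu> B \<le> emeasure \<nu> UNIV"
    using emeasure_space[of \<nu> B] by (simp add: space_nu)
  then have "emeasure \<nu> B \<noteq> \<infinity>" using finite_nu by (auto simp: top_unique)
  then show ?thesis by (simp add: emeasure_eq_ennreal_measure)
qed

text \<open>Forgetting the labels of the points makes such laws accessible to a comparison of void
  probabilities.\<close>

definition tuple_law :: "nat set \<Rightarrow> 'a set measure" where
  "tuple_law I = distr (PiM I (\<lambda>_. \<nu>)) point_space (\<lambda>x. x ` I)"

lemma sets_tuple_law: "sets (tuple_law I) = sets point_space"
  by (simp add: tuple_law_def)

lemma measurable_image_PiM_nu:
  "finite J \<Longrightarrow> J \<subseteq> I \<Longrightarrow> (\<lambda>x. x ` J) \<in> PiM I (\<lambda>_. \<nu>) \<rightarrow>\<^sub>M point_space"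
  unfolding measurable_PiM_nu by (rule measurable_image_tuple)

lemma emeasure_tuple_law_void:
  assumes "finite I" and B: "B \<in> sets borel"
  shows "emeasure (tuple_law I) {S. loc_finite S \<and> S \<inter> B = {}} = emeasure \<nu> (- B) ^ card I"
proof -
  have "{S. loc_finite S \<and> S \<inter> B = {}} \<in> sets point_space"
    using measurable_void[OF B] by (simp add: pred_def space_point_space)
  then have "emeasure (tuple_law I) {S. loc_finite S \<and> S \<inter> B = {}} =
      emeasure (PiM I (\<lambda>_. \<nu>)) ((\<lambda>x. x ` I) -` {S. loc_finite S \<and> S \<inter> B = {}} \<inter> space (PiM I (\<lambda>_. \<nu>)))"
    unfolding tuple_law_def using assms(1) by (intro emeasure_distr measurable_image_PiM_nu) auto
  also have "(\<lambda>x. x ` I) -` {S. loc_finite S \<and> S \<inter> B = {}} \<inter> space (PiM I (\<lambda>_. \<nu>)) = PiE I (\<lambda>_. - B)"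
    using assms(1) by (auto simp: space_PiM space_nu loc_finite_def PiE_iff)
  also have "emeasure (PiM I (\<lambda>_. \<nu>)) (PiE I (\<lambda>_. - B)) = emeasure \<nu> (- B) ^ card I"
    using assms B by (subst emeasure_PiM) (auto simp: sets_nu)
  finally show ?thesis .
qed

lemma space_tuple_law: "space (tuple_law I) = {S. loc_finite S}"
  by (simp add: tuple_law_def space_point_space)

lemma emeasure_tuple_law_space: "finite I \<Longrightarrow> emeasure (tuple_law I) (space (tuple_law I)) = emeasure \<nu> UNIV ^ card I"
  using emeasure_tuple_law_void[of I "{}"] by (simp add: space_tuple_law)

text \<open>A set forgets the labels of its points, so only the number of labels matters. Void probabilities
  show this without a permutation of coordinates.\<close>

lemma tuple_law_eq:
  assumes "finite I" "finite J" "card I = card J"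
  shows "tuple_law I = tuple_law J"
  using assms emeasure_tuple_law_space[OF assms(1)] finite_nu
  by (intro measure_eqI_void) (auto simp: sets_tuple_law emeasure_tuple_law_void emeasure_nu_eq ennreal_power)

text \<open>When the coordinate \<open>i\<close> is integrated first, the other coordinates and \<open>v\<close> are fixed, and a diffuse
  measure does not charge them.\<close>

lemma AE_tuple_distinct:
  fixes I :: "nat set"
  assumes "finite I"
  shows "AE x in PiM I (\<lambda>_. \<nu>). inj_on x I \<and> v \<notin> x ` I"
proof -
  have *: "AE x in PiM I (\<lambda>_. \<nu>). x i \<noteq> c x"
    if i: "i \<in> I" and c: "c \<in> PiM I (\<lambda>_. \<nu>) \<rightarrow>\<^sub>M borel" and upd: "\<And>x y. c (x(i := y)) = c x" for i c
  proof -
    have [measurable]: "(\<lambda>x. x i) \<in> PiM I (\<lambda>_. \<nu>) \<rightarrow>\<^sub>M borel"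
      using measurable_component_singleton[OF i, of "\<lambda>_. borel :: 'a measure"] measurable_PiM_nu by auto
    note c[measurable]
    have "Measurable.pred (PiM I (\<lambda>_. \<nu>)) (\<lambda>x. dist (x i) (c x) = 0)" by measurable
    then have m: "Measurable.pred (PiM I (\<lambda>_. \<nu>)) (\<lambda>x. x i = c x)" by simp
    let ?f = "\<lambda>x. indicator {x. x i = c x} x :: ennreal"
    have f: "?f \<in> borel_measurable (PiM I (\<lambda>_. \<nu>))"
      using m by (subst borel_measurable_indicator_iff) (simp add: pred_def Int_def conj_commute)
    have I: "insert i (I - {i}) = I" using i by auto
    have "(\<integral>\<^sup>+x. ?f x \<partial>PiM I (\<lambda>_. \<nu>)) =
        (\<integral>\<^sup>+x. \<integral>\<^sup>+y. ?f (x(i := y)) \<partial>\<nu> \<partial>PiM (I - {i}) (\<lambda>_. \<nu>))"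
      using product_nn_integral_insert[of "I - {i}" i ?f] assms f unfolding I by simp
    also have "\<dots> = (\<integral>\<^sup>+x. \<integral>\<^sup>+y. indicator {c x} y \<partial>\<nu> \<partial>PiM (I - {i}) (\<lambda>_. \<nu>))"
      by (intro nn_integral_cong) (auto simp: upd indicator_def)
    also have "\<dots> = 0"
      by (simp add: sets_nu diffuse)
    finally have "AE x in PiM I (\<lambda>_. \<nu>). ?f x = 0"
      using f by (subst (asm) nn_integral_0_iff_AE) auto
    then show ?thesis by eventually_elim (auto simp: indicator_def)
  qed
  have "AE x in PiM I (\<lambda>_. \<nu>). x i \<noteq> v" if "i \<in> I" for i
    using that by (rule *) auto
  then have 1: "AE x in PiM I (\<lambda>_. \<nu>). \<forall>i\<in>I. x i \<noteq> v"
    using assms by (intro AE_finite_allI) auto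
  have "AE x in PiM I (\<lambda>_. \<nu>). i \<noteq> j \<longrightarrow> x i \<noteq> x j" if "i \<in> I" "j \<in> I" for i j
  proof (cases "i = j")
    case False
    have "AE x in PiM I (\<lambda>_. \<nu>). x i \<noteq> x j"
    proof (rule *)
      show "(\<lambda>x. x j) \<in> PiM I (\<lambda>_. \<nu>) \<rightarrow>\<^sub>M borel"
        unfolding measurable_PiM_nu using that(2) by (rule measurable_component_singleton)
    qed (use that False in auto)
    then show ?thesis by eventually_elim auto
  qed auto
  then have 2: "AE x in PiM I (\<lambda>_. \<nu>). \<forall>i\<in>I. \<forall>j\<in>I. i \<noteq> j \<longrightarrow> x i \<noteq> x j"
    using assms by (intro AE_finite_allI) auto
  show ?thesis
    using 1 2 by eventually_elim (auto simp: inj_on_def)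
qed

definition poisson_term :: "real \<Rightarrow> nat \<Rightarrow> 'a set measure" where
  "poisson_term t m = scale_measure (ennreal (exp (- t * mass) * t ^ m / fact m)) (tuple_law {..<m})"

text \<open>The explicit Poisson process: given that there are \<open>m\<close> points, they are independent with law
  proportional to \<open>\<nu>\<close>. The normalisation and the Poisson weights are merged in \<open>poisson_term\<close>, and
  binding the counting measure sums over \<open>m\<close>.\<close>

definition poisson_law :: "real \<Rightarrow> 'a set measure" where
  "poisson_law t = count_space UNIV \<bind> poisson_term t"

lemma measurable_poisson_term:
  assumes "0 \<le> t"
  shows "poisson_term t \<in> count_space UNIV \<rightarrow>\<^sub>M subprob_algebra point_space"
proof (rule measurable_subprob_algebra)
  fix m
  have "emeasure (poisson_term t m) (space (poisson_term t m)) =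
      ennreal (exp (- t * mass) * t ^ m / fact m) * ennreal (mass ^ m)"
    using emeasure_tuple_law_space[of "{..<m}"]
    by (simp add: poisson_term_def space_scale_measure emeasure_nu_eq ennreal_power)
  also have "\<dots> = ennreal (exp (- (t * mass)) * ((t * mass) ^ m / fact m))"
    using assms by (subst ennreal_mult[symmetric]) (auto simp: power_mult_distrib field_simps)
  also have "\<dots> \<le> 1"
  proof -
    have "(t * mass) ^ m / fact m \<le> (\<Sum>i\<in>{..m}. (t * mass) ^ i / fact i)"
      using assms by (intro member_le_sum) auto
    also have "\<dots> \<le> exp (t * mass)"
      unfolding exp_def using assms summable_exp[of "t * mass"]
      by (intro order.trans[OF sum_le_suminf[of _ "{..m}"]]) (auto simp: divide_inverse ac_simps)
    finally show ?thesis by (simp add: exp_minus field_simps)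
  qed
  finally show "subprob_space (poisson_term t m)"
    by (intro subprob_spaceI) (auto simp: poisson_term_def space_scale_measure space_tuple_law loc_finite_def intro: exI[of _ "{}"])
qed (auto simp: poisson_term_def sets_tuple_law)

lemma sets_poisson_law: "0 \<le> t \<Longrightarrow> sets (poisson_law t) = sets point_space"
  unfolding poisson_law_def
  using measurable_poisson_term by (intro sets_bind_measurable) auto

lemma nn_integral_poisson_law:
  assumes "0 \<le> t" and f: "f \<in> borel_measurable point_space"
  shows "(\<integral>\<^sup>+S. f S \<partial>poisson_law t) =
    (\<Sum>m. ennreal (exp (- t * mass) * t ^ m / fact m) * (\<integral>\<^sup>+S. f S \<partial>tuple_law {..<m}))"
  unfolding poisson_law_def using f
  by (subst nn_integral_bind[OF _ measurable_poisson_term[OF assms(1)]])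
    (auto simp: nn_integral_count_space_nat poisson_term_def nn_integral_scale_measure sets_tuple_law
      cong: measurable_cong_sets)

text \<open>The void probability is the exponential series of \<open>t * measure \<nu> (- B)\<close>, multiplied by
  \<open>exp (- t * mass)\<close>.\<close>

lemma emeasure_poisson_law_void:
  assumes t: "0 \<le> t" and B: "B \<in> sets borel"
  shows "emeasure (poisson_law t) {S. loc_finite S \<and> S \<inter> B = {}} = ennreal (exp (- t * measure \<nu> B))"
proof -
  let ?A = "{S. loc_finite S \<and> S \<inter> B = {}}"
  have A: "?A \<in> sets point_space"
    using measurable_void[OF B] by (simp add: pred_def space_point_space)
  have nB: "measure \<nu> (- B) = mass - measure \<nu> B"
    using B finite_nu measure_Diff[of \<nu> UNIV B] by (simp add: sets_nu Compl_eq_Diff_UNIV)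
  have "emeasure (poisson_law t) ?A = (\<integral>\<^sup>+S. indicator ?A S \<partial>poisson_law t)"
    using A t by (simp add: sets_poisson_law)
  also have "\<dots> = (\<Sum>m. ennreal (exp (- t * mass) * t ^ m / fact m) * emeasure (tuple_law {..<m}) ?A)"
    using A t by (subst nn_integral_poisson_law) (auto simp: sets_tuple_law)
  also have "\<dots> = (\<Sum>m. ennreal (exp (- t * mass) * ((t * measure \<nu> (- B)) ^ m / fact m)))"
    using t B by (simp add: emeasure_tuple_law_void emeasure_nu_eq ennreal_power ennreal_mult[symmetric]
        power_mult_distrib field_simps)
  also have "\<dots> = ennreal (\<Sum>m. exp (- t * mass) * ((t * measure \<nu> (- B)) ^ m / fact m))"
    using t summable_exp[of "t * measure \<nu> (- B)"]
    by (intro suminf_ennreal2 summable_mult) (auto simp: divide_inverse ac_simps)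
  also have "(\<Sum>m. exp (- t * mass) * ((t * measure \<nu> (- B)) ^ m / fact m)) =
      exp (- t * mass) * exp (t * measure \<nu> (- B))"
    using exp_converges[of "t * measure \<nu> (- B)"]
    by (intro sums_unique[symmetric] sums_mult) (simp add: divide_inverse ac_simps)
  also have "\<dots> = exp (- t * measure \<nu> B)"
    unfolding nB by (simp add: exp_add[symmetric] algebra_simps)
  finally show ?thesis .
qed

end

section \<open>The cluster inside a finite vertex set\<close>

lemma sum_Pow_Un_disjoint:
  fixes F :: "'b set \<Rightarrow> 'c::comm_monoid_add"
  assumes "A \<inter> B = {}"
  shows "(\<Sum>E\<in>Pow (A \<union> B). F E) = (\<Sum>E\<^sub>1\<in>Pow A. \<Sum>E\<^sub>2\<in>Pow B. F (E\<^sub>1 \<union> E\<^sub>2))"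
proof -
  have "bij_betw (\<lambda>(E\<^sub>1, E\<^sub>2). E\<^sub>1 \<union> E\<^sub>2) (Pow A \<times> Pow B) (Pow (A \<union> B))"
    using assms by (intro bij_betwI[where g="\<lambda>E. (E \<inter> A, E \<inter> B)"]) auto
  then have "(\<Sum>E\<in>Pow (A \<union> B). F E) = (\<Sum>z\<in>Pow A \<times> Pow B. F (case z of (E\<^sub>1, E\<^sub>2) \<Rightarrow> E\<^sub>1 \<union> E\<^sub>2))"
    by (rule sum.reindex_bij_betw[symmetric])
  then show ?thesis by (simp add: sum.cartesian_product split_beta')
qed

context connection_function
begin

lemma sum_edge_weight:
  assumes "finite V"
  shows "(\<Sum>E\<in>Pow (pairs V). ennreal (edge_weight \<phi> (pairs V) E)) = 1"
proof -
  interpret prob_space "graph_law \<phi> V"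
    using assms by (intro prob_space_graph_law) (simp add: loc_finite_def)
  show ?thesis
    using nn_integral_graph_law[OF assms, of "\<lambda>_. 1"] emeasure_space_1 by simp
qed

text \<open>The probability that a point at \<open>y\<close> is joined to no vertex in \<open>V\<close>.\<close>

definition avoid :: "'a set \<Rightarrow> 'a \<Rightarrow> real" where
  "avoid V y = (\<Prod>z\<in>V. 1 - \<phi> z y)"

lemma avoid_range: "0 \<le> avoid V y" "avoid V y \<le> 1"
  unfolding avoid_def using phi_range by (auto intro: prod_nonneg prod_le_1)

text \<open>The component of \<open>v\<close> in a graph on \<open>V\<close> has vertex set \<open>U\<close> iff no edge joins \<open>U\<close> to its complement and
  the induced graph on \<open>U\<close> is connected. The edges inside \<open>U\<close>, those leaving \<open>U\<close> and those outside \<open>U\<close>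
  are independent; the last group integrates to \<open>1\<close>, and the second one contributes the product.\<close>

lemma nn_integral_component_eq:
  assumes "finite V" and v: "v \<in> U" "U \<subseteq> V" and g: "g \<in> borel_measurable graph_space"
  shows "(\<integral>\<^sup>+\<mu>. g (component v \<mu>) * indicator {\<mu>. verts \<mu> = U} (component v \<mu>) \<partial>graph_law \<phi> V) =
    (\<integral>\<^sup>+\<mu>. g \<mu> * indicator (connected_from v) \<mu> \<partial>graph_law \<phi> U) * ennreal (\<Prod>y\<in>V - U. avoid U y)"
proof -
  have U: "finite U" using assms finite_subset by auto
  define A C where "A = pairs U" and "C = pairs (V - U)"
  \<comment> \<open>The edges leaving \<open>U\<close>, parametrised by their outer and inner end point.\<close>
  define X where "X = (\<lambda>(y, z). {z, y}) ` ((V - U) \<times> U)"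
  define G where "G \<mu> = g (component v \<mu>) * indicator {\<mu>. verts \<mu> = U} (component v \<mu>)" for \<mu>
  define H where "H \<mu> = g \<mu> * indicator (connected_from v) \<mu>" for \<mu>
  have G: "G \<in> borel_measurable graph_space"
  proof -
    have "(\<lambda>\<mu>. g \<mu> * indicator {\<mu>. verts \<mu> = U} \<mu>) \<in> borel_measurable graph_space"
      using g borel_measurable_indicator_pred[OF measurable_verts_eq[OF U]]
      by (intro borel_measurable_times_ennreal) auto
    from measurable_compose[OF measurable_component this] show ?thesis by (simp add: G_def[abs_def])
  qed
  have H: "H \<in> borel_measurable graph_space"
    unfolding H_def using g borel_measurable_indicator_pred[OF measurable_connected_from[of v]]
    by (intro borel_measurable_times_ennreal) auto
  have pairs_V: "pairs V = (A \<union> C) \<union> X"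
  proof (intro set_eqI iffI)
    fix e assume "e \<in> pairs V"
    then obtain x y where e: "e = {x, y}" "x \<in> V" "y \<in> V" "x \<noteq> y" by (rule pairsE)
    show "e \<in> (A \<union> C) \<union> X"
    proof (cases "x \<in> U \<longleftrightarrow> y \<in> U")
      case True
      then show ?thesis using e by (auto simp: A_def C_def intro: pairsI)
    next
      case False
      then have "(y, x) \<in> (V - U) \<times> U \<or> (x, y) \<in> (V - U) \<times> U" using e by auto
      then show ?thesis using e unfolding X_def by (auto simp: insert_commute intro: rev_image_eqI)
    qed
  next
    fix e assume "e \<in> (A \<union> C) \<union> X"
    then show "e \<in> pairs V"
      using v(2) unfolding A_def C_def X_def by (auto elim!: pairsE intro!: pairsI)
  qed
  have disj: "A \<inter> C = {}" "(A \<union> C) \<inter> X = {}"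
    by (auto simp: A_def C_def X_def pairs_def doubleton_eq_iff)
  have fin: "finite A" "finite C" "finite X"
    using assms(1) U finite_pairs by (auto simp: A_def C_def X_def)
  have cross: "G (mk_graph V E) = 0" if E: "E \<subseteq> pairs V" "E \<inter> X \<noteq> {}" for E
  proof -
    obtain y z where yz: "{z, y} \<in> E" "y \<in> V" "y \<notin> U" "z \<in> U" using E(2) by (auto simp: X_def)
    have "verts (component v (mk_graph V E)) \<noteq> U"
    proof
      assume eq: "verts (component v (mk_graph V E)) = U"
      with yz have "(v, z) \<in> (adj (mk_graph V E))\<^sup>*" by (auto simp: verts_component)
      moreover have "(z, y) \<in> adj (mk_graph V E)" using yz v(2) by (auto simp: adj_mk_graph)
      ultimately have "y \<in> verts (component v (mk_graph V E))"
        using yz by (auto simp: verts_component verts_mk_graph intro: rtrancl_into_rtrancl)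
      with eq yz show False by auto
    qed
    then show ?thesis by (simp add: G_def)
  qed
  have inner: "G (mk_graph V (E\<^sub>1 \<union> E\<^sub>2)) = H (mk_graph U E\<^sub>1)" if E: "E\<^sub>1 \<subseteq> A" "E\<^sub>2 \<subseteq> C" for E\<^sub>1 E\<^sub>2
  proof -
    let ?\<mu> = "mk_graph V (E\<^sub>1 \<union> E\<^sub>2)"
    have "x \<in> U" if "(v, x) \<in> (adj ?\<mu>)\<^sup>*" for x
      using that
    proof induction
      case (step y z)
      then show ?case using E by (auto simp: adj_mk_graph A_def C_def pairs_def doubleton_eq_iff)
    qed (use v in simp)
    then have sub: "verts (component v ?\<mu>) \<subseteq> U" by (auto simp: verts_component)
    have "restr U ?\<mu> = mk_graph (V \<inter> U) ((E\<^sub>1 \<union> E\<^sub>2) \<inter> pairs U)" by (rule restr_mk_graph)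
    also have "V \<inter> U = U" using v(2) by auto
    also have "(E\<^sub>1 \<union> E\<^sub>2) \<inter> pairs U = E\<^sub>1" using E disj(1) by (auto simp: A_def)
    finally have r: "restr U ?\<mu> = mk_graph U E\<^sub>1" .
    have "component v (restr U ?\<mu>) = component v ?\<mu>"
      using assms(1) v sub by (intro component_restr_eq) (auto simp: mk_graph_in_graphs loc_finite_def verts_mk_graph)
    then have "component v ?\<mu> = component v (mk_graph U E\<^sub>1)" by (simp add: r)
    moreover have "verts (component v (mk_graph U E\<^sub>1)) = U \<longleftrightarrow> mk_graph U E\<^sub>1 \<in> connected_from v"
      using verts_component_eq_iff[of v "mk_graph U E\<^sub>1"] by (simp add: verts_mk_graph)
    ultimately show ?thesis
      by (cases "mk_graph U E\<^sub>1 \<in> connected_from v") (auto simp: G_def H_def component_eq_self)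
  qed
  have weight: "edge_weight \<phi> (pairs V) (E\<^sub>1 \<union> E\<^sub>2) =
      edge_weight \<phi> A E\<^sub>1 * edge_weight \<phi> C E\<^sub>2 * (\<Prod>y\<in>V - U. avoid U y)" if E: "E\<^sub>1 \<subseteq> A" "E\<^sub>2 \<subseteq> C" for E\<^sub>1 E\<^sub>2
  proof -
    have fin': "finite E\<^sub>1" "finite E\<^sub>2" using E fin finite_subset by auto
    have "pairs V - (E\<^sub>1 \<union> E\<^sub>2) = ((A - E\<^sub>1) \<union> (C - E\<^sub>2)) \<union> X"
      unfolding pairs_V using E disj by auto
    moreover have "((A - E\<^sub>1) \<union> (C - E\<^sub>2)) \<inter> X = {}" "(A - E\<^sub>1) \<inter> (C - E\<^sub>2) = {}" "E\<^sub>1 \<inter> E\<^sub>2 = {}"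
      using disj E by auto
    moreover have "(\<Prod>e\<in>X. 1 - edge_prob \<phi> e) = (\<Prod>y\<in>V - U. avoid U y)"
    proof -
      have "inj_on (\<lambda>(y, z). {z, y}) ((V - U) \<times> U)"
        by (auto simp: inj_on_def doubleton_eq_iff)
      then have "(\<Prod>e\<in>X. 1 - edge_prob \<phi> e) = (\<Prod>(y, z)\<in>(V - U) \<times> U. 1 - \<phi> z y)"
        unfolding X_def by (subst prod.reindex) (auto simp: edge_prob_doubleton[OF phi_sym] intro!: prod.cong)
      then show ?thesis by (simp add: prod.cartesian_product avoid_def)
    qed
    ultimately show ?thesis
      using fin fin' unfolding edge_weight_def by (simp add: prod.union_disjoint)
  qed
  have wA: "0 \<le> edge_weight \<phi> A E" if "E \<subseteq> A" for E
    using edge_weight_nonneg[of E A U] that by (simp add: A_def)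
  have wC: "0 \<le> edge_weight \<phi> C E" if "E \<subseteq> C" for E
    using edge_weight_nonneg[of E C "V - U"] that by (simp add: C_def)
  have p: "0 \<le> (\<Prod>y\<in>V - U. avoid U y)" by (intro prod_nonneg) (simp add: avoid_range)
  have "(\<integral>\<^sup>+\<mu>. G \<mu> \<partial>graph_law \<phi> V) =
      (\<Sum>E\<in>Pow (pairs V). ennreal (edge_weight \<phi> (pairs V) E) * G (mk_graph V E))"
    using assms(1) G by (rule nn_integral_graph_law)
  also have "\<dots> = (\<Sum>E\<in>Pow (A \<union> C). ennreal (edge_weight \<phi> (pairs V) E) * G (mk_graph V E))"
  proof (rule sum.mono_neutral_right)
    show "finite (Pow (pairs V))" "Pow (A \<union> C) \<subseteq> Pow (pairs V)" using fin by (auto simp: pairs_V)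
    show "\<forall>E\<in>Pow (pairs V) - Pow (A \<union> C). ennreal (edge_weight \<phi> (pairs V) E) * G (mk_graph V E) = 0"
    proof
      fix E assume "E \<in> Pow (pairs V) - Pow (A \<union> C)"
      then have "E \<subseteq> pairs V" "E \<inter> X \<noteq> {}" by (auto simp: pairs_V)
      then show "ennreal (edge_weight \<phi> (pairs V) E) * G (mk_graph V E) = 0" by (simp add: cross)
    qed
  qed
  also have "\<dots> = (\<Sum>E\<^sub>1\<in>Pow A. \<Sum>E\<^sub>2\<in>Pow C.
      ennreal (edge_weight \<phi> (pairs V) (E\<^sub>1 \<union> E\<^sub>2)) * G (mk_graph V (E\<^sub>1 \<union> E\<^sub>2)))"
    using disj(1) by (rule sum_Pow_Un_disjoint)
  also have "\<dots> = (\<Sum>E\<^sub>1\<in>Pow A. \<Sum>E\<^sub>2\<in>Pow C. ennreal (edge_weight \<phi> C E\<^sub>2) *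
      (ennreal (edge_weight \<phi> A E\<^sub>1) * H (mk_graph U E\<^sub>1) * ennreal (\<Prod>y\<in>V - U. avoid U y)))"
    using wA wC p by (intro sum.cong) (auto simp: weight inner ennreal_mult ac_simps)
  also have "\<dots> = (\<Sum>E\<^sub>1\<in>Pow A. ennreal (edge_weight \<phi> A E\<^sub>1) * H (mk_graph U E\<^sub>1)) *
      ennreal (\<Prod>y\<in>V - U. avoid U y)"
    using sum_edge_weight[of "V - U"] assms(1)
    by (simp add: sum_distrib_right[symmetric] C_def)
  also have "(\<Sum>E\<^sub>1\<in>Pow A. ennreal (edge_weight \<phi> A E\<^sub>1) * H (mk_graph U E\<^sub>1)) = (\<integral>\<^sup>+\<mu>. H \<mu> \<partial>graph_law \<phi> U)"
    unfolding A_def using U H by (rule nn_integral_graph_law[symmetric])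
  finally show ?thesis unfolding G_def H_def .
qed

text \<open>A Poisson process with intensity \<open>t\<close> times \<open>N\<close> has a mean number \<open>t * hit N V\<close> of points that are
  joined to a vertex in \<open>V\<close>.\<close>

definition hit :: "'a measure \<Rightarrow> 'a set \<Rightarrow> ennreal" where
  "hit N V = (\<integral>\<^sup>+y. ennreal (1 - avoid V y) \<partial>N)"

text \<open>The value \<open>0\<close> for an infinite \<open>hit N (verts \<mu>)\<close> is the limit of the exponential for \<open>c > 0\<close>.\<close>

definition damp :: "'a measure \<Rightarrow> real \<Rightarrow> 'a graph \<Rightarrow> ennreal" where
  "damp N c \<mu> = (if finite (verts \<mu>) \<and> hit N (verts \<mu>) < \<infinity>
    then ennreal (exp (- c * enn2real (hit N (verts \<mu>)))) else 0)"

text \<open>The contribution of clusters with vertex set \<open>insert v T\<close>, regardless of the points outside \<open>T\<close>.\<close>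

definition cluster_weight :: "('a graph \<Rightarrow> ennreal) \<Rightarrow> 'a \<Rightarrow> 'a set \<Rightarrow> ennreal" where
  "cluster_weight g v T = (\<integral>\<^sup>+\<mu>. g \<mu> * indicator (connected_from v) \<mu> \<partial>finite_law (insert v T))"

lemma measurable_cluster_weight:
  assumes g: "g \<in> borel_measurable graph_space"
  shows "cluster_weight g v \<in> borel_measurable point_space"
  unfolding cluster_weight_def
proof (rule nn_integral_measurable_subprob_algebra2)
  have "(\<lambda>\<mu>. g \<mu> * indicator (connected_from v) \<mu>) \<in> borel_measurable graph_space"
    using g borel_measurable_indicator_pred[OF measurable_connected_from[of v]]
    by (intro borel_measurable_times_ennreal) auto
  then show "(\<lambda>(T, \<mu>). g \<mu> * indicator (connected_from v) \<mu>) \<in>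
      borel_measurable (point_space \<Otimes>\<^sub>M graph_space)"
    unfolding split_beta' by (rule measurable_compose[OF measurable_snd])
  show "(\<lambda>T. finite_law (insert v T)) \<in> point_space \<rightarrow>\<^sub>M subprob_algebra graph_space"
    using measurable_insert measurable_finite_law by (rule measurable_compose)
qed

text \<open>The set \<open>T\<close> consists of the vertices of the component other than \<open>v\<close>; each possible value is
  treated by \<open>nn_integral_component_eq\<close>.\<close>

lemma nn_integral_component_card:
  assumes S: "finite S" "v \<notin> S" and g: "g \<in> borel_measurable graph_space"
  shows "(\<integral>\<^sup>+\<mu>. g (component v \<mu>) * indicator {\<mu>. num (verts \<mu>) = of_nat (Suc k)} (component v \<mu>)
      \<partial>finite_law (insert v S)) =
    (\<Sum>T\<in>{T. T \<subseteq> S \<and> card T = k}. cluster_weight g v T * ennreal (\<Prod>y\<in>S - T. avoid (insert v T) y))"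
proof -
  let ?V = "insert v S"
  let ?K = "{T. T \<subseteq> S \<and> card T = k}"
  have finK: "finite ?K" by (rule finite_subset[of _ "Pow S"]) (use S in auto)
  have eq: "indicator {\<mu>. num (verts \<mu>) = of_nat (Suc k)} (component v \<mu>) =
      (\<Sum>T\<in>?K. indicator {\<mu>. verts \<mu> = insert v T} (component v \<mu>) :: ennreal)"
    if "verts \<mu> = ?V" for \<mu>
  proof -
    define U where "U = verts (component v \<mu>)"
    have U: "v \<in> U" "U \<subseteq> ?V" using that by (auto simp: U_def verts_component)
    then have finU: "finite U" using S finite_subset by blast
    have iff: "U = insert v T \<longleftrightarrow> T = U - {v}" if "T \<in> ?K" for T
      using that S(2) U by auto
    have "(\<Sum>T\<in>?K. indicator {\<mu>. verts \<mu> = insert v T} (component v \<mu>) :: ennreal) =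
        (\<Sum>T\<in>?K. if T = U - {v} then 1 else 0)"
      by (intro sum.cong) (simp_all add: indicator_def U_def[symmetric] iff)
    also have "\<dots> = (if U - {v} \<in> ?K then 1 else 0)"
      using finK by (simp add: sum.delta)
    also have "U - {v} \<in> ?K \<longleftrightarrow> card U = Suc k"
      using U finU by (auto simp: card_Diff_singleton card_gt_0_iff)
        (metis Suc_pred card_gt_0_iff empty_iff)
    finally show ?thesis
      using finU by (auto simp: U_def[symmetric] num_eq_of_nat_iff simp del: of_nat_Suc)
  qed
  have meas: "(\<lambda>\<mu>. g (component v \<mu>) * indicator {\<mu>. verts \<mu> = insert v T} (component v \<mu>))
      \<in> borel_measurable (graph_law \<phi> ?V)" if "T \<in> ?K" for T
  proof -
    have "finite (insert v T)" using that S finite_subset by auto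
    from borel_measurable_indicator_pred[OF measurable_verts_eq[OF this]] g
    have "(\<lambda>\<mu>. g \<mu> * indicator {\<mu>. verts \<mu> = insert v T} \<mu>) \<in> borel_measurable graph_space"
      by (intro borel_measurable_times_ennreal) auto
    from measurable_compose[OF measurable_component this] show ?thesis
      by (simp add: sets_graph_law cong: measurable_cong_sets)
  qed
  have "(\<integral>\<^sup>+\<mu>. g (component v \<mu>) * indicator {\<mu>. num (verts \<mu>) = of_nat (Suc k)} (component v \<mu>)
      \<partial>graph_law \<phi> ?V) =
    (\<integral>\<^sup>+\<mu>. (\<Sum>T\<in>?K. g (component v \<mu>) * indicator {\<mu>. verts \<mu> = insert v T} (component v \<mu>)) \<partial>graph_law \<phi> ?V)"
  proof (rule nn_integral_cong_AE)
    have "AE \<mu> in graph_law \<phi> ?V. verts \<mu> = ?V" using S by (intro AE_graph_law_verts) auto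
    then show "AE \<mu> in graph_law \<phi> ?V.
        g (component v \<mu>) * indicator {\<mu>. num (verts \<mu>) = of_nat (Suc k)} (component v \<mu>) =
        (\<Sum>T\<in>?K. g (component v \<mu>) * indicator {\<mu>. verts \<mu> = insert v T} (component v \<mu>))"
      by eventually_elim (simp only: eq sum_distrib_left)
  qed
  also have "\<dots> = (\<Sum>T\<in>?K.
      \<integral>\<^sup>+\<mu>. g (component v \<mu>) * indicator {\<mu>. verts \<mu> = insert v T} (component v \<mu>) \<partial>graph_law \<phi> ?V)"
    using meas by (rule nn_integral_sum)
  also have "\<dots> = (\<Sum>T\<in>?K. cluster_weight g v T * ennreal (\<Prod>y\<in>S - T. avoid (insert v T) y))"
  proof (rule sum.cong)
    fix T assume T: "T \<in> ?K"
    have "insert v S - insert v T = S - T" using S T by auto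
    moreover have "finite T" using T S finite_subset by auto
    ultimately show "(\<integral>\<^sup>+\<mu>. g (component v \<mu>) * indicator {\<mu>. verts \<mu> = insert v T} (component v \<mu>) \<partial>graph_law \<phi> ?V) =
        cluster_weight g v T * ennreal (\<Prod>y\<in>S - T. avoid (insert v T) y)"
      using T S nn_integral_component_eq[of ?V v "insert v T" g] g
      by (auto simp: cluster_weight_def finite_law_def)
  qed simp
  finally show ?thesis using S by (simp add: finite_law_def)
qed

lemma measurable_avoid_tuple:
  assumes "finite I"
  shows "(\<lambda>(x, y). \<Prod>i\<in>I. 1 - \<phi> (x i) y) \<in> borel_measurable (PiM I (\<lambda>_. borel) \<Otimes>\<^sub>M borel)"
proof -
  have "(\<lambda>z. \<phi> (fst z i) (snd z)) \<in> borel_measurable (PiM I (\<lambda>_. borel) \<Otimes>\<^sub>M borel)" if [measurable]: "i \<in> I" for i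
  proof -
    have "(\<lambda>z. (fst z i, snd z)) \<in> PiM I (\<lambda>_. borel) \<Otimes>\<^sub>M borel \<rightarrow>\<^sub>M borel \<Otimes>\<^sub>M borel" by measurable
    from measurable_compose[OF this phi_measurable] show ?thesis by simp
  qed
  then show ?thesis
    unfolding split_beta' by (intro borel_measurable_prod borel_measurable_diff) auto
qed

lemma measurable_nn_integral_avoid:
  assumes N: "sigma_finite_measure N" "sets N = sets borel" and F: "F \<in> borel_measurable borel"
  shows "(\<lambda>V. if finite V then \<integral>\<^sup>+y. ennreal (F (avoid V y)) \<partial>N else 0) \<in> borel_measurable point_space"
proof (rule measurable_on_finite_sets)
  interpret sigma_finite_measure N by (rule N)
  fix m :: nat
  have "(\<lambda>(x, y). ennreal (F (\<Prod>i<m. 1 - \<phi> (x i) y))) \<in> borel_measurable (PiM {..<m} (\<lambda>_. borel) \<Otimes>\<^sub>M borel)"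
    using measurable_compose[OF measurable_avoid_tuple[of "{..<m}"] F] by (simp add: split_beta')
  then have "(\<lambda>(x, y). ennreal (F (\<Prod>i<m. 1 - \<phi> (x i) y))) \<in> borel_measurable (PiM {..<m} (\<lambda>_. borel) \<Otimes>\<^sub>M N)"
    by (simp add: N(2) cong: measurable_cong_sets)
  then show "(\<lambda>x. \<integral>\<^sup>+y. ennreal (F (\<Prod>i<m. 1 - \<phi> (x i) y)) \<partial>N) \<in> borel_measurable (PiM {..<m} (\<lambda>_. borel))"
    by (rule borel_measurable_nn_integral)
  show "(\<integral>\<^sup>+y. ennreal (F (avoid (x ` {..<m}) y)) \<partial>N) = (\<integral>\<^sup>+y. ennreal (F (\<Prod>i<m. 1 - \<phi> (x i) y)) \<partial>N)"
    if "inj_on x {..<m}" for x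
    using that by (simp add: avoid_def prod.reindex)
qed

lemma measurable_hit:
  assumes "sigma_finite_measure N" "sets N = sets borel"
  shows "(\<lambda>V. if finite V then hit N V else 0) \<in> borel_measurable point_space"
  using measurable_nn_integral_avoid[OF assms, of "\<lambda>r. 1 - r"] unfolding hit_def by simp

lemma measurable_damp:
  assumes "sigma_finite_measure N" "sets N = sets borel"
  shows "damp N c \<in> borel_measurable graph_space"
proof -
  note measurable_hit[OF assms, measurable] measurable_finite[measurable]
  have "(\<lambda>V. if finite V \<and> (if finite V then hit N V else 0) < \<infinity>
      then ennreal (exp (- c * enn2real (if finite V then hit N V else 0))) else 0)
      \<in> borel_measurable point_space" by measurable
  from measurable_compose[OF measurable_verts this]
  have "(\<lambda>\<mu>. if finite (verts \<mu>) \<and> (if finite (verts \<mu>) then hit N (verts \<mu>) else 0) < \<infinity>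
      then ennreal (exp (- c * enn2real (if finite (verts \<mu>) then hit N (verts \<mu>) else 0))) else 0)
      \<in> borel_measurable graph_space" .
  moreover have "damp N c = (\<lambda>\<mu>. if finite (verts \<mu>) \<and> (if finite (verts \<mu>) then hit N (verts \<mu>) else 0) < \<infinity>
      then ennreal (exp (- c * enn2real (if finite (verts \<mu>) then hit N (verts \<mu>) else 0))) else 0)"
    by (auto simp: damp_def fun_eq_iff)
  ultimately show ?thesis by simp
qed

end

section \<open>The cluster in a bounded window\<close>

locale rcm_window = connection_function \<phi> + window \<nu>
  for \<phi> :: "'a::polish_space \<Rightarrow> 'a \<Rightarrow> real" and \<nu> :: "'a measure" +
  fixes v :: 'a
begin

definition miss :: "'a set \<Rightarrow> ennreal" where
  "miss V = (\<integral>\<^sup>+y. ennreal (avoid V y) \<partial>\<nu>)"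

lemma measurable_avoid: "finite V \<Longrightarrow> avoid V \<in> borel_measurable \<nu>"
proof -
  assume "finite V"
  have "(\<lambda>y. \<phi> z y) \<in> borel_measurable borel" for z
    using measurable_compose[OF _ phi_measurable, of "\<lambda>y. (z, y)" borel] by simp
  then have "(\<lambda>y. \<Prod>z\<in>V. 1 - \<phi> z y) \<in> borel_measurable borel"
    by (intro borel_measurable_prod borel_measurable_diff) auto
  then show ?thesis by (simp add: avoid_def[abs_def] sets_nu cong: measurable_cong_sets)
qed

lemma miss_add_hit:
  assumes "finite V"
  shows "miss V + hit \<nu> V = ennreal mass"
proof -
  have "miss V + hit \<nu> V = (\<integral>\<^sup>+y. ennreal (avoid V y) + ennreal (1 - avoid V y) \<partial>\<nu>)"
    unfolding miss_def hit_def using measurable_avoid[OF assms]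
    by (intro nn_integral_add[symmetric]) auto
  also have "\<dots> = (\<integral>\<^sup>+y. 1 \<partial>\<nu>)"
    using avoid_range by (intro nn_integral_cong) (simp add: ennreal_plus[symmetric] del: ennreal_plus)
  finally show ?thesis by (simp add: space_nu emeasure_nu_eq)
qed

lemma hit_le_mass: "finite V \<Longrightarrow> hit \<nu> V \<le> ennreal mass"
  using miss_add_hit[of V] by (metis le_iff_add add.commute)

lemma hit_nu_less_top: "finite V \<Longrightarrow> hit \<nu> V < \<infinity>"
  by (rule le_less_trans[OF hit_le_mass]) simp_all

lemma miss_eq:
  assumes "finite V"
  shows "miss V = ennreal (mass - enn2real (hit \<nu> V))" "enn2real (hit \<nu> V) \<le> mass"
proof -
  have "hit \<nu> V \<le> ennreal mass" using miss_add_hit[OF assms] by (metis le_iff_add add.commute)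
  moreover from this have h: "hit \<nu> V = ennreal (enn2real (hit \<nu> V))" by (intro ennreal_enn2real[symmetric]) (rule le_less_trans[OF _ ennreal_less_top])
  ultimately show le: "enn2real (hit \<nu> V) \<le> mass" by (metis ennreal_le_iff measure_nonneg)
  have "miss V = ennreal mass - hit \<nu> V"
    using miss_add_hit[OF assms] h by (metis ennreal_add_diff_cancel_right ennreal_neq_top)
  then show "miss V = ennreal (mass - enn2real (hit \<nu> V))"
    using h by (metis ennreal_minus enn2real_nonneg)
qed

lemma measurable_hit_insert:
  "(\<lambda>T. if finite T then hit \<nu> (insert v T) else 0) \<in> borel_measurable point_space"
  "(\<lambda>T. if finite T then miss (insert v T) else 0) \<in> borel_measurable point_space"
proof -
  have *: "(\<lambda>T. if finite (insert v T) then \<integral>\<^sup>+y. ennreal (F (avoid (insert v T) y)) \<partial>\<nu> else 0)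
      \<in> borel_measurable point_space" if "F \<in> borel_measurable borel" for F
    using measurable_insert measurable_nn_integral_avoid[OF sigma_finite_nu sets_nu that]
    by (rule measurable_compose)
  show "(\<lambda>T. if finite T then hit \<nu> (insert v T) else 0) \<in> borel_measurable point_space"
    using *[of "\<lambda>r. 1 - r"] unfolding hit_def by simp
  show "(\<lambda>T. if finite T then miss (insert v T) else 0) \<in> borel_measurable point_space"
    using *[of "\<lambda>r. r"] unfolding miss_def by simp
qed

lemma AE_tuple_law_finite: "finite I \<Longrightarrow> AE T in tuple_law I. finite T"
  unfolding tuple_law_def using measurable_finite
  by (subst AE_distr_iff[OF measurable_image_PiM_nu]) (auto simp: pred_def)

text \<open>\<open>avoid (insert v (x ` I))\<close> as a product over indices. It agrees with a product over the set of
  points for distinct points only, but is evidently measurable in \<open>x\<close>.\<close>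

definition attach :: "nat set \<Rightarrow> (nat \<Rightarrow> 'a) \<Rightarrow> 'a \<Rightarrow> real" where
  "attach I x y = (1 - \<phi> v y) * (\<Prod>i\<in>I. 1 - \<phi> (x i) y)"

lemma attach_eq: "finite I \<Longrightarrow> inj_on x I \<Longrightarrow> v \<notin> x ` I \<Longrightarrow> attach I x y = avoid (insert v (x ` I)) y"
  by (simp add: attach_def avoid_def prod.reindex)

lemma attach_cong: "(\<And>i. i \<in> I \<Longrightarrow> x i = x' i) \<Longrightarrow> attach I x y = attach I x' y"
  by (simp add: attach_def)

lemma measurable_phi_compose:
  assumes "f \<in> M \<rightarrow>\<^sub>M borel" "g \<in> M \<rightarrow>\<^sub>M borel"
  shows "(\<lambda>x. \<phi> (f x) (g x)) \<in> borel_measurable M"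
  using measurable_compose[OF measurable_Pair[OF assms] phi_measurable] by simp

lemma measurable_attach:
  assumes "f \<in> M \<rightarrow>\<^sub>M borel" "\<And>i. i \<in> I \<Longrightarrow> (\<lambda>z. h z i) \<in> M \<rightarrow>\<^sub>M borel"
  shows "(\<lambda>z. attach I (h z) (f z)) \<in> borel_measurable M"
  unfolding attach_def using assms
  by (intro borel_measurable_times borel_measurable_prod borel_measurable_diff measurable_phi_compose) auto

lemma measurable_cluster_weight_tuple:
  assumes "g \<in> borel_measurable graph_space" "finite I" "I \<subseteq> K"
  shows "(\<lambda>x. cluster_weight g v (x ` I)) \<in> borel_measurable (PiM K (\<lambda>_. \<nu>))"
  using assms by (intro measurable_compose[OF measurable_image_PiM_nu] measurable_cluster_weight)

lemma measurable_index_integrand: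
  assumes "g \<in> borel_measurable graph_space" "finite I" "I \<subseteq> K" "J \<subseteq> K"
  shows "(\<lambda>x. cluster_weight g v (x ` I) * (\<Prod>i\<in>J. ennreal (attach I x (x i)))) \<in>
    borel_measurable (PiM K (\<lambda>_. \<nu>))"
proof (intro borel_measurable_times_ennreal borel_measurable_prod_ennreal)
  fix i assume i: "i \<in> J"
  have "(\<lambda>x. x j) \<in> PiM K (\<lambda>_. \<nu>) \<rightarrow>\<^sub>M borel" if "j \<in> K" for j
    unfolding measurable_PiM_nu using that by (rule measurable_component_singleton)
  then have "(\<lambda>x. attach I x (x i)) \<in> borel_measurable (PiM K (\<lambda>_. \<nu>))"
    using i assms(3,4) by (intro measurable_attach) auto
  then show "(\<lambda>x. ennreal (attach I x (x i))) \<in> borel_measurable (PiM K (\<lambda>_. \<nu>))" by simp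
qed (use assms measurable_cluster_weight_tuple in auto)

text \<open>The component consists of the points with index in \<open>I\<close>, and each of the \<open>m - card I\<close> remaining
  points is independently placed where it is not joined to it. Integrating out these points one by
  one produces the power of \<open>miss\<close>. Almost surely the points are distinct, so that products over
  indices and products over points agree.\<close>

lemma nn_integral_index_subset:
  assumes g: "g \<in> borel_measurable graph_space" and I: "I \<subseteq> {..<m}"
  shows "(\<integral>\<^sup>+x. cluster_weight g v (x ` I) * (\<Prod>i\<in>{..<m} - I. ennreal (attach I x (x i)))
      \<partial>PiM {..<m} (\<lambda>_. \<nu>)) =
    (\<integral>\<^sup>+T. cluster_weight g v T * miss (insert v T) ^ (m - card I) \<partial>tuple_law I)"
proof -
  have finI: "finite I" using I finite_subset by auto
  define J where "J = {..<m} - I"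
  have J: "finite J" "I \<union> J = {..<m}" "I \<inter> J = {}" "card J = m - card I"
    using I finI by (auto simp: J_def card_Diff_subset)
  let ?PI = "PiM I (\<lambda>_. \<nu>)" and ?PJ = "PiM J (\<lambda>_. \<nu>)" and ?PM = "PiM {..<m} (\<lambda>_. \<nu>)"
  let ?q = "cluster_weight g v"
  let ?f = "\<lambda>x. ?q (x ` I) * (\<Prod>i\<in>J. ennreal (attach I x (x i)))"
  have f: "?f \<in> borel_measurable (PiM (I \<union> J) (\<lambda>_. \<nu>))"
    using g finI by (intro measurable_index_integrand) auto
  have "(\<integral>\<^sup>+x. ?f x \<partial>?PM) = (\<integral>\<^sup>+x. \<integral>\<^sup>+y. ?f (merge I J (x, y)) \<partial>?PJ \<partial>?PI)"
    using product_nn_integral_fold[OF J(3) finI J(1) f] by (simp only: J(2))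
  also have "\<dots> = (\<integral>\<^sup>+x. ?q (x ` I) * (\<integral>\<^sup>+y. ennreal (attach I x y) \<partial>\<nu>) ^ card J \<partial>?PI)"
  proof (rule nn_integral_cong)
    fix x assume x: "x \<in> space ?PI"
    have im: "merge I J (x, y) ` I = x ` I" for y by (auto simp: merge_def image_iff)
    have re: "attach I (merge I J (x, y)) z = attach I x z" for y z
      by (rule attach_cong) (simp add: merge_def)
    have mj: "merge I J (x, y) i = y i" if "i \<in> J" for y i
      using that J(3) by (auto simp: merge_def)
    have "(\<lambda>y. attach I x y) \<in> borel_measurable \<nu>"
      by (intro measurable_attach) (simp_all add: sets_nu cong: measurable_cong_sets)
    then have ax: "(\<lambda>y. ennreal (attach I x y)) \<in> borel_measurable \<nu>" by simp
    have "(\<integral>\<^sup>+y. ?f (merge I J (x, y)) \<partial>?PJ) = (\<integral>\<^sup>+y. ?q (x ` I) * (\<Prod>i\<in>J. ennreal (attach I x (y i))) \<partial>?PJ)"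
      by (intro nn_integral_cong) (simp add: im re mj)
    also have "\<dots> = ?q (x ` I) * (\<integral>\<^sup>+y. (\<Prod>i\<in>J. ennreal (attach I x (y i))) \<partial>?PJ)"
      using ax by (intro nn_integral_cmult borel_measurable_prod_ennreal)
        (auto intro: measurable_compose[OF measurable_component_singleton])
    also have "(\<integral>\<^sup>+y. (\<Prod>i\<in>J. ennreal (attach I x (y i))) \<partial>?PJ) = (\<Prod>i\<in>J. \<integral>\<^sup>+y. ennreal (attach I x y) \<partial>\<nu>)"
      using J(1) ax by (rule product_nn_integral_prod)
    finally show "(\<integral>\<^sup>+y. ?f (merge I J (x, y)) \<partial>?PJ) = ?q (x ` I) * (\<integral>\<^sup>+y. ennreal (attach I x y) \<partial>\<nu>) ^ card J"
      by simp
  qed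
  also have "\<dots> = (\<integral>\<^sup>+x. ?q (x ` I) * (if finite (x ` I) then miss (insert v (x ` I)) else 0) ^ card J \<partial>?PI)"
  proof (rule nn_integral_cong_AE)
    show "AE x in ?PI. ?q (x ` I) * (\<integral>\<^sup>+y. ennreal (attach I x y) \<partial>\<nu>) ^ card J =
        ?q (x ` I) * (if finite (x ` I) then miss (insert v (x ` I)) else 0) ^ card J"
      using AE_tuple_distinct[OF finI, of v]
      by eventually_elim (use finI in \<open>simp add: miss_def attach_eq\<close>)
  qed
  also have "\<dots> = (\<integral>\<^sup>+T. ?q T * (if finite T then miss (insert v T) else 0) ^ card J \<partial>tuple_law I)"
    unfolding tuple_law_def
    using finI measurable_cluster_weight[OF g] measurable_hit_insert(2)
    by (subst nn_integral_distr[OF measurable_image_PiM_nu])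
      (auto intro!: borel_measurable_times_ennreal borel_measurable_power_ennreal)
  also have "\<dots> = (\<integral>\<^sup>+T. ?q T * miss (insert v T) ^ card J \<partial>tuple_law I)"
    using AE_tuple_law_finite[OF finI] by (intro nn_integral_cong_AE) (auto elim!: eventually_mono)
  finally show ?thesis by (simp add: J_def J(4)[unfolded J_def])
qed

lemma measurable_finite_law_component:
  assumes g: "g \<in> borel_measurable graph_space"
  shows "(\<lambda>S. \<integral>\<^sup>+\<mu>. g (component v \<mu>) * has_card n (component v \<mu>) \<partial>finite_law (insert v S))
    \<in> borel_measurable point_space"
proof -
  have "(\<lambda>\<mu>. g \<mu> * has_card n \<mu>) \<in> borel_measurable graph_space"
    using g measurable_has_card by (rule borel_measurable_times_ennreal)
  from measurable_compose[OF measurable_snd measurable_compose[OF measurable_component this]]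
  show ?thesis
    by (intro nn_integral_measurable_subprob_algebra2[where N=graph_space]
        measurable_compose[OF measurable_insert measurable_finite_law]) (simp add: split_beta')
qed

text \<open>All \<open>m choose k\<close> sets of indices contribute equally, since only the number of points matters in
  a tuple law.\<close>

lemma nn_integral_tuple_law_component:
  assumes g: "g \<in> borel_measurable graph_space"
  shows "(\<integral>\<^sup>+S. \<integral>\<^sup>+\<mu>. g (component v \<mu>) * has_card (Suc k) (component v \<mu>) \<partial>finite_law (insert v S)
      \<partial>tuple_law {..<m}) =
    of_nat (m choose k) * (\<integral>\<^sup>+T. cluster_weight g v T * miss (insert v T) ^ (m - k) \<partial>tuple_law {..<k})"
proof -
  let ?PM = "PiM {..<m} (\<lambda>_. \<nu>)"
  let ?K = "{I. I \<subseteq> {..<m} \<and> card I = k}"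
  let ?h = "\<lambda>S. \<integral>\<^sup>+\<mu>. g (component v \<mu>) * has_card (Suc k) (component v \<mu>) \<partial>finite_law (insert v S)"
  have "?h \<in> borel_measurable point_space" by (rule measurable_finite_law_component[OF g])
  then have "(\<integral>\<^sup>+S. ?h S \<partial>tuple_law {..<m}) = (\<integral>\<^sup>+x. ?h (x ` {..<m}) \<partial>?PM)"
    unfolding tuple_law_def by (subst nn_integral_distr[OF measurable_image_PiM_nu]) auto
  also have "\<dots> = (\<integral>\<^sup>+x. (\<Sum>I\<in>?K. cluster_weight g v (x ` I) *
      (\<Prod>i\<in>{..<m} - I. ennreal (attach I x (x i)))) \<partial>?PM)"
  proof (rule nn_integral_cong_AE)
    show "AE x in ?PM. ?h (x ` {..<m}) = (\<Sum>I\<in>?K. cluster_weight g v (x ` I) *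
      (\<Prod>i\<in>{..<m} - I. ennreal (attach I x (x i))))"
      using AE_tuple_distinct[OF finite_lessThan, of m v]
    proof (rule AE_mp, intro AE_I2 impI)
      fix x :: "nat \<Rightarrow> 'a" assume x: "inj_on x {..<m} \<and> v \<notin> x ` {..<m}"
      then have inj: "inj_on x {..<m}" by simp
      have im: "{T. T \<subseteq> x ` {..<m} \<and> card T = k} = (`) x ` ?K"
      proof (intro set_eqI iffI)
        fix T assume T: "T \<in> {T. T \<subseteq> x ` {..<m} \<and> card T = k}"
        then obtain I where I: "I \<subseteq> {..<m}" "T = x ` I" by (auto simp: subset_image_iff)
        moreover have "card I = k" using T I inj by (auto simp: card_image inj_on_subset)
        ultimately show "T \<in> (`) x ` ?K" by auto
      qed (use inj in \<open>auto simp: card_image inj_on_subset\<close>)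
      have inj': "inj_on ((`) x) ?K"
        by (rule inj_on_subset[OF inj_on_image_Pow[OF inj]]) auto
      have "?h (x ` {..<m}) = (\<Sum>T\<in>{T. T \<subseteq> x ` {..<m} \<and> card T = k}.
          cluster_weight g v T * ennreal (\<Prod>y\<in>x ` {..<m} - T. avoid (insert v T) y))"
        unfolding has_card_def using x g by (intro nn_integral_component_card) auto
      also have "\<dots> = (\<Sum>I\<in>?K. cluster_weight g v (x ` I) *
          ennreal (\<Prod>y\<in>x ` {..<m} - x ` I. avoid (insert v (x ` I)) y))"
        unfolding im by (simp add: sum.reindex[OF inj'])
      also have "\<dots> = (\<Sum>I\<in>?K. cluster_weight g v (x ` I) *
          (\<Prod>i\<in>{..<m} - I. ennreal (attach I x (x i))))"
      proof (rule sum.cong)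
        fix I assume I: "I \<in> ?K"
        have at: "attach I x y = avoid (insert v (x ` I)) y" for y
          using I x by (intro attach_eq) (auto intro: finite_subset inj_on_subset)
        have "x ` {..<m} - x ` I = x ` ({..<m} - I)"
          using inj I by (auto simp: inj_on_def)
        moreover have "inj_on x ({..<m} - I)" using inj by (rule inj_on_subset) auto
        ultimately show "cluster_weight g v (x ` I) * ennreal (\<Prod>y\<in>x ` {..<m} - x ` I. avoid (insert v (x ` I)) y) =
          cluster_weight g v (x ` I) * (\<Prod>i\<in>{..<m} - I. ennreal (attach I x (x i)))"
          using avoid_range at by (simp add: prod.reindex prod_ennreal)
      qed simp
      finally show "?h (x ` {..<m}) = (\<Sum>I\<in>?K. cluster_weight g v (x ` I) *
        (\<Prod>i\<in>{..<m} - I. ennreal (attach I x (x i))))" .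
    qed
  qed
  also have "\<dots> = (\<Sum>I\<in>?K. \<integral>\<^sup>+x. cluster_weight g v (x ` I) *
      (\<Prod>i\<in>{..<m} - I. ennreal (attach I x (x i))) \<partial>?PM)"
    using g by (intro nn_integral_sum measurable_index_integrand) (auto intro: finite_subset)
  also have "\<dots> = (\<Sum>I\<in>?K. \<integral>\<^sup>+T. cluster_weight g v T * miss (insert v T) ^ (m - k) \<partial>tuple_law {..<k})"
  proof (rule sum.cong)
    fix I assume I: "I \<in> ?K"
    then have "finite I" using finite_subset by auto
    then have "tuple_law I = tuple_law {..<k}" using I by (intro tuple_law_eq) auto
    then show "(\<integral>\<^sup>+x. cluster_weight g v (x ` I) *
      (\<Prod>i\<in>{..<m} - I. ennreal (attach I x (x i))) \<partial>?PM) =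
      (\<integral>\<^sup>+T. cluster_weight g v T * miss (insert v T) ^ (m - k) \<partial>tuple_law {..<k})"
      using nn_integral_index_subset[OF g, of I m] I by simp
  qed simp
  also have "\<dots> = of_nat (m choose k) *
      (\<integral>\<^sup>+T. cluster_weight g v T * miss (insert v T) ^ (m - k) \<partial>tuple_law {..<k})"
    using n_subsets[of "{..<m}" k] by simp
  finally show ?thesis .
qed

end

lemma sums_exp_choose:
  fixes t r L :: real
  shows "(\<lambda>m. exp (- t * L) * t ^ m / fact m * real (m choose k) * r ^ (m - k)) sums
    (t ^ k / fact k * exp (- t * (L - r)))"
proof -
  have "(\<lambda>j. t ^ k / fact k * exp (- t * L) * ((t * r) ^ j /\<^sub>R fact j)) sums
      (t ^ k / fact k * exp (- t * L) * exp (t * r))"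
    by (intro sums_mult exp_converges)
  moreover have "t ^ k / fact k * exp (- t * L) * ((t * r) ^ j /\<^sub>R fact j) =
      exp (- t * L) * t ^ (j + k) / fact (j + k) * real (j + k choose k) * r ^ (j + k - k)" for j
  proof -
    have "real (j + k choose k) = fact (j + k) / (fact k * fact j)"
      using binomial_fact[of k "j + k", where ?'a=real] by simp
    then show ?thesis by (simp add: power_add power_mult_distrib divide_inverse)
  qed
  moreover have "exp (- t * L) * exp (t * r) = exp (- t * (L - r))"
    by (simp add: exp_add[symmetric] algebra_simps)
  ultimately have "(\<lambda>j. exp (- t * L) * t ^ (j + k) / fact (j + k) * real (j + k choose k) * r ^ (j + k - k)) sums
      (t ^ k / fact k * exp (- t * (L - r)))"
    by (simp add: mult.assoc)
  then show ?thesis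
    by (subst (asm) sums_zero_iff_shift) auto
qed

context rcm_window
begin

text \<open>The cluster formula: the \<open>k\<close> further vertices of the cluster contribute \<open>t ^ k / fact k\<close>, and
  the exponential is the probability that no other point of the process is joined to it. Summing
  over the number \<open>m\<close> of points is the series \<open>sums_exp_choose\<close>.\<close>

lemma nn_integral_poisson_law_component:
  assumes t: "0 \<le> t" and g: "g \<in> borel_measurable graph_space"
  shows "(\<integral>\<^sup>+S. \<integral>\<^sup>+\<mu>. g (component v \<mu>) * has_card (Suc k) (component v \<mu>) \<partial>finite_law (insert v S)
      \<partial>poisson_law t) =
    ennreal (t ^ k / fact k) *
      (\<integral>\<^sup>+T. cluster_weight g v T * ennreal (exp (- t * enn2real (hit \<nu> (insert v T)))) \<partial>tuple_law {..<k})"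
proof -
  let ?c = "\<lambda>m. exp (- t * mass) * t ^ m / fact m"
  let ?q = "cluster_weight g v"
  let ?T = "tuple_law {..<k}"
  let ?miss = "\<lambda>T. if finite T then miss (insert v T) else 0"
  have c: "0 \<le> ?c m" for m using t by simp
  have q: "?q \<in> borel_measurable ?T"
    using measurable_cluster_weight[OF g] by (simp add: sets_tuple_law cong: measurable_cong_sets)
  have m: "?miss \<in> borel_measurable ?T"
    using measurable_hit_insert(2) by (simp add: sets_tuple_law cong: measurable_cong_sets)
  have fin: "AE T in ?T. finite T" by (rule AE_tuple_law_finite) simp
  have "(\<integral>\<^sup>+S. \<integral>\<^sup>+\<mu>. g (component v \<mu>) * has_card (Suc k) (component v \<mu>) \<partial>finite_law (insert v S)
      \<partial>poisson_law t) =
    (\<Sum>m. ennreal (?c m) * (of_nat (m choose k) * (\<integral>\<^sup>+T. ?q T * miss (insert v T) ^ (m - k) \<partial>?T)))"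
    using t g by (subst nn_integral_poisson_law)
      (auto simp: measurable_finite_law_component nn_integral_tuple_law_component)
  also have "\<dots> = (\<Sum>m. \<integral>\<^sup>+T. ennreal (?c m * real (m choose k)) * (?q T * ?miss T ^ (m - k)) \<partial>?T)"
  proof (rule suminf_cong)
    fix m
    have "(\<integral>\<^sup>+T. ?q T * miss (insert v T) ^ (m - k) \<partial>?T) = (\<integral>\<^sup>+T. ?q T * ?miss T ^ (m - k) \<partial>?T)"
      using fin by (intro nn_integral_cong_AE) (auto elim!: eventually_mono)
    moreover have "(\<integral>\<^sup>+T. ennreal (?c m * real (m choose k)) * (?q T * ?miss T ^ (m - k)) \<partial>?T) =
        ennreal (?c m * real (m choose k)) * (\<integral>\<^sup>+T. ?q T * ?miss T ^ (m - k) \<partial>?T)"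
      using q m by (intro nn_integral_cmult borel_measurable_times_ennreal borel_measurable_power_ennreal)
    moreover have "ennreal (?c m * real (m choose k)) = ennreal (?c m) * of_nat (m choose k)"
      unfolding ennreal_of_nat_eq_real_of_nat by (rule ennreal_mult[OF c]) simp
    ultimately show "ennreal (?c m) * (of_nat (m choose k) * (\<integral>\<^sup>+T. ?q T * miss (insert v T) ^ (m - k) \<partial>?T)) =
        (\<integral>\<^sup>+T. ennreal (?c m * real (m choose k)) * (?q T * ?miss T ^ (m - k)) \<partial>?T)"
      by (simp add: mult.assoc)
  qed
  also have "\<dots> = (\<integral>\<^sup>+T. (\<Sum>m. ennreal (?c m * real (m choose k)) * (?q T * ?miss T ^ (m - k))) \<partial>?T)"
    using q m by (intro nn_integral_suminf[symmetric] borel_measurable_times_ennreal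
        borel_measurable_power_ennreal) auto
  also have "\<dots> = (\<integral>\<^sup>+T. ennreal (t ^ k / fact k) *
      (?q T * (if finite T then ennreal (exp (- t * enn2real (hit \<nu> (insert v T)))) else 0)) \<partial>?T)"
  proof (rule nn_integral_cong_AE)
    have eq: "(\<Sum>m. ennreal (?c m * real (m choose k)) * (?q T * ?miss T ^ (m - k))) =
      ennreal (t ^ k / fact k) * (?q T * ennreal (exp (- t * enn2real (hit \<nu> (insert v T)))))"
      if T: "finite T" for T
    proof -
      define h where "h = enn2real (hit \<nu> (insert v T))"
      have h: "miss (insert v T) = ennreal (mass - h)" "h \<le> mass"
        using miss_eq[of "insert v T"] T by (auto simp: h_def)
      have "(\<Sum>m. ennreal (?c m * real (m choose k)) * (?q T * ?miss T ^ (m - k))) =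
          (\<Sum>m. ?q T * ennreal (?c m * real (m choose k) * (mass - h) ^ (m - k)))"
      proof (rule suminf_cong)
        fix m
        have "ennreal (?c m * real (m choose k) * (mass - h) ^ (m - k)) =
            ennreal (?c m * real (m choose k)) * ennreal (mass - h) ^ (m - k)"
          using t h by (subst ennreal_mult) (auto simp: ennreal_power)
        then show "ennreal (?c m * real (m choose k)) * (?q T * ?miss T ^ (m - k)) =
            ?q T * ennreal (?c m * real (m choose k) * (mass - h) ^ (m - k))"
          using T h by (simp add: ac_simps)
      qed
      also have "\<dots> = ?q T * (\<Sum>m. ennreal (?c m * real (m choose k) * (mass - h) ^ (m - k)))"
        by (rule ennreal_suminf_cmult)
      also have "(\<Sum>m. ennreal (?c m * real (m choose k) * (mass - h) ^ (m - k))) =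
          ennreal (t ^ k / fact k * exp (- t * (mass - (mass - h))))"
        using t h sums_exp_choose[of t mass k "mass - h"]
        by (subst suminf_ennreal2) (auto simp: sums_iff intro!: mult_nonneg_nonneg)
      also have "\<dots> = ennreal (t ^ k / fact k) * ennreal (exp (- t * h))"
        using t by (simp add: ennreal_mult[symmetric])
      finally show ?thesis by (simp add: h_def ac_simps)
    qed
    show "AE T in ?T. (\<Sum>m. ennreal (?c m * real (m choose k)) * (?q T * ?miss T ^ (m - k))) =
      ennreal (t ^ k / fact k) * (?q T * (if finite T then ennreal (exp (- t * enn2real (hit \<nu> (insert v T)))) else 0))"
      using fin
    proof (rule eventually_mono)
      fix T :: "'a set" assume T: "finite T"
      then show "(\<Sum>m. ennreal (?c m * real (m choose k)) * (?q T * ?miss T ^ (m - k))) = ennreal (t ^ k / fact k) *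
          (?q T * (if finite T then ennreal (exp (- t * enn2real (hit \<nu> (insert v T)))) else 0))"
        using eq[OF T] by (simp only: if_True)
    qed
  qed
  also have "\<dots> = ennreal (t ^ k / fact k) *
      (\<integral>\<^sup>+T. ?q T * (if finite T then ennreal (exp (- t * enn2real (hit \<nu> (insert v T)))) else 0) \<partial>?T)"
  proof (intro nn_integral_cmult borel_measurable_times_ennreal q)
    have eq: "(\<lambda>T. if finite T then ennreal (exp (- t * enn2real (hit \<nu> (insert v T)))) else 0) =
        (\<lambda>T. ennreal (exp (- t * enn2real (if finite T then hit \<nu> (insert v T) else 0))) * (if finite T then 1 else 0))"
      by auto
    note measurable_finite[measurable]
    note measurable_hit_insert(1)[measurable]
    have "(\<lambda>T. if finite T then ennreal (exp (- t * enn2real (hit \<nu> (insert v T)))) else 0) \<in> borel_measurable point_space"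
      unfolding eq by measurable
    then show "(\<lambda>T. if finite T then ennreal (exp (- t * enn2real (hit \<nu> (insert v T)))) else 0) \<in> borel_measurable ?T"
      by (simp add: sets_tuple_law cong: measurable_cong_sets)
  qed
  also have "(\<integral>\<^sup>+T. ?q T * (if finite T then ennreal (exp (- t * enn2real (hit \<nu> (insert v T)))) else 0) \<partial>?T) =
      (\<integral>\<^sup>+T. ?q T * ennreal (exp (- t * enn2real (hit \<nu> (insert v T)))) \<partial>?T)"
    using fin by (intro nn_integral_cong_AE) (auto elim!: eventually_mono)
  finally show ?thesis .
qed

text \<open>Under the connectedness condition the vertex set of the graph is \<open>insert v T\<close>, so the damping
  factor is constant and may be taken out of the integral.\<close>

lemma cluster_weight_damp:
  assumes "finite T" and g: "g \<in> borel_measurable graph_space"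
  shows "cluster_weight (\<lambda>\<mu>. g \<mu> * damp \<nu> c \<mu>) v T =
    cluster_weight g v T * ennreal (exp (- c * enn2real (hit \<nu> (insert v T))))"
proof -
  have gi: "(\<lambda>\<mu>. g \<mu> * indicator (connected_from v) \<mu>) \<in> borel_measurable graph_space"
    using g borel_measurable_indicator_pred[OF measurable_connected_from[of v]]
    by (intro borel_measurable_times_ennreal) auto
  have "AE \<mu> in graph_law \<phi> (insert v T). verts \<mu> = insert v T"
    using assms(1) by (intro AE_graph_law_verts) auto
  then have "cluster_weight (\<lambda>\<mu>. g \<mu> * damp \<nu> c \<mu>) v T =
      (\<integral>\<^sup>+\<mu>. g \<mu> * indicator (connected_from v) \<mu> * ennreal (exp (- c * enn2real (hit \<nu> (insert v T))))
        \<partial>graph_law \<phi> (insert v T))"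
    using assms(1) unfolding cluster_weight_def finite_law_def
    using hit_nu_less_top[of "insert v T"]
    by (auto intro!: nn_integral_cong_AE elim!: eventually_mono simp: damp_def ac_simps)
  also have "\<dots> = cluster_weight g v T * ennreal (exp (- c * enn2real (hit \<nu> (insert v T))))"
    using assms(1) gi unfolding cluster_weight_def finite_law_def
    by (subst nn_integral_multc) (auto simp: sets_graph_law cong: measurable_cong_sets)
  finally show ?thesis .
qed

text \<open>In the cluster formula the intensity enters only through \<open>t ^ k\<close> and through the exponential of
  \<open>- t * hit \<nu> V\<close>, where \<open>V\<close> is the vertex set of the cluster. The quotient of these factors for two
  intensities is a function of the cluster, hence can be moved into the integrand.\<close>

lemma poisson_law_change_intensity:
  assumes st: "0 < s" "0 \<le> t" and g: "g \<in> borel_measurable graph_space"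
  shows "(\<integral>\<^sup>+S. \<integral>\<^sup>+\<mu>. g (component v \<mu>) * has_card (Suc k) (component v \<mu>) \<partial>finite_law (insert v S)
      \<partial>poisson_law t) =
    ennreal ((t / s) ^ k) *
    (\<integral>\<^sup>+S. \<integral>\<^sup>+\<mu>. g (component v \<mu>) * damp \<nu> (t - s) (component v \<mu>) * has_card (Suc k) (component v \<mu>)
      \<partial>finite_law (insert v S) \<partial>poisson_law s)"
proof -
  let ?T = "tuple_law {..<k}"
  have "(\<integral>\<^sup>+S. \<integral>\<^sup>+\<mu>. g (component v \<mu>) * damp \<nu> (t - s) (component v \<mu>) * has_card (Suc k) (component v \<mu>)
      \<partial>finite_law (insert v S) \<partial>poisson_law s) =
    ennreal (s ^ k / fact k) * (\<integral>\<^sup>+T. cluster_weight (\<lambda>\<mu>. g \<mu> * damp \<nu> (t - s) \<mu>) v T *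
        ennreal (exp (- s * enn2real (hit \<nu> (insert v T)))) \<partial>?T)"
    using st g measurable_damp[OF sigma_finite_nu sets_nu]
    by (intro nn_integral_poisson_law_component borel_measurable_times_ennreal) auto
  also have "(\<integral>\<^sup>+T. cluster_weight (\<lambda>\<mu>. g \<mu> * damp \<nu> (t - s) \<mu>) v T *
        ennreal (exp (- s * enn2real (hit \<nu> (insert v T)))) \<partial>?T) =
      (\<integral>\<^sup>+T. cluster_weight g v T * ennreal (exp (- t * enn2real (hit \<nu> (insert v T)))) \<partial>?T)"
  proof (rule nn_integral_cong_AE)
    have "ennreal (exp (- (t - s) * h)) * ennreal (exp (- s * h)) = ennreal (exp (- t * h))" for h
      by (simp add: ennreal_mult[symmetric] exp_add[symmetric] algebra_simps)
    then show "AE T in ?T. cluster_weight (\<lambda>\<mu>. g \<mu> * damp \<nu> (t - s) \<mu>) v T *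
        ennreal (exp (- s * enn2real (hit \<nu> (insert v T)))) =
        cluster_weight g v T * ennreal (exp (- t * enn2real (hit \<nu> (insert v T))))"
      using AE_tuple_law_finite[of "{..<k}"] g
      by (auto elim!: eventually_mono simp: cluster_weight_damp mult.assoc)
  qed
  finally show ?thesis
    using st g
    by (simp add: nn_integral_poisson_law_component mult.assoc[symmetric] ennreal_mult[symmetric] power_divide)
qed

end

section \<open>Change of intensity\<close>

lemma window_density:
  assumes lam: "sets lam = sets borel" and diffuse: "\<And>x. emeasure lam {x} = 0"
    and W: "W \<in> sets borel" "emeasure lam W < \<infinity>"
  shows "window (density lam (indicator W) :: 'a::polish_space measure)"
proof -
  let ?\<nu> = "density lam (indicator W)"
  have em: "emeasure ?\<nu> B = emeasure lam (W \<inter> B)" if "B \<in> sets borel" for B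
    using that lam W by (intro emeasure_restricted) auto
  have sp: "space lam = UNIV" using sets_eq_imp_space_eq[OF lam] by simp
  have fin: "emeasure ?\<nu> UNIV < \<infinity>" using em[of UNIV] W by simp
  then have "finite_measure ?\<nu>" by (intro finite_measureI) (auto simp: sp)
  then have "sigma_finite_measure ?\<nu>" by (simp add: finite_measure_def)
  moreover have "emeasure ?\<nu> {x} = 0" for x
  proof -
    have "emeasure ?\<nu> {x} \<le> emeasure lam {x}"
      using em[of "{x}"] emeasure_mono[of "W \<inter> {x}" "{x}" lam] lam by simp
    then show ?thesis unfolding diffuse by simp
  qed
  ultimately show ?thesis
    using fin lam by (intro window.intro product_sigma_finite.intro window_axioms.intro) auto
qed

text \<open>Both laws are determined by their void probabilities, and these are exponentials.\<close>

lemma distr_poisson_process_window: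
  fixes lam :: "'a::polish_space measure"
  assumes pp: "poisson_process M (scale_measure (ennreal t) lam) \<eta>" and t: "0 \<le> t"
    and lam: "sets lam = sets borel" and win: "window (density lam (indicator W))"
    and W: "W \<in> sets borel" "emeasure lam W < \<infinity>"
  shows "distr M point_space (\<lambda>\<omega>. \<eta> \<omega> \<inter> W) = window.poisson_law (density lam (indicator W)) t"
proof -
  let ?\<nu> = "density lam (indicator W)"
  interpret window ?\<nu> by (rule win)
  interpret prob_space M using pp by (simp add: poisson_process_def)
  have eta: "\<eta> \<in> M \<rightarrow>\<^sub>M point_space" using pp by (simp add: poisson_process_def)
  then have etaW: "(\<lambda>\<omega>. \<eta> \<omega> \<inter> W) \<in> M \<rightarrow>\<^sub>M point_space"
    using measurable_Int_set[OF W(1)] by (rule measurable_compose)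
  show ?thesis
  proof (rule measure_eqI_void)
    show "sets (poisson_law t) = sets point_space" using t by (rule sets_poisson_law)
    show "emeasure (distr M point_space (\<lambda>\<omega>. \<eta> \<omega> \<inter> W)) (space (distr M point_space (\<lambda>\<omega>. \<eta> \<omega> \<inter> W))) \<noteq> \<infinity>"
      unfolding prob_space.emeasure_space_1[OF prob_space_distr[OF etaW]] by simp
    fix B :: "'a set" assume B: "B \<in> sets borel"
    have WB: "W \<inter> B \<in> sets borel" using W B by auto
    have "emeasure lam (W \<inter> B) \<le> emeasure lam W" using lam W by (intro emeasure_mono) auto
    then have fin: "emeasure lam (W \<inter> B) < \<infinity>" using W(2) by (rule le_less_trans)
    have nuB: "emeasure ?\<nu> B = emeasure lam (W \<inter> B)"
      using B lam W by (intro emeasure_restricted) auto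
    have m: "measure (scale_measure (ennreal t) lam) (W \<inter> B) = t * measure ?\<nu> B"
      using t by (simp add: measure_def nuB enn2real_mult)
    have "emeasure (scale_measure (ennreal t) lam) (W \<inter> B) < \<infinity>"
      using fin by (simp add: ennreal_mult_less_top)
    with pp WB have "measure M {\<omega> \<in> space M. num (\<eta> \<omega> \<inter> (W \<inter> B)) = of_nat 0} =
        (t * measure ?\<nu> B) ^ 0 / fact 0 * exp (- (t * measure ?\<nu> B))"
      unfolding poisson_process_def m[symmetric] by blast
    then have "emeasure M {\<omega> \<in> space M. \<eta> \<omega> \<inter> W \<inter> B = {}} = ennreal (exp (- t * measure ?\<nu> B))"
      by (simp add: num_eq_0_iff Int_assoc emeasure_eq_measure)
    moreover have "{S. loc_finite S \<and> S \<inter> B = {}} \<in> sets point_space"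
      using measurable_void[OF B] by (simp add: pred_def space_point_space)
    moreover have "(\<lambda>\<omega>. \<eta> \<omega> \<inter> W) -` {S. loc_finite S \<and> S \<inter> B = {}} \<inter> space M =
        {\<omega> \<in> space M. \<eta> \<omega> \<inter> W \<inter> B = {}}"
      using measurable_space[OF etaW] by (auto simp: space_point_space)
    ultimately show "emeasure (distr M point_space (\<lambda>\<omega>. \<eta> \<omega> \<inter> W)) {S. loc_finite S \<and> S \<inter> B = {}} =
        emeasure (poisson_law t) {S. loc_finite S \<and> S \<inter> B = {}}"
      using t B by (simp add: emeasure_distr[OF etaW] emeasure_poisson_law_void)
  qed simp
qed

locale rcm_setting = connection_function \<phi>
  for \<phi> :: "'a::polish_space \<Rightarrow> 'a \<Rightarrow> real" +
  fixes lam :: "'a measure" and v :: 'a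
  assumes lam_sets: "sets lam = sets borel"
    and lam_loc_finite: "\<And>B. B \<in> sets borel \<Longrightarrow> bounded B \<Longrightarrow> emeasure lam B < \<infinity>"
    and lam_diffuse: "\<And>x. emeasure lam {x} = 0"
begin

definition W :: "nat \<Rightarrow> 'a set" where "W j = cball v (real j)"

lemma W: "W j \<in> sets borel" "bounded (W j)" "v \<in> W j" "emeasure lam (W j) < \<infinity>"
  using lam_loc_finite[of "cball v (real j)"] by (auto simp: W_def)

lemma incseq_W: "incseq W" and UN_W: "(\<Union>j. W j) = UNIV"
  using incseq_cball_nat[of v] UN_cball_nat[of v] by (simp_all add: W_def[abs_def])

abbreviation nu :: "nat \<Rightarrow> 'a measure" where "nu j \<equiv> density lam (indicator (W j))"

lemma window_nu: "window (nu j)"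
  using lam_sets lam_diffuse W by (intro window_density) auto

lemma rcm_window: "rcm_window \<phi> (nu j)"
  using connection_function_axioms window_nu by (rule rcm_window.intro)

text \<open>Given the process, the restricted graph is the random connection model on the finitely many points
  in the window together with \<open>v\<close>.\<close>

lemma nn_integral_restr_rcm:
  assumes pp: "poisson_process M (scale_measure (ennreal t) lam) \<eta>" and t: "0 \<le> t"
    and rcm: "rcm M \<phi> \<eta> v \<xi>" and g: "g \<in> borel_measurable graph_space"
  shows "(\<integral>\<^sup>+\<omega>. g (restr (W j) (\<xi> \<omega>)) \<partial>M) =
    (\<integral>\<^sup>+S. \<integral>\<^sup>+\<mu>. g \<mu> \<partial>finite_law (insert v S) \<partial>window.poisson_law (nu j) t)"
proof -
  interpret window "nu j" by (rule window_nu)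
  interpret prob_space M using pp by (simp add: poisson_process_def)
  have eta: "\<eta> \<in> M \<rightarrow>\<^sub>M point_space" using pp by (simp add: poisson_process_def)
  have xi: "\<xi> \<in> M \<rightarrow>\<^sub>M graph_space" using rcm by (simp add: rcm_def)
  have etaW: "(\<lambda>\<omega>. \<eta> \<omega> \<inter> W j) \<in> M \<rightarrow>\<^sub>M point_space"
    using eta measurable_Int_set[OF W(1)] by (rule measurable_compose)
  have xiW: "(\<lambda>\<omega>. restr (W j) (\<xi> \<omega>)) \<in> M \<rightarrow>\<^sub>M graph_space"
    using xi measurable_restr[OF W(1)] by (rule measurable_compose)
  have K: "(\<lambda>S. finite_law (insert v S)) \<in> point_space \<rightarrow>\<^sub>M subprob_algebra graph_space"
    using measurable_insert measurable_finite_law by (rule measurable_compose)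
  have K': "(\<lambda>S. finite_law (insert v S)) \<in> poisson_law t \<rightarrow>\<^sub>M subprob_algebra graph_space"
    using K sets_poisson_law[OF t] by (simp cong: measurable_cong_sets)
  have ne: "space (poisson_law t) \<noteq> {}"
    using sets_eq_imp_space_eq[OF sets_poisson_law[OF t]] by (auto simp: space_point_space loc_finite_def)
  have law: "distr M point_space (\<lambda>\<omega>. \<eta> \<omega> \<inter> W j) = poisson_law t"
    using pp t lam_sets window_nu W by (intro distr_poisson_process_window) auto
  have "distr M graph_space (\<lambda>\<omega>. restr (W j) (\<xi> \<omega>)) = poisson_law t \<bind> (\<lambda>S. finite_law (insert v S))"
  proof (rule measure_eqI)
    show "sets (distr M graph_space (\<lambda>\<omega>. restr (W j) (\<xi> \<omega>))) = sets (poisson_law t \<bind> (\<lambda>S. finite_law (insert v S)))"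
      using K' ne by (simp add: sets_bind_measurable)
    fix A assume "A \<in> sets (distr M graph_space (\<lambda>\<omega>. restr (W j) (\<xi> \<omega>)))"
    then have A: "A \<in> sets graph_space" by simp
    let ?A = "restr (W j) -` A \<inter> space graph_space"
    have A': "?A \<in> sets graph_space" using measurable_restr[OF W(1)] A by (rule measurable_sets)
    have "emeasure (distr M graph_space (\<lambda>\<omega>. restr (W j) (\<xi> \<omega>))) A =
        emeasure M {\<omega> \<in> space M. \<eta> \<omega> \<in> space point_space \<and> \<xi> \<omega> \<in> ?A}"
      using measurable_space[OF eta] measurable_space[OF xi] A
      by (subst emeasure_distr[OF xiW]) (auto intro!: arg_cong[where f="emeasure M"])
    also have "\<dots> = (\<integral>\<^sup>+\<omega>. emeasure (graph_law \<phi> (insert v (\<eta> \<omega>))) ?A * indicator (space point_space) (\<eta> \<omega>) \<partial>M)"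
      using rcm A' unfolding rcm_def by blast
    also have "\<dots> = (\<integral>\<^sup>+\<omega>. emeasure (finite_law (insert v (\<eta> \<omega> \<inter> W j))) A \<partial>M)"
    proof (rule nn_integral_cong)
      fix \<omega> assume "\<omega> \<in> space M"
      then have sp: "\<eta> \<omega> \<in> space point_space" using eta by (rule measurable_space[rotated])
      then have lf: "loc_finite (insert v (\<eta> \<omega>))" by (simp add: space_point_space loc_finite_insert)
      have "insert v (\<eta> \<omega>) \<inter> W j = insert v (\<eta> \<omega> \<inter> W j)" using W(3) by auto
      moreover have "finite (\<eta> \<omega> \<inter> W j)" using sp W(2) by (simp add: space_point_space loc_finite_def)
      ultimately show "emeasure (graph_law \<phi> (insert v (\<eta> \<omega>))) ?A * indicator (space point_space) (\<eta> \<omega>) =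
          emeasure (finite_law (insert v (\<eta> \<omega> \<inter> W j))) A"
        using graph_law_restr[OF lf W(1,2) A] sp by (simp add: finite_law_def)
    qed
    also have "\<dots> = (\<integral>\<^sup>+S. emeasure (finite_law (insert v S)) A \<partial>distr M point_space (\<lambda>\<omega>. \<eta> \<omega> \<inter> W j))"
      using measurable_emeasure_kernel[OF K A] by (subst nn_integral_distr[OF etaW]) auto
    also have "\<dots> = emeasure (poisson_law t \<bind> (\<lambda>S. finite_law (insert v S))) A"
      using ne K' A by (simp add: law emeasure_bind)
    finally show "emeasure (distr M graph_space (\<lambda>\<omega>. restr (W j) (\<xi> \<omega>))) A =
        emeasure (poisson_law t \<bind> (\<lambda>S. finite_law (insert v S))) A" .
  qed
  then have "(\<integral>\<^sup>+\<mu>. g \<mu> \<partial>distr M graph_space (\<lambda>\<omega>. restr (W j) (\<xi> \<omega>))) =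
      (\<integral>\<^sup>+\<mu>. g \<mu> \<partial>(poisson_law t \<bind> (\<lambda>S. finite_law (insert v S))))" by simp
  then show ?thesis
    using g K' by (simp add: nn_integral_distr[OF xiW] nn_integral_bind)
qed

lemma AE_root_in_verts:
  assumes rcm: "rcm M \<phi> \<eta> v \<xi>" and eta: "\<eta> \<in> M \<rightarrow>\<^sub>M point_space"
  shows "AE \<omega> in M. v \<in> verts (\<xi> \<omega>)"
proof -
  let ?A = "{\<mu> \<in> space graph_space. verts \<mu> \<inter> {v} = {}}"
  have A: "?A \<in> sets graph_space"
    using measurable_compose[OF measurable_verts measurable_void[of "{v}"]] by (simp add: pred_def)
  have xi: "\<xi> \<in> M \<rightarrow>\<^sub>M graph_space" using rcm by (simp add: rcm_def)
  have zero: "emeasure (graph_law \<phi> (insert v (\<eta> \<omega>))) ?A = 0" if "\<omega> \<in> space M" for \<omega>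
  proof -
    have "loc_finite (insert v (\<eta> \<omega>))"
      using measurable_space[OF eta that] by (simp add: space_point_space loc_finite_insert)
    then show ?thesis
      unfolding graph_law_def using A
      by (subst emeasure_distr[OF measurable_mk_graph]) (auto simp: verts_mk_graph vimage_def)
  qed
  have "emeasure M {\<omega> \<in> space M. \<eta> \<omega> \<in> space point_space \<and> \<xi> \<omega> \<in> ?A} =
      (\<integral>\<^sup>+\<omega>. emeasure (graph_law \<phi> (insert v (\<eta> \<omega>))) ?A * indicator (space point_space) (\<eta> \<omega>) \<partial>M)"
    using rcm A unfolding rcm_def by blast
  also have "\<dots> = (\<integral>\<^sup>+\<omega>. 0 \<partial>M)"
    by (rule nn_integral_cong) (simp only: zero mult_zero_left)
  finally have "emeasure M {\<omega> \<in> space M. \<eta> \<omega> \<in> space point_space \<and> \<xi> \<omega> \<in> ?A} = 0" by simp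
  moreover have "{\<omega> \<in> space M. \<eta> \<omega> \<in> space point_space \<and> \<xi> \<omega> \<in> ?A} = {\<omega> \<in> space M. \<not> v \<in> verts (\<xi> \<omega>)}"
    using measurable_space[OF eta] measurable_space[OF xi] by auto
  moreover have "{\<omega> \<in> space M. \<xi> \<omega> \<in> ?A} \<in> sets M"
    using measurable_sets[OF xi A] by (simp add: vimage_def Int_def conj_commute)
  moreover have "{\<omega> \<in> space M. \<xi> \<omega> \<in> ?A} = {\<omega> \<in> space M. \<not> v \<in> verts (\<xi> \<omega>)}"
    using measurable_space[OF xi] by auto
  ultimately show ?thesis by (intro AE_I[where N="{\<omega> \<in> space M. \<not> v \<in> verts (\<xi> \<omega>)}"]) auto
qed

lemma measurable_avoid_borel: "finite V \<Longrightarrow> avoid V \<in> borel_measurable lam"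
proof -
  assume "finite V"
  then have "avoid V \<in> borel_measurable (nu 0)"
    by (rule rcm_window.measurable_avoid[OF rcm_window])
  then show ?thesis by simp
qed

lemma hit_eq:
  assumes "finite V"
  shows "hit (nu j) V = (\<integral>\<^sup>+y. ennreal (1 - avoid V y) * indicator (W j) y \<partial>lam)"
  unfolding hit_def
  using measurable_avoid_borel[OF assms] W(1)[of j] lam_sets
  by (subst nn_integral_density) (auto simp: ac_simps)

lemma hit_less_top: "finite V \<Longrightarrow> hit (nu j) V < \<infinity>"
proof -
  assume V: "finite V"
  have "hit (nu j) V \<le> (\<integral>\<^sup>+y. indicator (W j) y \<partial>lam)"
    unfolding hit_eq[OF V] using avoid_range
    by (intro nn_integral_mono) (auto simp: indicator_def)
  also have "\<dots> < \<infinity>" using W(1,4)[of j] lam_sets by simp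
  finally show ?thesis .
qed

lemma hit_tendsto:
  assumes "finite V"
  shows "(\<lambda>j. hit (nu j) V) \<longlonglongrightarrow> hit lam V"
proof -
  have inc: "incseq (\<lambda>j y. ennreal (1 - avoid V y) * indicator (W j) y)"
    using incseq_W by (auto simp: incseq_def le_fun_def indicator_def)
  have "(SUP j. ennreal (1 - avoid V y) * indicator (W j) y) = ennreal (1 - avoid V y)" for y
  proof (rule antisym)
    show "(SUP j. ennreal (1 - avoid V y) * indicator (W j) y) \<le> ennreal (1 - avoid V y)"
      by (intro SUP_least) (auto simp: indicator_def)
    obtain j where "y \<in> W j" using UN_W by blast
    then show "ennreal (1 - avoid V y) \<le> (SUP j. ennreal (1 - avoid V y) * indicator (W j) y)"
      by (intro SUP_upper2[of j]) auto
  qed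
  moreover have "(\<integral>\<^sup>+y. (SUP j. ennreal (1 - avoid V y) * indicator (W j) y) \<partial>lam) =
      (SUP j. \<integral>\<^sup>+y. ennreal (1 - avoid V y) * indicator (W j) y \<partial>lam)"
    using measurable_avoid_borel[OF assms] W(1) lam_sets
    by (intro nn_integral_monotone_convergence_SUP inc) auto
  ultimately have "hit lam V = (SUP j. hit (nu j) V)"
    by (simp add: hit_def[of lam] hit_eq[OF assms])
  moreover have "incseq (\<lambda>j. hit (nu j) V)"
    using inc unfolding hit_eq[OF assms] incseq_def le_fun_def by (intro allI impI nn_integral_mono) auto
  ultimately show ?thesis by (simp add: LIMSEQ_SUP)
qed

lemma sigma_finite_lam: "sigma_finite_measure lam"
proof
  have sp: "space lam = UNIV" using sets_eq_imp_space_eq[OF lam_sets] by simp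
  show "\<exists>A. countable A \<and> A \<subseteq> sets lam \<and> \<Union> A = space lam \<and> (\<forall>a\<in>A. emeasure lam a \<noteq> \<infinity>)"
    using W UN_W lam_sets sp by (intro exI[of _ "range W"]) (auto simp: less_top[symmetric])
qed

lemma damp_tendsto:
  assumes c: "0 < c" and fin: "finite (verts \<mu>)"
  shows "(\<lambda>j. damp (nu j) c \<mu>) \<longlonglongrightarrow> damp lam c \<mu>"
proof -
  let ?h = "\<lambda>j. hit (nu j) (verts \<mu>)"
  have d: "damp (nu j) c \<mu> = ennreal (exp (- c * enn2real (?h j)))" for j
    using fin hit_less_top[OF fin, of j] by (simp add: damp_def)
  show ?thesis
  proof (cases "hit lam (verts \<mu>) < \<infinity>")
    case True
    then have "(\<lambda>j. enn2real (?h j)) \<longlonglongrightarrow> enn2real (hit lam (verts \<mu>))"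
      using hit_tendsto[OF fin] by (intro tendsto_enn2real) (simp_all add: less_top)
    then show ?thesis
      using True fin unfolding d unfolding damp_def by (auto intro!: tendsto_ennrealI tendsto_exp tendsto_minus tendsto_mult tendsto_const)
  next
    case False
    then have "?h \<longlonglongrightarrow> \<infinity>" using hit_tendsto[OF fin] by (simp add: less_top[symmetric])
    moreover have "?h j = ennreal (enn2real (?h j))" for j
      using hit_less_top[OF fin, of j] by simp
    ultimately have "(\<lambda>j. ennreal (enn2real (?h j))) \<longlonglongrightarrow> \<infinity>" by simp
    then have "filterlim (\<lambda>j. enn2real (?h j)) at_top sequentially"
      by (simp add: ennreal_tendsto_top_eq_at_top)
    then have "filterlim (\<lambda>j. - (c * enn2real (?h j))) at_bot sequentially"
      using c by (simp add: filterlim_uminus_at_bot filterlim_tendsto_pos_mult_at_top[OF tendsto_const])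
    then have "(\<lambda>j. exp (- c * enn2real (?h j))) \<longlonglongrightarrow> 0"
      by (simp add: filterlim_compose[OF exp_at_bot])
    from tendsto_ennrealI[OF this] have "(\<lambda>j. ennreal (exp (- c * enn2real (?h j)))) \<longlonglongrightarrow> 0" by simp
    then show ?thesis
      using False unfolding d unfolding damp_def by simp
  qed
qed

lemma eventually_in_W: "eventually (\<lambda>j. x \<in> W j) sequentially"
proof -
  obtain j where "x \<in> W j" using UN_W by blast
  then show ?thesis
    using incseq_W by (auto simp: eventually_sequentially incseq_def intro!: exI[of _ j])
qed

text \<open>For a finite cluster the approximations are eventually exact, apart from the factor \<open>d j\<close>. An
  infinite cluster contains \<open>n + 1\<close> vertices that belong to the approximating clusters as soon as \<open>j\<close>
  is large, so that these no longer have \<open>n\<close> vertices.\<close>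

lemma component_window_tendsto:
  fixes g :: "'a graph \<Rightarrow> ennreal"
  assumes \<mu>: "\<mu> \<in> graphs" "v \<in> verts \<mu>" and g: "\<And>\<mu>. g \<mu> < top"
    and d: "\<And>\<mu>. finite (verts \<mu>) \<Longrightarrow> (\<lambda>j. d j \<mu>) \<longlonglongrightarrow> D \<mu>"
  shows "(\<lambda>j. g (component v (restr (W j) \<mu>)) * d j (component v (restr (W j) \<mu>)) *
      has_card n (component v (restr (W j) \<mu>)))
    \<longlonglongrightarrow> g (component v \<mu>) * D (component v \<mu>) * has_card n (component v \<mu>)"
proof (cases "finite (verts (component v \<mu>))")
  case True
  have "eventually (\<lambda>j. \<forall>x\<in>verts (component v \<mu>). x \<in> W j) sequentially"
    using True eventually_in_W by (intro eventually_ball_finite) auto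
  then have ev: "eventually (\<lambda>j. component v (restr (W j) \<mu>) = component v \<mu>) sequentially"
  proof (rule eventually_mono)
    fix j assume "\<forall>x\<in>verts (component v \<mu>). x \<in> W j"
    then show "component v (restr (W j) \<mu>) = component v \<mu>"
      by (intro component_restr_eq[OF \<mu>]) auto
  qed
  have h: "has_card n (component v \<mu>) < top"
    by (rule le_less_trans[OF has_card_le_1]) simp
  have "(\<lambda>j. g (component v \<mu>) * (has_card n (component v \<mu>) * d j (component v \<mu>)))
      \<longlonglongrightarrow> g (component v \<mu>) * (has_card n (component v \<mu>) * D (component v \<mu>))"
    by (intro ennreal_tendsto_cmult d True h g)
  then have "(\<lambda>j. g (component v \<mu>) * d j (component v \<mu>) * has_card n (component v \<mu>))
      \<longlonglongrightarrow> g (component v \<mu>) * D (component v \<mu>) * has_card n (component v \<mu>)"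
    by (simp add: ac_simps)
  then show ?thesis
    by (rule Lim_transform_eventually) (use ev in \<open>auto elim!: eventually_mono\<close>)
next
  case False
  then obtain F where F: "F \<subseteq> verts (component v \<mu>)" "finite F" "card F = Suc n"
    using infinite_arbitrarily_large by metis
  have "eventually (\<lambda>j. \<forall>x\<in>F. x \<in> verts (component v (restr (W j) \<mu>))) sequentially"
    using F eventually_verts_component_restr[OF incseq_W UN_W] by (intro eventually_ball_finite) auto
  then have "eventually (\<lambda>j. has_card n (component v (restr (W j) \<mu>)) = 0) sequentially"
  proof eventually_elim
    fix j assume "\<forall>x\<in>F. x \<in> verts (component v (restr (W j) \<mu>))"
    then have "F \<subseteq> verts (component v (restr (W j) \<mu>))" by auto
    then have "\<not> (finite (verts (component v (restr (W j) \<mu>))) \<and> card (verts (component v (restr (W j) \<mu>))) = n)"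
      using F card_mono[of "verts (component v (restr (W j) \<mu>))" F] by auto
    then show "has_card n (component v (restr (W j) \<mu>)) = 0"
      by (rule has_card_eq_0_iff[THEN iffD2])
  qed
  moreover have "has_card n (component v \<mu>) = 0"
    using False by (simp add: has_card_eq_0_iff)
  ultimately show ?thesis
    by (intro tendsto_eventually) (auto elim!: eventually_mono)
qed

lemma nn_integral_window_tendsto:
  assumes pp: "poisson_process M (scale_measure (ennreal t) lam) \<eta>" and rcm: "rcm M \<phi> \<eta> v \<xi>"
    and g: "g \<in> borel_measurable graph_space" "\<And>\<mu>. g \<mu> \<le> ennreal b"
    and d: "\<And>\<mu>. finite (verts \<mu>) \<Longrightarrow> (\<lambda>j. d j \<mu>) \<longlonglongrightarrow> D \<mu>"
    and d_meas: "\<And>j. d j \<in> borel_measurable graph_space" "D \<in> borel_measurable graph_space"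
    and d_le: "\<And>j \<mu>. d j \<mu> \<le> 1"
  shows "(\<lambda>j. \<integral>\<^sup>+\<omega>. g (component v (restr (W j) (\<xi> \<omega>))) * d j (component v (restr (W j) (\<xi> \<omega>))) *
      has_card n (component v (restr (W j) (\<xi> \<omega>))) \<partial>M)
    \<longlonglongrightarrow> (\<integral>\<^sup>+\<omega>. g (component v (\<xi> \<omega>)) * D (component v (\<xi> \<omega>)) * has_card n (component v (\<xi> \<omega>)) \<partial>M)"
proof (rule nn_integral_dominated_convergence[where w="\<lambda>_. ennreal b"])
  interpret prob_space M using pp by (simp add: poisson_process_def)
  have eta: "\<eta> \<in> M \<rightarrow>\<^sub>M point_space" using pp by (simp add: poisson_process_def)
  have xi: "\<xi> \<in> M \<rightarrow>\<^sub>M graph_space" using rcm by (simp add: rcm_def)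
  note hc = measurable_has_card[of n]
  have m: "(\<lambda>\<mu>. g \<mu> * e \<mu> * has_card n \<mu>) \<in> borel_measurable graph_space"
    if "e \<in> borel_measurable graph_space" for e
    using g(1) that hc by (intro borel_measurable_times_ennreal)
  show "(\<lambda>\<omega>. g (component v (restr (W j) (\<xi> \<omega>))) * d j (component v (restr (W j) (\<xi> \<omega>))) *
      has_card n (component v (restr (W j) (\<xi> \<omega>)))) \<in> borel_measurable M" for j
    using measurable_compose[OF measurable_compose[OF measurable_compose[OF xi measurable_restr[OF W(1)]]
      measurable_component] m[OF d_meas(1)]] .
  show "(\<lambda>\<omega>. g (component v (\<xi> \<omega>)) * D (component v (\<xi> \<omega>)) * has_card n (component v (\<xi> \<omega>))) \<in> borel_measurable M"
    using measurable_compose[OF measurable_compose[OF xi measurable_component] m[OF d_meas(2)]] .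
  show "(\<integral>\<^sup>+\<omega>. ennreal b \<partial>M) < \<infinity>" by (simp add: emeasure_space_1)
  have "g \<mu> * d j \<mu> * has_card n \<mu> \<le> ennreal b * 1 * 1" for \<mu> j
    using g(2) d_le by (intro mult_mono) (auto simp: has_card_le_1)
  then show "AE \<omega> in M. g (component v (restr (W j) (\<xi> \<omega>))) * d j (component v (restr (W j) (\<xi> \<omega>))) *
      has_card n (component v (restr (W j) (\<xi> \<omega>))) \<le> ennreal b" for j
    by simp
  have g_top: "g \<mu> < top" for \<mu> using g(2) by (rule le_less_trans) simp
  show "AE \<omega> in M. (\<lambda>j. g (component v (restr (W j) (\<xi> \<omega>))) * d j (component v (restr (W j) (\<xi> \<omega>))) *
      has_card n (component v (restr (W j) (\<xi> \<omega>))))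
      \<longlonglongrightarrow> g (component v (\<xi> \<omega>)) * D (component v (\<xi> \<omega>)) * has_card n (component v (\<xi> \<omega>))"
    using AE_root_in_verts[OF rcm eta] AE_space
    by eventually_elim
      (use d g_top measurable_space[OF xi] in \<open>auto simp: space_graph_space intro!: component_window_tendsto\<close>)
qed simp

lemma SUP_min_of_nat: "(SUP i. min x (of_nat i)) = (x :: ennreal)"
proof (cases "x = top")
  case True
  then show ?thesis by (simp add: min_def top_unique ennreal_SUP_of_nat_eq_top)
next
  case False
  then obtain n where "x < of_nat n" using ennreal_Ex_less_of_nat[of x] by (auto simp: less_top)
  then show ?thesis
    by (intro antisym SUP_least SUP_upper2[of n]) (auto simp: min_def)
qed

text \<open>On the event that the cluster has \<open>k + 1\<close> vertices, its law at intensity \<open>t\<close> has the density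
  \<open>(t / s) ^ k * exp (- (t - s) * hit lam V)\<close> with respect to its law at intensity \<open>s\<close>, where \<open>V\<close> is
  the vertex set. For bounded \<open>g\<close> this is the limit of the corresponding identities in the windows;
  truncation extends it to all \<open>g\<close>.\<close>

lemma nn_integral_change_intensity:
  assumes st: "0 < s" "s < t"
    and pt: "poisson_process M (scale_measure (ennreal t) lam) \<eta>" "rcm M \<phi> \<eta> v \<xi>"
    and ps: "poisson_process N (scale_measure (ennreal s) lam) \<eta>" "rcm N \<phi> \<eta> v \<xi>"
    and g: "g \<in> borel_measurable graph_space"
  shows "(\<integral>\<^sup>+\<omega>. g (component v (\<xi> \<omega>)) * has_card (Suc k) (component v (\<xi> \<omega>)) \<partial>M) =
    ennreal ((t / s) ^ k) *
    (\<integral>\<^sup>+\<omega>. g (component v (\<xi> \<omega>)) * damp lam (t - s) (component v (\<xi> \<omega>)) *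
      has_card (Suc k) (component v (\<xi> \<omega>)) \<partial>N)"
proof -
  note hc = measurable_has_card[of "Suc k"]
  have bounded: "(\<integral>\<^sup>+\<omega>. g (component v (\<xi> \<omega>)) * has_card (Suc k) (component v (\<xi> \<omega>)) \<partial>M) =
    ennreal ((t / s) ^ k) *
    (\<integral>\<^sup>+\<omega>. g (component v (\<xi> \<omega>)) * damp lam (t - s) (component v (\<xi> \<omega>)) *
      has_card (Suc k) (component v (\<xi> \<omega>)) \<partial>N)"
    if g: "g \<in> borel_measurable graph_space" "\<And>\<mu>. g \<mu> \<le> ennreal b" for g b
  proof -
    let ?C = "\<lambda>j \<omega>. component v (restr (W j) (\<xi> \<omega>))"
    let ?d = "\<lambda>j. damp (nu j) (t - s)"
    let ?A = "\<lambda>j. \<integral>\<^sup>+\<omega>. g (?C j \<omega>) * has_card (Suc k) (?C j \<omega>) \<partial>M"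
    let ?B = "\<lambda>j. \<integral>\<^sup>+\<omega>. g (?C j \<omega>) * ?d j (?C j \<omega>) * has_card (Suc k) (?C j \<omega>) \<partial>N"
    have d_meas: "?d j \<in> borel_measurable graph_space" for j
      by (rule measurable_damp[OF window.sigma_finite_nu[OF window_nu] window.sets_nu[OF window_nu]])
    have d_le: "?d j \<mu> \<le> 1" for j \<mu>
      using st by (auto simp: damp_def mult_nonpos_nonneg)
    have A: "?A \<longlonglongrightarrow> (\<integral>\<^sup>+\<omega>. g (component v (\<xi> \<omega>)) * has_card (Suc k) (component v (\<xi> \<omega>)) \<partial>M)"
      using nn_integral_window_tendsto[OF pt g, of "\<lambda>_ _. 1" "\<lambda>_. 1"] by simp
    have B: "?B \<longlonglongrightarrow> (\<integral>\<^sup>+\<omega>. g (component v (\<xi> \<omega>)) * damp lam (t - s) (component v (\<xi> \<omega>)) *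
        has_card (Suc k) (component v (\<xi> \<omega>)) \<partial>N)"
      using st by (intro nn_integral_window_tendsto[OF ps g] damp_tendsto d_meas measurable_damp[OF sigma_finite_lam lam_sets] d_le) auto
    have "?A j = ennreal ((t / s) ^ k) * ?B j" for j
    proof -
      have mA: "(\<lambda>\<mu>. g (component v \<mu>) * has_card (Suc k) (component v \<mu>)) \<in> borel_measurable graph_space"
        using measurable_compose[OF measurable_component borel_measurable_times_ennreal[OF g(1) hc]] .
      have "(\<lambda>\<mu>. g \<mu> * ?d j \<mu> * has_card (Suc k) \<mu>) \<in> borel_measurable graph_space"
        using g(1) d_meas hc by (intro borel_measurable_times_ennreal)
      from measurable_compose[OF measurable_component this]
      have mB: "(\<lambda>\<mu>. g (component v \<mu>) * ?d j (component v \<mu>) * has_card (Suc k) (component v \<mu>))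
          \<in> borel_measurable graph_space" .
      show ?thesis
        using st nn_integral_restr_rcm[OF pt(1) _ pt(2) mA, of j] nn_integral_restr_rcm[OF ps(1) _ ps(2) mB, of j]
          rcm_window.poisson_law_change_intensity[OF rcm_window st(1) _ g(1), of t j v k]
        by simp
    qed
    then have "?A \<longlonglongrightarrow> ennreal ((t / s) ^ k) * (\<integral>\<^sup>+\<omega>. g (component v (\<xi> \<omega>)) *
        damp lam (t - s) (component v (\<xi> \<omega>)) * has_card (Suc k) (component v (\<xi> \<omega>)) \<partial>N)"
      using ennreal_tendsto_cmult[OF _ B, of "ennreal ((t / s) ^ k)"] by simp
    with A show ?thesis by (rule LIMSEQ_unique)
  qed
  \<comment> \<open>Truncation makes the bounded case applicable.\<close>
  define G where "G i \<mu> = min (g \<mu>) (of_nat i)" for i :: nat and \<mu>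
  have G: "G i \<in> borel_measurable graph_space" for i
    unfolding G_def[abs_def] using g by measurable
  have G_le: "G i \<mu> \<le> ennreal (real i)" for i \<mu>
    by (simp add: G_def ennreal_of_nat_eq_real_of_nat)
  have inc: "incseq G"
    unfolding incseq_def le_fun_def G_def by (intro allI impI min.mono of_nat_mono order_refl)
  have SUP: "(\<integral>\<^sup>+\<omega>. g (component v (\<xi> \<omega>)) * h (component v (\<xi> \<omega>)) \<partial>K) =
      (SUP i. \<integral>\<^sup>+\<omega>. G i (component v (\<xi> \<omega>)) * h (component v (\<xi> \<omega>)) \<partial>K)"
    if h: "h \<in> borel_measurable graph_space" and K: "\<xi> \<in> K \<rightarrow>\<^sub>M graph_space" for h K
  proof -
    have "(SUP i. G i \<mu> * h \<mu>) = g \<mu> * h \<mu>" for \<mu>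
      unfolding SUP_mult_right_ennreal[symmetric] by (simp add: G_def SUP_min_of_nat)
    then have "(\<integral>\<^sup>+\<omega>. g (component v (\<xi> \<omega>)) * h (component v (\<xi> \<omega>)) \<partial>K) =
        (\<integral>\<^sup>+\<omega>. (SUP i. G i (component v (\<xi> \<omega>)) * h (component v (\<xi> \<omega>))) \<partial>K)" by simp
    also have "\<dots> = (SUP i. \<integral>\<^sup>+\<omega>. G i (component v (\<xi> \<omega>)) * h (component v (\<xi> \<omega>)) \<partial>K)"
    proof (rule nn_integral_monotone_convergence_SUP)
      show "incseq (\<lambda>i \<omega>. G i (component v (\<xi> \<omega>)) * h (component v (\<xi> \<omega>)))"
        using inc by (auto simp: incseq_def le_fun_def intro!: mult_right_mono)
      have "(\<lambda>\<mu>. G i \<mu> * h \<mu>) \<in> borel_measurable graph_space" for i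
        using G h by (intro borel_measurable_times_ennreal)
      then show "(\<lambda>\<omega>. G i (component v (\<xi> \<omega>)) * h (component v (\<xi> \<omega>))) \<in> borel_measurable K" for i
        by (rule measurable_compose[OF measurable_compose[OF K measurable_component]])
    qed
    finally show ?thesis .
  qed
  have D: "(\<lambda>\<mu>. damp lam (t - s) \<mu> * has_card (Suc k) \<mu>) \<in> borel_measurable graph_space"
    using measurable_damp[OF sigma_finite_lam lam_sets] hc by (intro borel_measurable_times_ennreal)
  have xi: "\<xi> \<in> M \<rightarrow>\<^sub>M graph_space" "\<xi> \<in> N \<rightarrow>\<^sub>M graph_space"
    using pt ps by (auto simp: rcm_def)
  show ?thesis
    unfolding mult.assoc SUP[OF hc xi(1)] SUP[OF D xi(2)] SUP_mult_left_ennreal[symmetric]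
    using bounded[OF G G_le] by (simp add: mult.assoc SUP_mult_left_ennreal)
qed

end

section \<open>Laplace transforms\<close>

lemma abs_exp_diff_le:
  fixes a b m :: real
  assumes "m \<le> a" "m \<le> b"
  shows "\<bar>exp (- a) - exp (- b)\<bar> \<le> \<bar>a - b\<bar> * exp (- m)"
proof -
  have *: "\<bar>exp (- a) - exp (- b)\<bar> \<le> \<bar>a - b\<bar> * exp (- m)" if "a \<le> b" "m \<le> a" for a b :: real
  proof -
    have e: "1 - exp (- (b - a)) \<le> b - a" using exp_ge_add_one_self[of "- (b - a)"] by linarith
    have "exp (- a) - exp (- b) = exp (- a) * (1 - exp (- (b - a)))"
      by (simp add: algebra_simps exp_add[symmetric])
    also have "\<dots> \<le> exp (- m) * (b - a)"
      using that by (intro mult_mono e) auto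
    finally show ?thesis using that by (simp add: abs_if mult.commute)
  qed
  show ?thesis
    using *[of a b] *[of b a] assms by (cases "a \<le> b") (auto simp: abs_minus_commute)
qed

lemma mult_exp_le:
  fixes S c :: real
  assumes "0 < c"
  shows "S * exp (- (c * S)) \<le> 1 / c"
proof -
  have "c * S \<le> exp (c * S)" using exp_ge_add_one_self[of "c * S"] by linarith
  then have "c * S * exp (- (c * S)) \<le> exp (c * S) * exp (- (c * S))"
    by (rule mult_right_mono) simp
  then show ?thesis using assms by (simp add: exp_add[symmetric] field_simps)
qed

lemma integrable_laplace:
  fixes F S :: "'w \<Rightarrow> real"
  assumes F: "integrable M F" and S: "S \<in> borel_measurable M" "\<And>\<omega>. 0 \<le> S \<omega>" and c: "0 \<le> c"
  shows "integrable M (\<lambda>\<omega>. F \<omega> * exp (- c * S \<omega>))"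
proof (rule Bochner_Integration.integrable_bound[OF F])
  show "(\<lambda>\<omega>. F \<omega> * exp (- c * S \<omega>)) \<in> borel_measurable M" using F S by measurable
  have "\<bar>F \<omega>\<bar> * exp (- (c * S \<omega>)) \<le> \<bar>F \<omega>\<bar> * 1" for \<omega>
    using c S(2) by (intro mult_left_mono) auto
  then show "AE \<omega> in M. norm (F \<omega> * exp (- c * S \<omega>)) \<le> norm (F \<omega>)"
    by (simp add: abs_mult)
qed

lemma integrable_laplace_deriv:
  fixes F S :: "'w \<Rightarrow> real"
  assumes F: "integrable M F" and S: "S \<in> borel_measurable M" "\<And>\<omega>. 0 \<le> S \<omega>" and c: "0 < c"
  shows "integrable M (\<lambda>\<omega>. F \<omega> * S \<omega> * exp (- c * S \<omega>))"
proof (rule Bochner_Integration.integrable_bound[where f="\<lambda>\<omega>. (1 / c) * F \<omega>"])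
  show "integrable M (\<lambda>\<omega>. (1 / c) * F \<omega>)" using F by simp
  show "(\<lambda>\<omega>. F \<omega> * S \<omega> * exp (- c * S \<omega>)) \<in> borel_measurable M" using F S by measurable
  have "\<bar>F \<omega>\<bar> * (S \<omega> * exp (- (c * S \<omega>))) \<le> \<bar>F \<omega>\<bar> * (1 / c)" for \<omega>
    using c by (intro mult_left_mono mult_exp_le) auto
  then show "AE \<omega> in M. norm (F \<omega> * S \<omega> * exp (- c * S \<omega>)) \<le> norm ((1 / c) * F \<omega>)"
    using c S(2) by (simp add: abs_mult mult.assoc)
qed

text \<open>Differentiation under the integral. The difference quotients at \<open>c > 0\<close> are dominated because
  \<open>S * exp (- (c / 2) * S)\<close> is bounded by \<open>2 / c\<close>.\<close>

lemma has_real_derivative_laplace: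
  fixes F S :: "'w \<Rightarrow> real"
  assumes F: "integrable M F" and S: "S \<in> borel_measurable M" "\<And>\<omega>. 0 \<le> S \<omega>" and c: "0 < c"
  shows "((\<lambda>c. \<integral>\<omega>. F \<omega> * exp (- c * S \<omega>) \<partial>M) has_real_derivative
    (\<integral>\<omega>. - (F \<omega> * S \<omega> * exp (- c * S \<omega>)) \<partial>M)) (at c)"
  unfolding has_field_derivative_iff tendsto_at_iff_sequentially
proof (intro allI impI)
  fix X :: "nat \<Rightarrow> real"
  assume X: "\<forall>i. X i \<in> UNIV - {c}" "X \<longlonglongrightarrow> c"
  let ?G = "\<lambda>c. \<integral>\<omega>. F \<omega> * exp (- c * S \<omega>) \<partial>M"
  let ?q = "\<lambda>x \<omega>. (F \<omega> * exp (- x * S \<omega>) - F \<omega> * exp (- c * S \<omega>)) / (x - c)"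
  \<comment> \<open>The domination requires \<open>X i > c / 2\<close>, so an initial segment of the sequence is dropped.\<close>
  have "eventually (\<lambda>i. c / 2 < X i) sequentially"
    using c by (intro order_tendstoD(1)[OF X(2)]) auto
  then obtain n where n: "\<And>i. n \<le> i \<Longrightarrow> c / 2 < X i" by (auto simp: eventually_sequentially)
  let ?Y = "\<lambda>i. X (i + n)"
  have Y: "?Y i \<noteq> c" "c / 2 < ?Y i" for i using X(1) n by auto
  have "(\<lambda>i. \<integral>\<omega>. ?q (?Y i) \<omega> \<partial>M) \<longlonglongrightarrow> (\<integral>\<omega>. - (F \<omega> * S \<omega> * exp (- c * S \<omega>)) \<partial>M)"
  proof (rule integral_dominated_convergence[where w="\<lambda>\<omega>. \<bar>F \<omega>\<bar> * (2 / c)"])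
    show "(\<lambda>\<omega>. - (F \<omega> * S \<omega> * exp (- c * S \<omega>))) \<in> borel_measurable M" using F S by measurable
    show "?q (?Y i) \<in> borel_measurable M" for i using F S by measurable
    show "integrable M (\<lambda>\<omega>. \<bar>F \<omega>\<bar> * (2 / c))" using F by simp
    show "AE \<omega> in M. (\<lambda>i. ?q (?Y i) \<omega>) \<longlonglongrightarrow> - (F \<omega> * S \<omega> * exp (- c * S \<omega>))"
    proof (rule AE_I2)
      fix \<omega>
      have "((\<lambda>c. F \<omega> * exp (- c * S \<omega>)) has_real_derivative - (F \<omega> * S \<omega> * exp (- c * S \<omega>))) (at c)"
        by (auto intro!: derivative_eq_intros)
      then have "((\<lambda>i. ?q i \<omega>) \<circ> X) \<longlonglongrightarrow> - (F \<omega> * S \<omega> * exp (- c * S \<omega>))"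
        using X unfolding has_field_derivative_iff tendsto_at_iff_sequentially by blast
      then show "(\<lambda>i. ?q (?Y i) \<omega>) \<longlonglongrightarrow> - (F \<omega> * S \<omega> * exp (- c * S \<omega>))"
        using LIMSEQ_ignore_initial_segment[of "(\<lambda>i. ?q i \<omega>) \<circ> X" _ n] by (simp add: comp_def)
    qed
    show "AE \<omega> in M. norm (?q (?Y i) \<omega>) \<le> \<bar>F \<omega>\<bar> * (2 / c)" for i
    proof (rule AE_I2)
      fix \<omega>
      let ?x = "?Y i"
      have "\<bar>exp (- (?x * S \<omega>)) - exp (- (c * S \<omega>))\<bar> \<le> \<bar>?x * S \<omega> - c * S \<omega>\<bar> * exp (- (c / 2 * S \<omega>))"
        using Y(2)[of i] c S(2)[of \<omega>] by (intro abs_exp_diff_le mult_right_mono) auto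
      also have "\<bar>?x * S \<omega> - c * S \<omega>\<bar> * exp (- (c / 2 * S \<omega>)) = \<bar>?x - c\<bar> * (S \<omega> * exp (- (c / 2 * S \<omega>)))"
        using S(2)[of \<omega>] by (simp add: left_diff_distrib[symmetric] abs_mult)
      also have "\<dots> \<le> \<bar>?x - c\<bar> * (1 / (c / 2))"
        using c by (intro mult_left_mono mult_exp_le) auto
      finally have "\<bar>exp (- (?x * S \<omega>)) - exp (- (c * S \<omega>))\<bar> / \<bar>?x - c\<bar> \<le> 2 / c"
        using Y(1)[of i] c by (simp add: field_simps)
      then have "\<bar>F \<omega>\<bar> * (\<bar>exp (- (?x * S \<omega>)) - exp (- (c * S \<omega>))\<bar> / \<bar>?x - c\<bar>) \<le> \<bar>F \<omega>\<bar> * (2 / c)"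
        by (rule mult_left_mono) simp
      then show "norm (?q ?x \<omega>) \<le> \<bar>F \<omega>\<bar> * (2 / c)"
        by (simp add: right_diff_distrib[symmetric] abs_mult)
    qed
  qed
  moreover have "(\<integral>\<omega>. ?q (?Y i) \<omega> \<partial>M) = (?G (?Y i) - ?G c) / (?Y i - c)" for i
  proof -
    have "0 \<le> ?Y i" using Y(2)[of i] c by simp
    then show ?thesis
      using integrable_laplace[OF F S, of "?Y i"] integrable_laplace[OF F S, of c] c by simp
  qed
  ultimately have "(\<lambda>i. (?G (?Y i) - ?G c) / (?Y i - c)) \<longlonglongrightarrow> (\<integral>\<omega>. - (F \<omega> * S \<omega> * exp (- c * S \<omega>)) \<partial>M)"
    by (simp only:)
  then have "(\<lambda>i. (?G (X i) - ?G c) / (X i - c)) \<longlonglongrightarrow> (\<integral>\<omega>. - (F \<omega> * S \<omega> * exp (- c * S \<omega>)) \<partial>M)"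
    by (rule LIMSEQ_offset)
  then show "((\<lambda>y. (?G y - ?G c) / (y - c)) \<circ> X) \<longlonglongrightarrow> (\<integral>\<omega>. - (F \<omega> * S \<omega> * exp (- c * S \<omega>)) \<partial>M)"
    by (simp add: comp_def)
qed

text \<open>A part \<open>exp (- (c / 2) * S)\<close> of the exponential can be absorbed into the integrand, which exhibits
  the derivative as a Laplace transform again.\<close>

lemma isCont_laplace_deriv:
  fixes F S :: "'w \<Rightarrow> real"
  assumes F: "integrable M F" and S: "S \<in> borel_measurable M" "\<And>\<omega>. 0 \<le> S \<omega>" and c: "0 < c"
  shows "isCont (\<lambda>c. \<integral>\<omega>. - (F \<omega> * S \<omega> * exp (- c * S \<omega>)) \<partial>M) c"
proof -
  define F' where "F' \<omega> = - (F \<omega> * S \<omega> * exp (- (c / 2) * S \<omega>))" for \<omega>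
  have F': "integrable M F'"
    unfolding F'_def using c by (intro Bochner_Integration.integrable_minus integrable_laplace_deriv[OF F S]) auto
  have "isCont (\<lambda>c. \<integral>\<omega>. F' \<omega> * exp (- c * S \<omega>) \<partial>M) (c / 2)"
    using c by (intro DERIV_isCont[OF has_real_derivative_laplace[OF F' S]]) auto
  then have "isCont (\<lambda>x. \<integral>\<omega>. F' \<omega> * exp (- (x - c / 2) * S \<omega>) \<partial>M) c"
    by (intro isCont_o2[where g="\<lambda>c. \<integral>\<omega>. F' \<omega> * exp (- c * S \<omega>) \<partial>M" and f="\<lambda>x. x - c / 2"]) auto
  moreover have "F' \<omega> * exp (- (x - c / 2) * S \<omega>) = - (F \<omega> * S \<omega> * exp (- x * S \<omega>))" for x \<omega>
    by (simp add: F'_def mult.assoc exp_add[symmetric] algebra_simps)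
  ultimately show ?thesis by simp
qed

section \<open>The means as functions of the intensity\<close>

locale rcm_family = rcm_setting \<phi> lam v
  for \<phi> :: "'a::polish_space \<Rightarrow> 'a \<Rightarrow> real" and lam :: "'a measure" and v :: 'a +
  fixes P :: "real \<Rightarrow> 'w measure" and \<eta> :: "'w \<Rightarrow> 'a set" and \<xi> :: "'w \<Rightarrow> 'a graph"
    and f :: "'a graph \<Rightarrow> real"
  assumes eta_poisson: "\<And>t. 0 < t \<Longrightarrow> poisson_process (P t) (scale_measure (ennreal t) lam) \<eta>"
    and xi_rcm: "\<And>t. 0 < t \<Longrightarrow> rcm (P t) \<phi> \<eta> v \<xi>"
    and f_measurable: "f \<in> borel_measurable graph_space"
begin

abbreviation C :: "'w \<Rightarrow> 'a graph" where "C \<omega> \<equiv> component v (\<xi> \<omega>)"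

lemma measurable_C: "0 < t \<Longrightarrow> C \<in> P t \<rightarrow>\<^sub>M graph_space"
  using xi_rcm[of t] measurable_component[of v] by (auto simp: rcm_def intro: measurable_compose)

lemma measurable_f_indicator:
  assumes "0 < t" "A \<in> sets borel"
  shows "(\<lambda>\<omega>. f (C \<omega>) * indicator {\<mu>. num (verts \<mu>) \<in> A} (C \<omega>)) \<in> borel_measurable (P t)"
proof -
  note measurable_num_verts[measurable] f_measurable[measurable] assms(2)[measurable]
  have "(\<lambda>\<mu>. f \<mu> * (if num (verts \<mu>) \<in> A then 1 else 0)) \<in> borel_measurable graph_space" by measurable
  from measurable_compose[OF measurable_C[OF assms(1)] this] show ?thesis
    by (simp add: indicator_def of_bool_def)
qed

lemma has_card_eq: "has_card n \<mu> = ennreal (indicator {\<mu>. num (verts \<mu>) = of_nat n} \<mu>)"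
  by (simp add: has_card_def indicator_def)

definition hits :: "'w \<Rightarrow> real" where
  "hits \<omega> = (if finite (verts (C \<omega>)) then enn2real (hit lam (verts (C \<omega>))) else 0)"

text \<open>The part of the integrand where \<open>hit lam (verts (C \<omega>))\<close> is finite; the remaining part does not
  contribute to intensities above the reference intensity.\<close>

definition trimmed :: "nat \<Rightarrow> 'w \<Rightarrow> real" where
  "trimmed n \<omega> = f (C \<omega>) * indicator {\<mu>. num (verts \<mu>) = of_nat n} (C \<omega>) *
    indicator {\<mu>. finite (verts \<mu>) \<and> hit lam (verts \<mu>) < \<infinity>} (C \<omega>)"

lemma measurable_hits:
  assumes "0 < t"
  shows "hits \<in> borel_measurable (P t)"
    "Measurable.pred (P t) (\<lambda>\<omega>. finite (verts (C \<omega>)) \<and> hit lam (verts (C \<omega>)) < \<infinity>)"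
proof -
  note h = measurable_hit[OF sigma_finite_lam lam_sets]
  from measurable_compose[OF measurable_compose[OF measurable_C[OF assms] measurable_verts] h]
  have [measurable]: "(\<lambda>\<omega>. if finite (verts (C \<omega>)) then hit lam (verts (C \<omega>)) else 0) \<in> borel_measurable (P t)" .
  have [measurable]: "(\<lambda>\<omega>. num (verts (C \<omega>))) \<in> borel_measurable (P t)"
    using measurable_C[OF assms] measurable_num_verts by (rule measurable_compose)
  have "(\<lambda>\<omega>. enn2real (if finite (verts (C \<omega>)) then hit lam (verts (C \<omega>)) else 0)) \<in> borel_measurable (P t)"
    by measurable
  moreover have "hits = (\<lambda>\<omega>. enn2real (if finite (verts (C \<omega>)) then hit lam (verts (C \<omega>)) else 0))"
    by (auto simp: hits_def fun_eq_iff)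
  ultimately show "hits \<in> borel_measurable (P t)" by simp
  have "Measurable.pred (P t) (\<lambda>\<omega>. num (verts (C \<omega>)) < \<infinity> \<and>
      (if finite (verts (C \<omega>)) then hit lam (verts (C \<omega>)) else 0) < \<infinity>)" by measurable
  then show "Measurable.pred (P t) (\<lambda>\<omega>. finite (verts (C \<omega>)) \<and> hit lam (verts (C \<omega>)) < \<infinity>)"
    unfolding num_less_top_iff by (simp cong: conj_cong)
qed

lemma measurable_trimmed: "0 < t \<Longrightarrow> trimmed n \<in> borel_measurable (P t)"
proof -
  assume t: "0 < t"
  note measurable_hits(2)[OF t, measurable]
  have [measurable]: "(\<lambda>\<omega>. f (C \<omega>) * indicator {\<mu>. num (verts \<mu>) \<in> {of_nat n}} (C \<omega>)) \<in> borel_measurable (P t)"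
    using t by (rule measurable_f_indicator) simp
  have "(\<lambda>\<omega>. f (C \<omega>) * indicator {\<mu>. num (verts \<mu>) \<in> {of_nat n}} (C \<omega>) *
    (if finite (verts (C \<omega>)) \<and> hit lam (verts (C \<omega>)) < \<infinity> then 1 else 0)) \<in> borel_measurable (P t)"
    by measurable
  then show ?thesis by (simp add: trimmed_def[abs_def] indicator_def of_bool_def)
qed

lemma hits_nonneg: "0 \<le> hits \<omega>"
  by (simp add: hits_def)

lemma nn_integral_change:
  assumes st: "0 < s" "s < t" and g: "g \<in> borel_measurable graph_space"
  shows "(\<integral>\<^sup>+\<omega>. ennreal (g (C \<omega>) * indicator {\<mu>. num (verts \<mu>) = of_nat (Suc k)} (C \<omega>)) \<partial>P t) =
    ennreal ((t / s) ^ k) * (\<integral>\<^sup>+\<omega>. ennreal (g (C \<omega>) * indicator {\<mu>. num (verts \<mu>) = of_nat (Suc k)} (C \<omega>) *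
      indicator {\<mu>. finite (verts \<mu>) \<and> hit lam (verts \<mu>) < \<infinity>} (C \<omega>) * exp (- (t - s) * hits \<omega>)) \<partial>P s)"
proof -
  have t: "0 < t" using st by simp
  have g': "(\<lambda>\<mu>. ennreal (g \<mu>)) \<in> borel_measurable graph_space" using g by measurable
  have 1: "ennreal (g (C \<omega>) * indicator {\<mu>. num (verts \<mu>) = of_nat (Suc k)} (C \<omega>)) =
      ennreal (g (C \<omega>)) * has_card (Suc k) (C \<omega>)" for \<omega>
    by (simp add: has_card_eq indicator_def)
  have 2: "ennreal (g (C \<omega>) * indicator {\<mu>. num (verts \<mu>) = of_nat (Suc k)} (C \<omega>) *
      indicator {\<mu>. finite (verts \<mu>) \<and> hit lam (verts \<mu>) < \<infinity>} (C \<omega>) * exp (- (t - s) * hits \<omega>)) =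
      ennreal (g (C \<omega>)) * damp lam (t - s) (C \<omega>) * has_card (Suc k) (C \<omega>)" for \<omega>
    by (auto simp: has_card_eq indicator_def damp_def hits_def ennreal_mult'' simp del: of_nat_Suc)
  show ?thesis
    unfolding 1 2
    by (rule nn_integral_change_intensity[OF st eta_poisson[OF t] xi_rcm[OF t]
        eta_poisson[OF st(1)] xi_rcm[OF st(1)] g'])
qed

end

lemma DERIV_diff_shift:
  fixes h :: "real \<Rightarrow> real"
  shows "(h has_real_derivative d) (at (t - a)) \<Longrightarrow> ((\<lambda>t. h (t - a)) has_real_derivative d) (at t)"
  using DERIV_shift[of h d t "- a"] by simp

context rcm_family
begin

lemma integrable_of_abs_mean_fin:
  assumes s: "0 < s" and fin: "abs_mean_fin P \<xi> v f s < \<infinity>"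
    and A: "A \<in> sets borel" "A \<subseteq> {..<\<infinity>}"
  shows "integrable (P s) (\<lambda>\<omega>. f (C \<omega>) * indicator {\<mu>. num (verts \<mu>) \<in> A} (C \<omega>))"
proof (rule integrableI_bounded)
  show "(\<lambda>\<omega>. f (C \<omega>) * indicator {\<mu>. num (verts \<mu>) \<in> A} (C \<omega>)) \<in> borel_measurable (P s)"
    using s A(1) by (rule measurable_f_indicator)
  have "(\<integral>\<^sup>+\<omega>. ennreal (norm (f (C \<omega>) * indicator {\<mu>. num (verts \<mu>) \<in> A} (C \<omega>))) \<partial>P s)
      \<le> abs_mean_fin P \<xi> v f s"
    unfolding abs_mean_fin_def using A(2) by (intro nn_integral_mono) (auto simp: indicator_def)
  then show "(\<integral>\<^sup>+\<omega>. ennreal (norm (f (C \<omega>) * indicator {\<mu>. num (verts \<mu>) \<in> A} (C \<omega>))) \<partial>P s) < \<infinity>"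
    using fin by (rule le_less_trans)
qed

lemma AE_component_nonempty: "0 < t \<Longrightarrow> AE \<omega> in P t. num (verts (C \<omega>)) \<noteq> 0"
proof -
  assume t: "0 < t"
  have "\<eta> \<in> P t \<rightarrow>\<^sub>M point_space" using eta_poisson[OF t] by (simp add: poisson_process_def)
  from AE_root_in_verts[OF xi_rcm[OF t] this] show ?thesis
    by eventually_elim (auto simp: num_eq_0_iff verts_component)
qed

lemma AE_mean_eq_0: "0 < t \<Longrightarrow> AE \<omega> in P t. f (C \<omega>) * indicator {\<mu>. num (verts \<mu>) = of_nat 0} (C \<omega>) = 0"
  using AE_component_nonempty[of t] by (auto elim!: eventually_mono)

text \<open>The cluster of \<open>v\<close> contains \<open>v\<close> almost surely.\<close>

lemma mean_eq_0: "0 < t \<Longrightarrow> mean_eq P \<xi> v f 0 t = 0"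
  unfolding mean_eq_def using AE_mean_eq_0 by (intro integral_eq_zero_AE) auto

context
  fixes t\<^sub>0 :: real
  assumes t0: "0 < t\<^sub>0" and fin0: "abs_mean_fin P \<xi> v f t\<^sub>0 < \<infinity>"
begin

lemma integrable_card: "integrable (P t\<^sub>0) (\<lambda>\<omega>. f (C \<omega>) * indicator {\<mu>. num (verts \<mu>) = of_nat n} (C \<omega>))"
  using integrable_of_abs_mean_fin[OF t0 fin0, of "{of_nat n}"] by (simp add: less_top of_nat_less_top)

lemma integrable_trimmed: "integrable (P t\<^sub>0) (trimmed n)"
proof (rule Bochner_Integration.integrable_bound[OF integrable_card])
  show "trimmed n \<in> borel_measurable (P t\<^sub>0)" using t0 by (rule measurable_trimmed)
  show "AE \<omega> in P t\<^sub>0. norm (trimmed n \<omega>) \<le>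
      norm (f (C \<omega>) * indicator {\<mu>. num (verts \<mu>) = of_nat n} (C \<omega>))"
    by (intro AE_I2) (simp add: trimmed_def indicator_def)
qed

lemma integrable_trimmed_exp:
  "0 \<le> c \<Longrightarrow> integrable (P t\<^sub>0) (\<lambda>\<omega>. trimmed n \<omega> * exp (- c * hits \<omega>))"
  using integrable_trimmed measurable_hits(1)[OF t0] hits_nonneg by (rule integrable_laplace)

text \<open>Integrability at \<open>t\<^sub>0\<close> propagates to all larger intensities for a fixed number of vertices, because
  the density is bounded. This is what makes two-sided derivatives available at the right end point
  of the interval.\<close>

lemma integrable_card_ge:
  assumes t: "t\<^sub>0 \<le> t"
  shows "integrable (P t) (\<lambda>\<omega>. f (C \<omega>) * indicator {\<mu>. num (verts \<mu>) = of_nat n} (C \<omega>))"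
proof (cases "t = t\<^sub>0 \<or> n = 0")
  case True
  then show ?thesis
  proof
    assume "t = t\<^sub>0"
    then show ?thesis using integrable_card by simp
  next
    assume n: "n = 0"
    have "(\<lambda>\<omega>. f (C \<omega>) * indicator {\<mu>. num (verts \<mu>) \<in> {of_nat n}} (C \<omega>)) \<in> borel_measurable (P t)"
      using t t0 by (intro measurable_f_indicator) auto
    then show ?thesis
      using AE_mean_eq_0[of t] t t0 n
      by (intro integrable_cong_AE[THEN iffD2, OF _ _ _ integrable_zero]) auto
  qed
next
  case False
  then obtain k where n: "n = Suc k" and lt: "t\<^sub>0 < t" using t by (cases n) auto
  have abs_f: "(\<lambda>\<mu>. \<bar>f \<mu>\<bar>) \<in> borel_measurable graph_space" using f_measurable by measurable
  show ?thesis
  proof (rule integrableI_bounded)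
    have "(\<lambda>\<omega>. f (C \<omega>) * indicator {\<mu>. num (verts \<mu>) \<in> {of_nat n}} (C \<omega>)) \<in> borel_measurable (P t)"
      using t t0 by (intro measurable_f_indicator) auto
    then show "(\<lambda>\<omega>. f (C \<omega>) * indicator {\<mu>. num (verts \<mu>) = of_nat n} (C \<omega>)) \<in> borel_measurable (P t)"
      by simp
    have "(\<integral>\<^sup>+\<omega>. ennreal (norm (f (C \<omega>) * indicator {\<mu>. num (verts \<mu>) = of_nat n} (C \<omega>))) \<partial>P t) =
        (\<integral>\<^sup>+\<omega>. ennreal (\<bar>f (C \<omega>)\<bar> * indicator {\<mu>. num (verts \<mu>) = of_nat (Suc k)} (C \<omega>)) \<partial>P t)"
      by (intro nn_integral_cong) (simp add: n abs_mult)
    also have "\<dots> = ennreal ((t / t\<^sub>0) ^ k) * (\<integral>\<^sup>+\<omega>. ennreal (\<bar>f (C \<omega>)\<bar> * indicator {\<mu>. num (verts \<mu>) = of_nat (Suc k)} (C \<omega>) *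
      indicator {\<mu>. finite (verts \<mu>) \<and> hit lam (verts \<mu>) < \<infinity>} (C \<omega>) * exp (- (t - t\<^sub>0) * hits \<omega>)) \<partial>P t\<^sub>0)"
      by (rule nn_integral_change[OF t0 lt abs_f])
    also have "\<dots> = ennreal ((t / t\<^sub>0) ^ k) *
        (\<integral>\<^sup>+\<omega>. ennreal (norm (trimmed n \<omega> * exp (- (t - t\<^sub>0) * hits \<omega>))) \<partial>P t\<^sub>0)"
      by (intro arg_cong2[where f="(*)"] nn_integral_cong refl) (simp add: n trimmed_def abs_mult)
    also have "\<dots> < \<infinity>"
      using integrable_trimmed_exp[of "t - t\<^sub>0" n] lt
      by (simp add: integrable_iff_bounded ennreal_mult_less_top)
    finally show "(\<integral>\<^sup>+\<omega>. ennreal (norm (f (C \<omega>) * indicator {\<mu>. num (verts \<mu>) = of_nat n} (C \<omega>))) \<partial>P t) < \<infinity>" .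
  qed
qed

text \<open>Positive and negative part of \<open>f\<close> are transformed separately by the change of intensity.\<close>

lemma mean_eq_laplace:
  assumes t: "t\<^sub>0 < t"
  shows "mean_eq P \<xi> v f (Suc k) t =
    (t / t\<^sub>0) ^ k * (\<integral>\<omega>. trimmed (Suc k) \<omega> * exp (- (t - t\<^sub>0) * hits \<omega>) \<partial>P t\<^sub>0)"
proof -
  let ?X = "\<lambda>\<omega>. f (C \<omega>) * indicator {\<mu>. num (verts \<mu>) = of_nat (Suc k)} (C \<omega>)"
  let ?Y = "\<lambda>\<omega>. trimmed (Suc k) \<omega> * exp (- (t - t\<^sub>0) * hits \<omega>)"
  have pos: "(\<integral>\<^sup>+\<omega>. ennreal (?X \<omega>) \<partial>P t) = ennreal ((t / t\<^sub>0) ^ k) * (\<integral>\<^sup>+\<omega>. ennreal (?Y \<omega>) \<partial>P t\<^sub>0)"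
    unfolding trimmed_def by (rule nn_integral_change[OF t0 t f_measurable])
  have "(\<lambda>\<mu>. - f \<mu>) \<in> borel_measurable graph_space" using f_measurable by measurable
  from nn_integral_change[OF t0 t this]
  have neg: "(\<integral>\<^sup>+\<omega>. ennreal (- ?X \<omega>) \<partial>P t) = ennreal ((t / t\<^sub>0) ^ k) * (\<integral>\<^sup>+\<omega>. ennreal (- ?Y \<omega>) \<partial>P t\<^sub>0)"
    unfolding trimmed_def by (simp only: mult_minus_left)
  have "mean_eq P \<xi> v f (Suc k) t = integral\<^sup>L (P t) ?X" by (simp only: mean_eq_def)
  also have "\<dots> = enn2real (\<integral>\<^sup>+\<omega>. ennreal (?X \<omega>) \<partial>P t) - enn2real (\<integral>\<^sup>+\<omega>. ennreal (- ?X \<omega>) \<partial>P t)"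
    using t by (intro real_lebesgue_integral_def integrable_card_ge) simp
  also have "\<dots> = (t / t\<^sub>0) ^ k * (enn2real (\<integral>\<^sup>+\<omega>. ennreal (?Y \<omega>) \<partial>P t\<^sub>0) - enn2real (\<integral>\<^sup>+\<omega>. ennreal (- ?Y \<omega>) \<partial>P t\<^sub>0))"
    unfolding pos neg enn2real_mult using t t0 by (simp add: right_diff_distrib)
  also have "enn2real (\<integral>\<^sup>+\<omega>. ennreal (?Y \<omega>) \<partial>P t\<^sub>0) - enn2real (\<integral>\<^sup>+\<omega>. ennreal (- ?Y \<omega>) \<partial>P t\<^sub>0) = integral\<^sup>L (P t\<^sub>0) ?Y"
    using t by (intro real_lebesgue_integral_def[symmetric] integrable_trimmed_exp) simp
  finally show ?thesis .
qed

lemma mean_eq_continuously_differentiable: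
  "\<exists>g. \<forall>t>t\<^sub>0. (mean_eq P \<xi> v f n has_real_derivative g t) (at t) \<and> isCont g t"
proof (cases n)
  case 0
  have "(mean_eq P \<xi> v f n has_real_derivative 0) (at t)" if "t\<^sub>0 < t" for t
    by (rule has_field_derivative_transform_within_open[where f="\<lambda>_. 0" and S="{0<..}"])
      (use that t0 0 in \<open>auto simp: mean_eq_0\<close>)
  then show ?thesis by (intro exI[of _ "\<lambda>_. 0"]) auto
next
  case (Suc k)
  define h where "h c = (\<integral>\<omega>. trimmed n \<omega> * exp (- c * hits \<omega>) \<partial>P t\<^sub>0)" for c
  define h' where "h' c = (\<integral>\<omega>. - (trimmed n \<omega> * hits \<omega> * exp (- c * hits \<omega>)) \<partial>P t\<^sub>0)" for c
  let ?g = "\<lambda>t. real k * (1 / t\<^sub>0 * (t / t\<^sub>0) ^ (k - Suc 0)) * h (t - t\<^sub>0) + h' (t - t\<^sub>0) * (t / t\<^sub>0) ^ k"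
  have h_deriv: "(h has_real_derivative h' c) (at c)" "isCont h' c" if "0 < c" for c
    unfolding h_def[abs_def] h'_def[abs_def]
    using integrable_trimmed measurable_hits(1)[OF t0] hits_nonneg that
    by (rule has_real_derivative_laplace, rule isCont_laplace_deriv)
  have shift: "((\<lambda>t. h (t - t\<^sub>0)) has_real_derivative h' (t - t\<^sub>0)) (at t)" if "t\<^sub>0 < t" for t
    by (rule DERIV_diff_shift[OF h_deriv(1)]) (use that in simp)
  have "(mean_eq P \<xi> v f n has_real_derivative ?g t) (at t) \<and> isCont ?g t" if t: "t\<^sub>0 < t" for t
  proof
    have "((\<lambda>t. (t / t\<^sub>0) ^ k) has_real_derivative real k * (1 / t\<^sub>0 * (t / t\<^sub>0) ^ (k - Suc 0))) (at t)"
      by (rule DERIV_power) (rule DERIV_cdivide[OF DERIV_ident])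
    then have "((\<lambda>t. (t / t\<^sub>0) ^ k * h (t - t\<^sub>0)) has_real_derivative ?g t) (at t)"
      by (rule DERIV_mult) (rule shift[OF t])
    then show "(mean_eq P \<xi> v f n has_real_derivative ?g t) (at t)"
      by (rule has_field_derivative_transform_within_open[where S="{t\<^sub>0<..}"])
        (use t Suc in \<open>auto simp: mean_eq_laplace h_def\<close>)
    have "isCont (\<lambda>t. h' (t - t\<^sub>0)) t"
      using h_deriv(2)[of "t - t\<^sub>0"] t by (intro isCont_o2[where g="h'" and f="\<lambda>t. t - t\<^sub>0"]) auto
    then show "isCont ?g t"
      using t0 DERIV_isCont[OF shift[OF t]] by (intro continuous_intros) auto
  qed
  then show ?thesis by (intro exI[of _ "?g"] allI impI)
qed

lemma has_derivative_mean_eq: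
  "t\<^sub>0 < t \<Longrightarrow> (mean_eq P \<xi> v f n has_real_derivative deriv (mean_eq P \<xi> v f n) t) (at t)"
  using mean_eq_continuously_differentiable[of n] DERIV_imp_deriv by metis

lemma isCont_deriv_mean_eq:
  assumes "t\<^sub>0 < t"
  shows "isCont (deriv (mean_eq P \<xi> v f n)) t"
proof -
  obtain g where g: "\<And>t. t\<^sub>0 < t \<Longrightarrow> (mean_eq P \<xi> v f n has_real_derivative g t) (at t) \<and> isCont g t"
    using mean_eq_continuously_differentiable[of n] by blast
  have "eventually (\<lambda>s. s \<in> {t\<^sub>0<..}) (nhds t)"
    using assms by (intro eventually_nhds_in_open) auto
  then have "eventually (\<lambda>s. deriv (mean_eq P \<xi> v f n) s = g s) (nhds t)"
    by eventually_elim (use g in \<open>auto intro: DERIV_imp_deriv\<close>)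
  then show ?thesis using g[OF assms] isCont_cong by blast
qed

lemma mean_le_eq_sum:
  assumes "t\<^sub>0 \<le> t"
  shows "mean_le P \<xi> v f n t = (\<Sum>k<n. mean_eq P \<xi> v f (Suc k) t)"
proof -
  have ind: "indicator {\<mu>. num (verts \<mu>) \<le> of_nat n} \<mu> =
      (\<Sum>k\<le>n. indicator {\<mu>. num (verts \<mu>) = of_nat k} \<mu> :: real)" for \<mu> :: "'a graph"
    by (cases "finite (verts \<mu>)")
      (auto simp: num_le_of_nat_iff num_eq_of_nat_iff indicator_def of_bool_def sum.delta)
  have "mean_le P \<xi> v f n t =
      (\<integral>\<omega>. (\<Sum>k\<le>n. f (C \<omega>) * indicator {\<mu>. num (verts \<mu>) = of_nat k} (C \<omega>)) \<partial>P t)"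
    by (simp only: mean_le_def ind sum_distrib_left)
  also have "\<dots> = (\<Sum>k\<le>n. mean_eq P \<xi> v f k t)"
    unfolding mean_eq_def using assms by (intro Bochner_Integration.integral_sum integrable_card_ge)
  also have "\<dots> = mean_eq P \<xi> v f 0 t + (\<Sum>k<n. mean_eq P \<xi> v f (Suc k) t)"
    by (rule sum.atMost_shift)
  finally show ?thesis using mean_eq_0[of t] assms t0 by simp
qed

lemma deriv_mean_le:
  assumes "t\<^sub>0 < t"
  shows "deriv (mean_le P \<xi> v f n) t = (\<Sum>k<n. deriv (mean_eq P \<xi> v f (Suc k)) t)"
proof -
  have "((\<lambda>t. \<Sum>k<n. mean_eq P \<xi> v f (Suc k) t) has_real_derivative
      (\<Sum>k<n. deriv (mean_eq P \<xi> v f (Suc k)) t)) (at t)"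
    using assms by (intro DERIV_sum has_derivative_mean_eq)
  then have "(mean_le P \<xi> v f n has_real_derivative (\<Sum>k<n. deriv (mean_eq P \<xi> v f (Suc k)) t)) (at t)"
    by (rule has_field_derivative_transform_within_open[where S="{t\<^sub>0<..}"])
      (use assms in \<open>auto simp: mean_le_eq_sum\<close>)
  then show ?thesis by (rule DERIV_imp_deriv)
qed

lemma mean_eq_sums:
  assumes t: "t\<^sub>0 \<le> t" and fin: "abs_mean_fin P \<xi> v f t < \<infinity>"
  shows "(\<lambda>k. mean_eq P \<xi> v f (Suc k) t) sums mean_fin P \<xi> v f t"
proof -
  have tp: "0 < t" using t t0 by simp
  have int: "integrable (P t) (\<lambda>\<omega>. f (C \<omega>) * indicator {\<mu>. num (verts \<mu>) < \<infinity>} (C \<omega>))"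
    using integrable_of_abs_mean_fin[OF tp fin, of "{..<\<infinity>}"] by simp
  have "(\<lambda>n. mean_le P \<xi> v f n t) \<longlonglongrightarrow> mean_fin P \<xi> v f t"
    unfolding mean_le_def mean_fin_def
  proof (rule integral_dominated_convergence)
    show "(\<lambda>\<omega>. f (C \<omega>) * indicator {\<mu>. num (verts \<mu>) < \<infinity>} (C \<omega>)) \<in> borel_measurable (P t)"
      using int by simp
    show "(\<lambda>\<omega>. f (C \<omega>) * indicator {\<mu>. num (verts \<mu>) \<le> of_nat n} (C \<omega>)) \<in> borel_measurable (P t)" for n
      using measurable_f_indicator[OF tp, of "{..of_nat n}"] by simp
    show "integrable (P t) (\<lambda>\<omega>. norm (f (C \<omega>) * indicator {\<mu>. num (verts \<mu>) < \<infinity>} (C \<omega>)))"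
      using int by (rule integrable_norm)
    show "AE \<omega> in P t. norm (f (C \<omega>) * indicator {\<mu>. num (verts \<mu>) \<le> of_nat n} (C \<omega>)) \<le>
        norm (f (C \<omega>) * indicator {\<mu>. num (verts \<mu>) < \<infinity>} (C \<omega>))" for n
      unfolding num_le_of_nat_iff num_less_top_iff by (intro AE_I2) (auto simp: indicator_def)
    show "AE \<omega> in P t. (\<lambda>n. f (C \<omega>) * indicator {\<mu>. num (verts \<mu>) \<le> of_nat n} (C \<omega>))
        \<longlonglongrightarrow> f (C \<omega>) * indicator {\<mu>. num (verts \<mu>) < \<infinity>} (C \<omega>)"
    proof (intro AE_I2 tendsto_eventually)
      fix \<omega>
      show "eventually (\<lambda>n. f (C \<omega>) * indicator {\<mu>. num (verts \<mu>) \<le> of_nat n} (C \<omega>) =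
          f (C \<omega>) * indicator {\<mu>. num (verts \<mu>) < \<infinity>} (C \<omega>)) sequentially"
        using eventually_ge_at_top[of "card (verts (C \<omega>))"]
        unfolding num_le_of_nat_iff num_less_top_iff by eventually_elim (simp add: indicator_def)
    qed
  qed
  then show ?thesis using t by (simp add: sums_def mean_le_eq_sum)
qed

end

end

theorem theorem8p8:
  fixes lam :: "'a::polish_space measure"
    and \<phi> :: "'a \<Rightarrow> 'a \<Rightarrow> real"
    and P :: "real \<Rightarrow> 'w measure"
    and \<eta> :: "'w \<Rightarrow> 'a set"
    and \<xi> :: "'w \<Rightarrow> 'a graph"
    and v :: 'a
    and f :: "'a graph \<Rightarrow> real"
    and t\<^sub>0 t\<^sub>1 :: real
  assumes lam_sets: "sets lam = sets borel"
    and lam_loc_finite: "\<And>B. B \<in> sets borel \<Longrightarrow> bounded B \<Longrightarrow> emeasure lam B < \<infinity>"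
    and lam_diffuse: "\<And>x. emeasure lam {x} = 0"
    and phi_measurable: "(\<lambda>(x, y). \<phi> x y) \<in> borel_measurable (borel \<Otimes>\<^sub>M borel)"
    and phi_range: "\<And>x y. 0 \<le> \<phi> x y \<and> \<phi> x y \<le> 1"
    and phi_sym: "\<And>x y. \<phi> x y = \<phi> y x"
    and phi_integral: "AE x in lam. (\<integral>\<^sup>+y. ennreal (\<phi> x y) \<partial>lam) < \<infinity>"
    and eta_poisson: "\<And>t. 0 < t \<Longrightarrow> poisson_process (P t) (scale_measure (ennreal t) lam) \<eta>"
    and xi_rcm: "\<And>t. 0 < t \<Longrightarrow> rcm (P t) \<phi> \<eta> v \<xi>"
    and f_measurable: "f \<in> borel_measurable graph_space"
    and t: "0 < t\<^sub>0" "t\<^sub>0 < t\<^sub>1"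
    and abs_finite: "\<And>t. t \<in> {t\<^sub>0..t\<^sub>1} \<Longrightarrow> abs_mean_fin P \<xi> v f t < \<infinity>"
    and deriv_summable: "\<And>t. t \<in> {t\<^sub>0<..t\<^sub>1} \<Longrightarrow> summable (\<lambda>k. deriv (mean_eq P \<xi> v f (Suc k)) t)"
    and deriv_tail: "\<And>\<epsilon>. \<epsilon> \<in> {0<..<t\<^sub>1 - t\<^sub>0} \<Longrightarrow>
      (\<lambda>n. SUP t\<in>{t\<^sub>0 + \<epsilon>..t\<^sub>1}. ennreal \<bar>\<Sum>j. deriv (mean_eq P \<xi> v f (n + 1 + j)) t\<bar>)
        \<longlonglongrightarrow> 0"
  shows "(\<forall>n\<ge>1. \<forall>t\<in>{t\<^sub>0<..t\<^sub>1}. mean_eq P \<xi> v f n differentiable (at t)) \<and>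
    (\<exists>f'. continuous_on {t\<^sub>0<..t\<^sub>1} f' \<and>
      (\<forall>t\<in>{t\<^sub>0<..t\<^sub>1}.
        (mean_fin P \<xi> v f has_real_derivative f' t) (at t within {t\<^sub>0<..t\<^sub>1}) \<and>
        (\<lambda>n. deriv (mean_le P \<xi> v f n) t) \<longlonglongrightarrow> f' t \<and>
        (\<lambda>n. deriv (mean_eq P \<xi> v f (Suc n)) t) sums f' t))"
proof -
  interpret rcm_family \<phi> lam v P \<eta> \<xi> f
    by unfold_locales (use assms in auto)
  have fin0: "abs_mean_fin P \<xi> v f t\<^sub>0 < \<infinity>" using abs_finite t by simp
  let ?F = "\<lambda>n. mean_eq P \<xi> v f (Suc n)"
  let ?D = "\<lambda>n. deriv (?F n)"
  define f' where "f' s = (\<Sum>n. ?D n s)" for s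
  have sums: "(\<lambda>n. ?D n s) sums f' s" if "s \<in> {t\<^sub>0<..t\<^sub>1}" for s
    unfolding f'_def using deriv_summable[OF that] by (rule summable_sums)
  \<comment> \<open>The tails of the series of derivatives are the distances to the partial sums.\<close>
  have unif: "uniform_limit {t\<^sub>0 + \<epsilon>..t\<^sub>1} (\<lambda>n s. \<Sum>i<n. ?D i s) f' sequentially"
    if \<epsilon>: "\<epsilon> \<in> {0<..<t\<^sub>1 - t\<^sub>0}" for \<epsilon>
  proof (rule uniform_limitI)
    fix e :: real assume "0 < e"
    then have "eventually (\<lambda>n. (SUP s\<in>{t\<^sub>0 + \<epsilon>..t\<^sub>1}. ennreal \<bar>\<Sum>j. deriv (mean_eq P \<xi> v f (n + 1 + j)) s\<bar>) < ennreal e)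
        sequentially"
      by (intro order_tendstoD(2)[OF deriv_tail[OF \<epsilon>]]) simp
    then show "eventually (\<lambda>n. \<forall>s\<in>{t\<^sub>0 + \<epsilon>..t\<^sub>1}. dist (\<Sum>i<n. ?D i s) (f' s) < e) sequentially"
    proof (eventually_elim, intro ballI)
      fix n s
      assume n: "(SUP s\<in>{t\<^sub>0 + \<epsilon>..t\<^sub>1}. ennreal \<bar>\<Sum>j. deriv (mean_eq P \<xi> v f (n + 1 + j)) s\<bar>) < ennreal e"
        and s: "s \<in> {t\<^sub>0 + \<epsilon>..t\<^sub>1}"
      have "ennreal \<bar>\<Sum>j. deriv (mean_eq P \<xi> v f (n + 1 + j)) s\<bar> < ennreal e"
        using s by (intro le_less_trans[OF SUP_upper n])
      then have "\<bar>\<Sum>j. deriv (mean_eq P \<xi> v f (n + 1 + j)) s\<bar> < e"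
        using \<open>0 < e\<close> by (simp add: ennreal_less_iff)
      moreover have "(\<Sum>j. ?D (j + n) s) = f' s - (\<Sum>i<n. ?D i s)"
        unfolding f'_def using deriv_summable[of s] s \<epsilon> by (intro suminf_minus_initial_segment) auto
      ultimately show "dist (\<Sum>i<n. ?D i s) (f' s) < e"
        by (simp add: dist_real_def abs_minus_commute add.commute)
    qed
  qed
  have local: "continuous (at s within {t\<^sub>0<..t\<^sub>1}) f' \<and>
      (mean_fin P \<xi> v f has_real_derivative f' s) (at s within {t\<^sub>0<..t\<^sub>1})"
    if s: "s \<in> {t\<^sub>0<..t\<^sub>1}" for s
  proof -
    \<comment> \<open>Uniform convergence is available on intervals that keep away from \<open>t\<^sub>0\<close>; this one is a
      neighbourhood of \<open>s\<close> within the half-open interval.\<close>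
    define \<epsilon> where "\<epsilon> = (s - t\<^sub>0) / 2"
    have \<epsilon>: "\<epsilon> \<in> {0<..<t\<^sub>1 - t\<^sub>0}" "t\<^sub>0 + \<epsilon> < s" using s by (auto simp: \<epsilon>_def field_simps)
    let ?K = "{t\<^sub>0 + \<epsilon>..t\<^sub>1}"
    have within: "at s within ?K = at s within {t\<^sub>0<..t\<^sub>1}"
      by (rule at_within_nhd[where S="{t\<^sub>0 + \<epsilon><..}"]) (use \<epsilon> in auto)
    have sK: "s \<in> ?K" using s \<epsilon> by auto
    have cont: "continuous_on ?K f'"
    proof (rule uniform_limit_theorem[OF _ unif[OF \<epsilon>(1)]])
      have "continuous_on ?K (\<lambda>s. \<Sum>i<n. ?D i s)" for n
        using \<epsilon> isCont_deriv_mean_eq[OF t(1) fin0]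
        by (intro continuous_on_sum continuous_at_imp_continuous_on) auto
      then show "eventually (\<lambda>n. continuous_on ?K (\<lambda>s. \<Sum>i<n. ?D i s)) sequentially" by simp
    qed simp
    have "\<exists>g. \<forall>x\<in>?K. (\<lambda>n. ?F n x) sums g x \<and> (g has_field_derivative f' x) (at x within ?K)"
    proof (rule has_field_derivative_series[OF _ _ unif[OF \<epsilon>(1)] sK])
      show "convex ?K" by simp
      show "(?F n has_field_derivative ?D n x) (at x within ?K)" if "x \<in> ?K" for n x
        using has_derivative_mean_eq[OF t(1) fin0, of x] that \<epsilon> by (auto intro: has_field_derivative_at_within)
      show "summable (\<lambda>n. ?F n s)"
        using mean_eq_sums[OF t(1) fin0, of s] s abs_finite[of s] by (auto simp: sums_iff)
    qed
    then obtain g where g: "\<And>x. x \<in> ?K \<Longrightarrow> (\<lambda>n. ?F n x) sums g x"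
      "\<And>x. x \<in> ?K \<Longrightarrow> (g has_field_derivative f' x) (at x within ?K)" by blast
    have "g x = mean_fin P \<xi> v f x" if "x \<in> ?K" for x
      using sums_unique2[OF g(1)[OF that] mean_eq_sums[OF t(1) fin0]] that \<epsilon> abs_finite[of x] by auto
    then have "(mean_fin P \<xi> v f has_real_derivative f' s) (at s within ?K)"
      by (intro has_field_derivative_transform_within[OF g(2)[OF sK] zero_less_one sK]) auto
    moreover have "continuous (at s within ?K) f'"
      using cont sK by (simp add: continuous_on_eq_continuous_within)
    ultimately show ?thesis by (simp only: within)
  qed
  show ?thesis
  proof (intro conjI exI[of _ f'] ballI allI impI)
    show "mean_eq P \<xi> v f n differentiable (at s)" if "s \<in> {t\<^sub>0<..t\<^sub>1}" for n s
      using has_derivative_mean_eq[OF t(1) fin0, of s n] that by (auto simp: real_differentiable_def)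
    show "continuous_on {t\<^sub>0<..t\<^sub>1} f'"
      using local by (simp add: continuous_on_eq_continuous_within)
    fix s assume s: "s \<in> {t\<^sub>0<..t\<^sub>1}"
    show "(mean_fin P \<xi> v f has_real_derivative f' s) (at s within {t\<^sub>0<..t\<^sub>1})"
      using local[OF s] by simp
    show "(\<lambda>n. ?D n s) sums f' s" using s by (rule sums)
    then show "(\<lambda>n. deriv (mean_le P \<xi> v f n) s) \<longlonglongrightarrow> f' s"
      using s deriv_mean_le[OF t(1) fin0, of s] by (simp add: sums_def)
  qed
qed

end
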